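(* There exist constants $h_0,C>0$, with $C$ independent of $h$, such that for all $h\in(0,h_0)$ and all $x=(u,U,z,Z)\in\mathbb V_h^{4N}$ there exists $y=(v,V,w,W)\in\mathbb V_h^{4N}$ satisfying $$\mathcal A(x;y)\ \ge\ C\Big(|||(u,U)|||_R^2+h^2|||u|||_F^2+h^2|||U|||_{F'}^2+|||z|||_D^2+|||Z|||_{D'}^2\Big)$$ and $$|||(u,U)|||_R^2+h^2|||u|||_F^2+h^2|||U|||_{F'}^2+|||z|||_D^2+|||Z|||_{D'}^2\ \ge\ C\,|||y|||_C^2 .$$
   Context: **Setting.** $n\in\{2,3\}$, $T>0$, $\Omega\subset\mathbb R^n$ is a connected bounded open set with smooth boundary, $\omega\subset\Omega$ is open, and $\chi_\omega$ is a fixed non-negative smooth function on $\overline\Omega$ localized in $\omega$ (vanishing on $\Omega\setminus\omega$). **Discretization.** $\tau=T/N$, $N\in\mathbb N$. $\Omega_h$ is a polyhedral approximation of $\Omega$ with $\mathrm{dist}(x,\partial\Omega)\le Ch^2$ for all $x\in\partial\Omega_h$; $\mathcal T_h$ is a conforming quasi-uniform triangulation of $\Omega_h$ with global mesh size $h$. The time step and $h$ are comparable in size ($\tau=\mathcal O(h)$, i.e. $c_1h\le\tau\le c_2h$ with fixed $c_1,c_2>0$). The family of meshes, with its constants, is fixed. $\mathbb V_h=\{v\in H^1_0(\Omega_h): v|_K\in\mathbb P_1(K)\ \forall K\in\mathcal T_h\}$, $(u,v)_h=\int_{\Omega_h}uv\,dx$, $a_h(u,v)=\int_{\Omega_h}\nabla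 u\cdot\nabla v\,dx$, $\|u\|_h=\sqrt{(u,u)_h}$. For discrete sequences, $\partial_\tau u^n=\frac{u^n-u^{n-1}}\tau$, $\partial_\tau^2u^n=\frac{u^n-2u^{n-1}+u^{n-2}}{\tau^2}$, $\tilde\partial_\tau^2u^n=\frac{u^n-2u^{n+1}+u^{n+2}}{\tau^2}$. $\chi_h$ is a non-negative continuous function on $\Omega_h$, affine on each $K\in\mathcal T_h$, with $\|\chi_\omega-\chi_h\|_{L^\infty(\Omega_h)}+h\|\chi_\omega-\chi_h\|_{W^{1,\infty}(\Omega_h)}\le Ch^2$, $C$ independent of $h$ ($\chi_\omega$ being smoothly extended to $\Omega\cup\Omega_h$). **Bilinear form.** $\mathbb V_h^{4N}=\mathbb V_h^{N+1}\times\mathbb V_h^{N+1}\times\mathbb V_h^{N-1}\times\mathbb V_h^{N-1}$ with elements $(u,U,z,Z)$, $u=(u^0,\dots,u^N)$, $U=(U^0,\dots,U^N)$, $z=(z^2,\dots,z^N)$, $Z=(Z^0,\dots,Z^{N-2})$. Set $$\mathcal G(u,z)=\tau\sum_{n=2}^N\big((\partial_\tau^2u^n,z^n)_h+a_h(u^n,z^n)\big),\quad \mathcal G^*(Z,U)=\tau\sum_{n=0}^{N-2}\big((Z^n,\tilde\partial_\tau^2U^n)_h+a_h(Z^n,U^n)\big).$$ For $x=(u,U,z,Z)$, $y=(v,V,w,W)$: $$\begin{aligned}\mathcal A(x;y)=\;&\mathcal G(v,z)+a_h(u^0,v^0)+a_h(u^N,v^N)+(\partial_\tau u^1,\partial_\tau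 v^1)_h+(\partial_\tau u^N,\partial_\tau v^N)_h\\&+\mathcal G^*(Z,V)-\tau\sum_{n=2}^N(\chi_hV^n,z^n)_h+h^2(\nabla U^N,\nabla V^N)_h+h^2(\partial_\tau\nabla U^N,\partial_\tau\nabla V^N)_h\\&+h^2(\partial_\tau\nabla U^1,\partial_\tau\nabla V^1)_h+\tau\sum_{n=1}^N(h\,\partial_\tau\nabla U^n,h\,\partial_\tau\nabla V^n)_h\\&+\mathcal G(u,w)-\tau\sum_{n=2}^N(\chi_hU^n,w^n)_h+\mathcal G^*(W,U).\end{aligned}$$ **Discrete (semi-)norms.** With $z^0=z^1=Z^{N-1}=Z^N=0$, $\mathcal I z^n=\tau\sum_{m=0}^n(1+m\tau)z^m$, $\tilde{\mathcal I}Z^n=\tau\sum_{m=n}^N(1+(N-m)\tau)Z^m$: $$\begin{aligned}|||(u,U)|||_R^2=\;&\|\nabla u^N\|_h^2+\|\partial_\tau u^N\|_h^2+\|\nabla u^0\|_h^2+\|\partial_\tau u^1\|_h^2+\tau\sum_{n=1}^N\|h\,\partial_\tau\nabla U^n\|_h^2\\&+h^2\|\nabla\partial_\tau U^N\|_h^2+h^2\|\partial_\tau\nabla U^1\|_h^2+h^2\|\nabla U^N\|_h^2,\\|||u|||_F^2=\;&\tau\sum_{n=1}^N(\|\partial_\tau u^n\|_h^2+\|\nabla u^n\|_h^2),\\|||U|||_{F'}^2=\;&\tau\sum_{n=2}^N(\|\partial_\tau^2U^n\|_h^2+\|\partial_\tau\nabla U^n\|_h^2+\|\partial_\tau U^n\|_h^2+\|\nabla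 U^n\|_h^2)+\|\partial_\tau U^1\|_h^2+\|\nabla U^1\|_h^2,\\|||z|||_D^2=\;&\tau\sum_{n=2}^N\|z^n\|_h^2+\tau\sum_{n=2}^N\|\nabla\mathcal Iz^n\|_h^2+\|\nabla\mathcal Iz^N\|_h^2+\|z^N\|_h^2,\\|||Z|||_{D'}^2=\;&\tau\sum_{n=0}^{N-2}\|Z^n\|_h^2+\tau\sum_{n=0}^{N-2}\|\nabla\tilde{\mathcal I}Z^n\|_h^2+\|\nabla\tilde{\mathcal I}Z^0\|_h^2+\|Z^0\|_h^2,\\|||(u,U,z,Z)|||_C^2=\;&|||(u,U)|||_R^2+\tau\sum_{n=2}^N\|z^n\|_h^2+\tau\sum_{n=0}^{N-2}\|Z^n\|_h^2.\end{aligned}$$ *)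

theory Defs
  imports "HOL-Analysis.Analysis" "HOL-Probability.Essential_Supremum"
begin

section \<open>Smooth functions and domains with smooth boundary\<close>

(* C^k; meaningful for open S only, since full derivatives at the points of S are used. *)
primrec Ck_on :: "'a::euclidean_space set \<Rightarrow> nat \<Rightarrow> ('a \<Rightarrow> real) \<Rightarrow> bool" where
  "Ck_on S 0 f \<longleftrightarrow> continuous_on S f"
| "Ck_on S (Suc k) f \<longleftrightarrow>
     (\<forall>x\<in>S. f differentiable (at x)) \<and>
     (\<forall>v. Ck_on S k (\<lambda>x. frechet_derivative f (at x) v))"

definition smooth_on :: "'a::euclidean_space set \<Rightarrow> ('a \<Rightarrow> real) \<Rightarrow> bool" where
  "smooth_on S f \<longleftrightarrow> open S \<and> (\<forall>k. Ck_on S k f)"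

definition classical_grad :: "('a::euclidean_space \<Rightarrow> real) \<Rightarrow> 'a \<Rightarrow> 'a" where
  "classical_grad f x = (\<Sum>i\<in>Basis. frechet_derivative f (at x) i *\<^sub>R i)"

(* Locally, the set is the negativity set of a smooth function without critical points;
   in particular it lies on one side of its boundary. *)
definition smooth_boundary :: "'a::euclidean_space set \<Rightarrow> bool" where
  "smooth_boundary \<Omega> \<longleftrightarrow>
     (\<forall>p\<in>frontier \<Omega>. \<exists>U \<phi>. p \<in> U \<and> smooth_on U \<phi> \<and>
        (\<forall>x\<in>U. classical_grad \<phi> x \<noteq> 0) \<and> \<Omega> \<inter> U = {x\<in>U. \<phi> x < 0})"


section \<open>Lebesgue and Sobolev spaces\<close>

(* Functions are total; only their values on the open set \<Omega> enter.  The completed Lebesgue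
   measure is used, so changes on null sets never affect measurability. *)

definition L2 :: "'a::euclidean_space set \<Rightarrow> ('a \<Rightarrow> 'b::euclidean_space) set" where
  "L2 \<Omega> = {f. f \<in> borel_measurable (lebesgue_on \<Omega>) \<and>
              integrable (lebesgue_on \<Omega>) (\<lambda>x. (norm (f x))\<^sup>2)}"

(* Used for scalar functions and, with the Euclidean inner product, for gradients. *)
definition L2_inner ::
    "'a::euclidean_space set \<Rightarrow> ('a \<Rightarrow> 'b::euclidean_space) \<Rightarrow> ('a \<Rightarrow> 'b) \<Rightarrow> real" where
  "L2_inner \<Omega> f g = integral\<^sup>L (lebesgue_on \<Omega>) (\<lambda>x. f x \<bullet> g x)"

definition L2_norm :: "'a::euclidean_space set \<Rightarrow> ('a \<Rightarrow> 'b::euclidean_space) \<Rightarrow> real" where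
  "L2_norm \<Omega> f = sqrt (L2_inner \<Omega> f f)"

definition test_functions :: "'a::euclidean_space set \<Rightarrow> ('a \<Rightarrow> real) set" where
  "test_functions \<Omega> = {\<phi>. smooth_on UNIV \<phi> \<and> (\<exists>K. compact K \<and> K \<subseteq> \<Omega> \<and> (\<forall>x. x \<notin> K \<longrightarrow> \<phi> x = 0))}"

definition has_weak_grad ::
    "'a::euclidean_space set \<Rightarrow> ('a \<Rightarrow> real) \<Rightarrow> ('a \<Rightarrow> 'a) \<Rightarrow> bool" where
  "has_weak_grad \<Omega> f g \<longleftrightarrow>
     (\<forall>K. compact K \<and> K \<subseteq> \<Omega> \<longrightarrow> f absolutely_integrable_on K \<and> g absolutely_integrable_on K) \<and>
     (\<forall>\<phi>\<in>test_functions \<Omega>. \<forall>i\<in>Basis.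
        integral\<^sup>L (lebesgue_on \<Omega>) (\<lambda>x. f x * (classical_grad \<phi> x \<bullet> i)) =
        - integral\<^sup>L (lebesgue_on \<Omega>) (\<lambda>x. (g x \<bullet> i) * \<phi> x))"

(* The weak gradient is unique only almost everywhere; one representative is chosen. *)
definition weak_grad :: "'a::euclidean_space set \<Rightarrow> ('a \<Rightarrow> real) \<Rightarrow> 'a \<Rightarrow> 'a" where
  "weak_grad \<Omega> f = (SOME g. has_weak_grad \<Omega> f g)"

definition H1 :: "'a::euclidean_space set \<Rightarrow> ('a \<Rightarrow> real) set" where
  "H1 \<Omega> = {f \<in> L2 \<Omega>. \<exists>g\<in>L2 \<Omega>. has_weak_grad \<Omega> f g}"

definition H1_norm :: "'a::euclidean_space set \<Rightarrow> ('a \<Rightarrow> real) \<Rightarrow> real" where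
  "H1_norm \<Omega> f = sqrt ((L2_norm \<Omega> f)\<^sup>2 + (L2_norm \<Omega> (weak_grad \<Omega> f))\<^sup>2)"

definition H1_0 :: "'a::euclidean_space set \<Rightarrow> ('a \<Rightarrow> real) set" where
  "H1_0 \<Omega> = {f \<in> H1 \<Omega>. \<exists>\<phi> :: nat \<Rightarrow> 'a \<Rightarrow> real.
     (\<forall>k. \<phi> k \<in> test_functions \<Omega>) \<and> (\<lambda>k. H1_norm \<Omega> (\<lambda>x. f x - \<phi> k x)) \<longlonglongrightarrow> 0}"

definition Linf_norm :: "'a::euclidean_space set \<Rightarrow> ('a \<Rightarrow> 'b::euclidean_space) \<Rightarrow> ereal" where
  "Linf_norm \<Omega> f = esssup (lebesgue_on \<Omega>) (\<lambda>x. ereal (norm (f x)))"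

definition W1inf_norm :: "'a::euclidean_space set \<Rightarrow> ('a \<Rightarrow> real) \<Rightarrow> ereal" where
  "W1inf_norm \<Omega> f = Linf_norm \<Omega> f + Linf_norm \<Omega> (weak_grad \<Omega> f)"


section \<open>Triangulations and the finite element space\<close>

(* Conformity is part of the library predicate triangulation: two elements meet in a common
   (possibly empty) face.  Elements are closed simplices of full dimension. *)
definition mesh_of :: "'a::euclidean_space set \<Rightarrow> 'a set set \<Rightarrow> bool" where
  "mesh_of \<Omega>h Th \<longleftrightarrow> Th \<noteq> {} \<and> triangulation Th \<and> (\<forall>K\<in>Th. int DIM('a) simplex K) \<and>
     \<Omega>h = interior (\<Union>Th)"

definition mesh_size :: "'a::euclidean_space set set \<Rightarrow> real" where
  "mesh_size Th = Max (diameter ` Th)"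

(* Shape regularity (diameter of an element bounded by \<sigma> times that of an inscribed ball)
   together with comparability of all element diameters to the mesh size. *)
definition quasi_uniform :: "real \<Rightarrow> real \<Rightarrow> 'a::euclidean_space set set \<Rightarrow> bool" where
  "quasi_uniform \<sigma> \<kappa> Th \<longleftrightarrow>
     (\<forall>K\<in>Th. (\<exists>x r. 0 < r \<and> cball x r \<subseteq> K \<and> diameter K \<le> \<sigma> * (2 * r)) \<and>
             mesh_size Th \<le> \<kappa> * diameter K)"

definition affine_fun_on :: "'a::euclidean_space set \<Rightarrow> ('a \<Rightarrow> real) \<Rightarrow> bool" where
  "affine_fun_on K f \<longleftrightarrow> (\<exists>a b. \<forall>x\<in>K. f x = a \<bullet> x + b)"

(* Affineness on the closed elements selects the continuous representative; extension by zero
   makes the representation of an element of the space as a total function unique. *)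
definition Vh :: "'a::euclidean_space set \<Rightarrow> 'a set set \<Rightarrow> ('a \<Rightarrow> real) set" where
  "Vh \<Omega>h Th = {v \<in> H1_0 \<Omega>h. (\<forall>K\<in>Th. affine_fun_on K v) \<and> (\<forall>x. x \<notin> \<Union>Th \<longrightarrow> v x = 0)}"

definition a_form :: "'a::euclidean_space set \<Rightarrow> ('a \<Rightarrow> real) \<Rightarrow> ('a \<Rightarrow> real) \<Rightarrow> real" where
  "a_form \<Omega>h u v = L2_inner \<Omega>h (weak_grad \<Omega>h u) (weak_grad \<Omega>h v)"


section \<open>Discrete time sequences\<close>

type_synonym 'a tseq = "nat \<Rightarrow> 'a \<Rightarrow> real"

definition dt :: "real \<Rightarrow> (nat \<Rightarrow> 'a \<Rightarrow> 'b::real_vector) \<Rightarrow> nat \<Rightarrow> 'a \<Rightarrow> 'b" where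
  "dt \<tau> u n = (\<lambda>x. (u n x - u (n - 1) x) /\<^sub>R \<tau>)"

definition dtt :: "real \<Rightarrow> (nat \<Rightarrow> 'a \<Rightarrow> 'b::real_vector) \<Rightarrow> nat \<Rightarrow> 'a \<Rightarrow> 'b" where
  "dtt \<tau> u n = (\<lambda>x. (u n x - 2 *\<^sub>R u (n - 1) x + u (n - 2) x) /\<^sub>R \<tau>\<^sup>2)"

definition dtt_fwd :: "real \<Rightarrow> (nat \<Rightarrow> 'a \<Rightarrow> 'b::real_vector) \<Rightarrow> nat \<Rightarrow> 'a \<Rightarrow> 'b" where
  "dtt_fwd \<tau> u n = (\<lambda>x. (u n x - 2 *\<^sub>R u (n + 1) x + u (n + 2) x) /\<^sub>R \<tau>\<^sup>2)"

definition seqs_on :: "nat set \<Rightarrow> ('a \<Rightarrow> real) set \<Rightarrow> 'a tseq set" where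
  "seqs_on J V = {u. (\<forall>n\<in>J. u n \<in> V) \<and> (\<forall>n. n \<notin> J \<longrightarrow> u n = (\<lambda>x. 0))}"

(* The indices of Z are 0, ..., N-2, i.e. n < N-1.  Outside its index set a sequence is zero,
   which contains the conventions z^0 = z^1 = 0 and Z^(N-1) = Z^N = 0. *)
definition Vh4N :: "'a::euclidean_space set \<Rightarrow> 'a set set \<Rightarrow> nat \<Rightarrow>
    ('a tseq \<times> 'a tseq \<times> 'a tseq \<times> 'a tseq) set" where
  "Vh4N \<Omega>h Th N = seqs_on {0..N} (Vh \<Omega>h Th) \<times> seqs_on {0..N} (Vh \<Omega>h Th) \<times>
                  seqs_on {2..N} (Vh \<Omega>h Th) \<times> seqs_on {0..<N - 1} (Vh \<Omega>h Th)"

definition G_form :: "'a::euclidean_space set \<Rightarrow> real \<Rightarrow> nat \<Rightarrow> 'a tseq \<Rightarrow> 'a tseq \<Rightarrow> real" where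
  "G_form \<Omega>h \<tau> N u z =
     \<tau> * (\<Sum>n=2..N. L2_inner \<Omega>h (dtt \<tau> u n) (z n) + a_form \<Omega>h (u n) (z n))"

definition Gstar_form :: "'a::euclidean_space set \<Rightarrow> real \<Rightarrow> nat \<Rightarrow> 'a tseq \<Rightarrow> 'a tseq \<Rightarrow> real" where
  "Gstar_form \<Omega>h \<tau> N Z U =
     \<tau> * (\<Sum>n=0..<N - 1. L2_inner \<Omega>h (Z n) (dtt_fwd \<tau> U n) + a_form \<Omega>h (Z n) (U n))"

definition A_form :: "'a::euclidean_space set \<Rightarrow> ('a \<Rightarrow> real) \<Rightarrow> real \<Rightarrow> real \<Rightarrow> nat \<Rightarrow>
    'a tseq \<times> 'a tseq \<times> 'a tseq \<times> 'a tseq \<Rightarrow>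
    'a tseq \<times> 'a tseq \<times> 'a tseq \<times> 'a tseq \<Rightarrow> real" where
  "A_form \<Omega>h chi h \<tau> N = (\<lambda>(u, U, z, Z) (v, V, w, W).
     let grad = weak_grad \<Omega>h; ip = L2_inner \<Omega>h; ipg = L2_inner \<Omega>h in
       G_form \<Omega>h \<tau> N v z
     + a_form \<Omega>h (u 0) (v 0) + a_form \<Omega>h (u N) (v N)
     + ip (dt \<tau> u 1) (dt \<tau> v 1) + ip (dt \<tau> u N) (dt \<tau> v N)
     + Gstar_form \<Omega>h \<tau> N Z V
     - \<tau> * (\<Sum>n=2..N. ip (\<lambda>x. chi x * V n x) (z n))
     + h\<^sup>2 * ipg (grad (U N)) (grad (V N))
     + h\<^sup>2 * ipg (dt \<tau> (\<lambda>n. grad (U n)) N) (dt \<tau> (\<lambda>n. grad (V n)) N)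
     + h\<^sup>2 * ipg (dt \<tau> (\<lambda>n. grad (U n)) 1) (dt \<tau> (\<lambda>n. grad (V n)) 1)
     + \<tau> * (\<Sum>n=1..N. ipg (\<lambda>x. h *\<^sub>R dt \<tau> (\<lambda>n. grad (U n)) n x)
                          (\<lambda>x. h *\<^sub>R dt \<tau> (\<lambda>n. grad (V n)) n x))
     + G_form \<Omega>h \<tau> N u w
     - \<tau> * (\<Sum>n=2..N. ip (\<lambda>x. chi x * U n x) (w n))
     + Gstar_form \<Omega>h \<tau> N W U)"


section \<open>Discrete norms\<close>

(* All quantities norm_..._sq are squares of the respective (semi-)norms. *)

definition I_op :: "real \<Rightarrow> 'a tseq \<Rightarrow> 'a tseq" where
  "I_op \<tau> z n = (\<lambda>x. \<tau> * (\<Sum>m=0..n. (1 + real m * \<tau>) * z m x))"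

definition I_op_bwd :: "real \<Rightarrow> nat \<Rightarrow> 'a tseq \<Rightarrow> 'a tseq" where
  "I_op_bwd \<tau> N Z n = (\<lambda>x. \<tau> * (\<Sum>m=n..N. (1 + (real N - real m) * \<tau>) * Z m x))"

definition norm_R_sq :: "'a::euclidean_space set \<Rightarrow> real \<Rightarrow> real \<Rightarrow> nat \<Rightarrow>
    'a tseq \<Rightarrow> 'a tseq \<Rightarrow> real" where
  "norm_R_sq \<Omega>h h \<tau> N u U = (let grad = weak_grad \<Omega>h in
     (L2_norm \<Omega>h (grad (u N)))\<^sup>2 + (L2_norm \<Omega>h (dt \<tau> u N))\<^sup>2
   + (L2_norm \<Omega>h (grad (u 0)))\<^sup>2 + (L2_norm \<Omega>h (dt \<tau> u 1))\<^sup>2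
   + \<tau> * (\<Sum>n=1..N. (L2_norm \<Omega>h (\<lambda>x. h *\<^sub>R dt \<tau> (\<lambda>n. grad (U n)) n x))\<^sup>2)
   + h\<^sup>2 * (L2_norm \<Omega>h (grad (dt \<tau> U N)))\<^sup>2
   + h\<^sup>2 * (L2_norm \<Omega>h (dt \<tau> (\<lambda>n. grad (U n)) 1))\<^sup>2
   + h\<^sup>2 * (L2_norm \<Omega>h (grad (U N)))\<^sup>2)"

definition norm_F_sq :: "'a::euclidean_space set \<Rightarrow> real \<Rightarrow> nat \<Rightarrow> 'a tseq \<Rightarrow> real" where
  "norm_F_sq \<Omega>h \<tau> N u =
     \<tau> * (\<Sum>n=1..N. (L2_norm \<Omega>h (dt \<tau> u n))\<^sup>2 + (L2_norm \<Omega>h (weak_grad \<Omega>h (u n)))\<^sup>2)"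

definition norm_F'_sq :: "'a::euclidean_space set \<Rightarrow> real \<Rightarrow> nat \<Rightarrow> 'a tseq \<Rightarrow> real" where
  "norm_F'_sq \<Omega>h \<tau> N U = (let grad = weak_grad \<Omega>h in
     \<tau> * (\<Sum>n=2..N. (L2_norm \<Omega>h (dtt \<tau> U n))\<^sup>2
                   + (L2_norm \<Omega>h (dt \<tau> (\<lambda>n. grad (U n)) n))\<^sup>2
                   + (L2_norm \<Omega>h (dt \<tau> U n))\<^sup>2
                   + (L2_norm \<Omega>h (grad (U n)))\<^sup>2)
   + (L2_norm \<Omega>h (dt \<tau> U 1))\<^sup>2 + (L2_norm \<Omega>h (grad (U 1)))\<^sup>2)"

definition norm_D_sq :: "'a::euclidean_space set \<Rightarrow> real \<Rightarrow> nat \<Rightarrow> 'a tseq \<Rightarrow> real" where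
  "norm_D_sq \<Omega>h \<tau> N z =
     \<tau> * (\<Sum>n=2..N. (L2_norm \<Omega>h (z n))\<^sup>2)
   + \<tau> * (\<Sum>n=2..N. (L2_norm \<Omega>h (weak_grad \<Omega>h (I_op \<tau> z n)))\<^sup>2)
   + (L2_norm \<Omega>h (weak_grad \<Omega>h (I_op \<tau> z N)))\<^sup>2
   + (L2_norm \<Omega>h (z N))\<^sup>2"

definition norm_D'_sq :: "'a::euclidean_space set \<Rightarrow> real \<Rightarrow> nat \<Rightarrow> 'a tseq \<Rightarrow> real" where
  "norm_D'_sq \<Omega>h \<tau> N Z =
     \<tau> * (\<Sum>n=0..<N - 1. (L2_norm \<Omega>h (Z n))\<^sup>2)
   + \<tau> * (\<Sum>n=0..<N - 1. (L2_norm \<Omega>h (weak_grad \<Omega>h (I_op_bwd \<tau> N Z n)))\<^sup>2)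
   + (L2_norm \<Omega>h (weak_grad \<Omega>h (I_op_bwd \<tau> N Z 0)))\<^sup>2
   + (L2_norm \<Omega>h (Z 0))\<^sup>2"

definition norm_C_sq :: "'a::euclidean_space set \<Rightarrow> real \<Rightarrow> real \<Rightarrow> nat \<Rightarrow>
    'a tseq \<times> 'a tseq \<times> 'a tseq \<times> 'a tseq \<Rightarrow> real" where
  "norm_C_sq \<Omega>h h \<tau> N = (\<lambda>(u, U, z, Z).
     norm_R_sq \<Omega>h h \<tau> N u U
   + \<tau> * (\<Sum>n=2..N. (L2_norm \<Omega>h (z n))\<^sup>2)
   + \<tau> * (\<Sum>n=0..<N - 1. (L2_norm \<Omega>h (Z n))\<^sup>2))"

definition stab_sq :: "'a::euclidean_space set \<Rightarrow> real \<Rightarrow> real \<Rightarrow> nat \<Rightarrow>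
    'a tseq \<times> 'a tseq \<times> 'a tseq \<times> 'a tseq \<Rightarrow> real" where
  "stab_sq \<Omega>h h \<tau> N = (\<lambda>(u, U, z, Z).
     norm_R_sq \<Omega>h h \<tau> N u U + h\<^sup>2 * norm_F_sq \<Omega>h \<tau> N u + h\<^sup>2 * norm_F'_sq \<Omega>h \<tau> N U
   + norm_D_sq \<Omega>h \<tau> N z + norm_D'_sq \<Omega>h \<tau> N Z)"

end

theory Submission
  imports Defs "HOL-Library.Function_Algebras"
begin

text \<open>Testing with \<open>(u, U, -z, -Z)\<close> makes every coupling term cancel and leaves exactly the seminorm
\<open>R(u,U)\<close>, because the stabilisation of \<open>A\<close> is the polarisation of \<open>R\<close>.  Each of the four remaining parts of
the stability norm is produced by one small perturbation of this test function:

\<^item> \<open>D(z)\<close> by perturbing \<open>v\<close> with the weighted time integral \<open>I z\<close>.  The second difference of \<open>I z\<close> is a weighted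
  difference quotient of \<open>z\<close>, and \<open>z\<close> itself is a weighted difference quotient of \<open>I z\<close>; since the weight
  \<open>1 + n \<tau>\<close> increases, summation by parts in \<open>G(I z, z)\<close> leaves only nonnegative terms (\<open>G_wsum_ge\<close>).
\<^item> \<open>D'(Z)\<close> by perturbing \<open>V\<close> with the backward integral of \<open>Z\<close>.  Reversing time turns \<open>G*\<close> into \<open>G\<close>, so this is
  the same estimate (\<open>Gs_wsum_bwd_ge\<close>).
\<^item> \<open>h^2 F(u)\<close> by perturbing \<open>w\<close> with \<open>h^2 (2T - n \<tau>)\<close> times the difference quotient of \<open>u\<close>: the energy estimate with a
  decreasing weight, whose initial energy is controlled by \<open>R\<close> (\<open>G_u_multiplier_ge\<close>).
\<^item> \<open>h^2\<close> times the squared second differences of \<open>U\<close> by perturbing \<open>W\<close> with \<open>h^2\<close> times these second differences; the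
  gradient term is summed by parts and then consists of quantities in \<open>R\<close> (\<open>Gs_U_multiplier_ge\<close>).  The other
  terms of \<open>h^2 F'(U)\<close> are bounded by \<open>R\<close>, since \<open>R\<close> contains the gradient of \<open>U\<close> at the final time and all its
  time differences (\<open>energy_U_le\<close>).

The cross terms are absorbed by choosing the sizes of the perturbations one after the other
(\<open>weighted_estimates_combine\<close>).  The argument uses only three forms, namely the inner product of \<open>L^2\<close>, the
Dirichlet form and the coupling by \<open>\<chi>\<close>, together with Poincare's inequality, the inverse inequality
\<open>h \<parallel>\<nabla>v\<parallel> \<le> C \<parallel>v\<parallel>\<close>, the bound \<open>\<tau> \<le> C h\<close> and the boundedness of \<open>\<chi>\<close>.  It is therefore carried out for abstract
forms (\<open>discrete_wave\<close>, \<open>discrete_inf_sup\<close>).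

The first half of the text provides these ingredients with constants independent of \<open>h\<close>.  The weak gradient is
an arbitrary representative, so even the bilinearity of the Dirichlet form rests on the uniqueness of weak
gradients, that is on the fundamental lemma of the calculus of variations.  The constant in
Poincare's inequality is uniform because the approximate domains lie in one fixed ball.  The inverse inequality holds because each element
contains a ball of radius comparable to \<open>h\<close>.\<close>

section \<open>Smooth cut-off functions\<close>

lemma Ck_on_Suc_imp: "Ck_on UNIV (Suc k) f \<Longrightarrow> Ck_on UNIV k f"
proof (induction k arbitrary: f)
  case 0
  then show ?case by (auto intro!: differentiable_imp_continuous_on simp: differentiable_on_def)
next
  case (Suc k)
  have "f differentiable (at x)" for x using Suc.prems by simp
  moreover have "Ck_on UNIV k (\<lambda>x. frechet_derivative f (at x) v)" for v
    by (rule Suc.IH) (use Suc.prems in \<open>subst (asm) Ck_on.simps, blast\<close>)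
  ultimately show ?case by (simp only: Ck_on.simps) blast
qed

lemma Ck_on_const: "Ck_on UNIV k (\<lambda>x. c)"
  by (induction k arbitrary: c) (auto simp: frechet_derivative_const)

lemma Ck_on_inner: "Ck_on UNIV k (\<lambda>x. x \<bullet> i)"
proof (cases k)
  case (Suc m)
  have *: "((\<lambda>x. x \<bullet> i) has_derivative (\<lambda>h. h \<bullet> i)) (at x)" for x by (auto intro!: derivative_eq_intros)
  then have "frechet_derivative (\<lambda>x. x \<bullet> i) (at x) = (\<lambda>h. h \<bullet> i)" for x
    using frechet_derivative_at by metis
  with * show ?thesis by (auto simp: Suc Ck_on_const differentiable_def)
qed (auto intro!: continuous_intros)

lemma Ck_on_add: "Ck_on UNIV k f \<Longrightarrow> Ck_on UNIV k g \<Longrightarrow> Ck_on UNIV k (\<lambda>x. f x + g x)"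
proof (induction k arbitrary: f g)
  case 0
  then show ?case by (auto intro!: continuous_intros)
next
  case (Suc k)
  have d: "f differentiable (at x)" "g differentiable (at x)" for x using Suc.prems by auto
  have *: "((\<lambda>x. f x + g x) has_derivative (\<lambda>v. frechet_derivative f (at x) v + frechet_derivative g (at x) v)) (at x)" for x
    using d by (intro derivative_intros) (auto simp: frechet_derivative_works[symmetric])
  have "frechet_derivative (\<lambda>x. f x + g x) (at x) = (\<lambda>v. frechet_derivative f (at x) v + frechet_derivative g (at x) v)" for x
    using frechet_derivative_at[OF *] by simp
  moreover have "(\<lambda>x. f x + g x) differentiable (at x)" for x using * by (auto simp: differentiable_def)
  ultimately show ?case using Suc by auto
qed

lemma Ck_on_mult: "Ck_on UNIV k f \<Longrightarrow> Ck_on UNIV k g \<Longrightarrow> Ck_on UNIV k (\<lambda>x. f x * g x)"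
proof (induction k arbitrary: f g)
  case 0
  then show ?case by (auto intro!: continuous_intros)
next
  case (Suc k)
  have d: "f differentiable (at x)" "g differentiable (at x)" for x using Suc.prems by auto
  have *: "((\<lambda>x. f x * g x) has_derivative (\<lambda>v. f x * frechet_derivative g (at x) v + frechet_derivative f (at x) v * g x)) (at x)" for x
    using d by (intro derivative_intros) (auto simp: frechet_derivative_works[symmetric])
  have "frechet_derivative (\<lambda>x. f x * g x) (at x) = (\<lambda>v. f x * frechet_derivative g (at x) v + frechet_derivative f (at x) v * g x)" for x
    using frechet_derivative_at[OF *] by simp
  moreover have "Ck_on UNIV k f" "Ck_on UNIV k g" using Suc.prems Ck_on_Suc_imp by blast+
  moreover have "(\<lambda>x. f x * g x) differentiable (at x)" for x using * by (auto simp: differentiable_def)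
  ultimately show ?case using Suc by (auto intro!: Ck_on_add Suc.IH)
qed

text \<open>The chain rule leads from \<open>\<phi> P\<close> to \<open>\<phi> (D P)\<close>; indexing a whole family of outer functions that is closed under
differentiation makes the induction on the order work with products only.\<close>

lemma Ck_on_compose:
  fixes \<phi> :: "'i \<Rightarrow> real \<Rightarrow> real"
  assumes \<phi>: "\<And>P t. (\<phi> P has_real_derivative \<phi> (D P) t) (at t)" and g: "\<And>k. Ck_on UNIV k g"
  shows "Ck_on UNIV k (\<lambda>x. \<phi> P (g x))"
proof (induction k arbitrary: P)
  case 0
  have "continuous_on UNIV (\<phi> P)" using \<phi> by (intro DERIV_continuous_on) (auto intro: DERIV_subset)
  moreover have "continuous_on UNIV g" using g[of 0] by simp
  ultimately show ?case by (auto intro: continuous_on_compose2)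
next
  case (Suc k)
  have d: "g differentiable (at x)" for x using g[of 1] by simp
  have *: "((\<lambda>x. \<phi> P (g x)) has_derivative (\<lambda>v. \<phi> (D P) (g x) * frechet_derivative g (at x) v)) (at x)" for x
  proof -
    have "(g has_derivative frechet_derivative g (at x)) (at x)" using d by (simp add: frechet_derivative_works[symmetric])
    from has_derivative_compose[OF this] \<phi>[of P "g x"] show ?thesis
      by (auto simp: has_field_derivative_def)
  qed
  have "frechet_derivative (\<lambda>x. \<phi> P (g x)) (at x) = (\<lambda>v. \<phi> (D P) (g x) * frechet_derivative g (at x) v)" for x
    using frechet_derivative_at[OF *] by simp
  moreover have "Ck_on UNIV k (\<lambda>x. frechet_derivative g (at x) v)" for v using g[of "Suc k"] by simp
  ultimately show ?case using * Suc by (auto simp: differentiable_def intro!: Ck_on_mult)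
qed

lemma Ck_on_prod: "(\<And>i. i \<in> A \<Longrightarrow> Ck_on UNIV k (f i)) \<Longrightarrow> Ck_on UNIV k (\<lambda>x. \<Prod>i\<in>A. f i x)"
  by (induction A rule: infinite_finite_induct) (auto intro!: Ck_on_const Ck_on_mult)

lemma smooth_on_const: "smooth_on UNIV (\<lambda>x. c)" and smooth_on_inner: "smooth_on UNIV (\<lambda>x. x \<bullet> i)"
  and smooth_on_add: "smooth_on UNIV f \<Longrightarrow> smooth_on UNIV g \<Longrightarrow> smooth_on UNIV (\<lambda>x. f x + g x)"
  and smooth_on_mult: "smooth_on UNIV f \<Longrightarrow> smooth_on UNIV g \<Longrightarrow> smooth_on UNIV (\<lambda>x. f x * g x)"
  by (auto simp: smooth_on_def Ck_on_const Ck_on_inner Ck_on_add Ck_on_mult)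

text \<open>The functions \<open>P(1/t) e^(-1/t)\<close>, extended by zero to \<open>t \<le> 0\<close>: a family that contains the classical flat function
and is closed under differentiation.\<close>

definition flat_exp :: "real poly \<Rightarrow> real \<Rightarrow> real" where
  "flat_exp P t = (if t > 0 then poly P (1 / t) * exp (- (1 / t)) else 0)"

lemma poly_exp_neg_tendsto_0: "((\<lambda>s::real. poly P s * exp (- s)) \<longlongrightarrow> 0) at_top"
proof -
  have "((\<lambda>s. \<Sum>i\<le>degree P. coeff P i * (s ^ i / exp s)) \<longlongrightarrow> (\<Sum>i\<le>degree P. coeff P i * 0)) at_top"
    by (intro tendsto_intros tendsto_power_div_exp_0)
  then show ?thesis
    by (simp add: poly_altdef sum_distrib_right exp_minus divide_inverse mult.assoc)
qed

text \<open>For \<open>t > 0\<close> this is the product rule.  At \<open>t = 0\<close> the difference quotient is again of the form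
\<open>Q(s) e^(-s)\<close> with \<open>s = 1/t\<close> tending to infinity, so it vanishes in the limit.\<close>

lemma flat_exp_deriv: "(flat_exp P has_real_derivative flat_exp ([:0, 0, 1:] * (P - pderiv P)) t) (at t)"
proof -
  consider "t > 0" | "t < 0" | "t = 0" by linarith
  then show ?thesis
  proof cases
    case 1
    have "((\<lambda>t. poly P (1 / t) * exp (- (1 / t))) has_real_derivative flat_exp ([:0, 0, 1:] * (P - pderiv P)) t) (at t)"
      using 1 by (auto intro!: derivative_eq_intros simp: flat_exp_def field_simps power2_eq_square)
    then show ?thesis
      by (rule has_field_derivative_transform_within_open[of _ _ _ "{0<..}"]) (use 1 in \<open>auto simp: flat_exp_def\<close>)
  next
    case 2
    have "((\<lambda>t. 0) has_real_derivative flat_exp ([:0, 0, 1:] * (P - pderiv P)) t) (at t)"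
      using 2 by (simp add: flat_exp_def)
    then show ?thesis
      by (rule has_field_derivative_transform_within_open[of _ _ _ "{..<0}"]) (use 2 in \<open>auto simp: flat_exp_def\<close>)
  next
    case 3
    have "((\<lambda>y. flat_exp P y / y) \<longlongrightarrow> 0) (at 0)"
    proof (rule filterlim_split_at)
      have "((\<lambda>y. poly (pCons 0 P) (inverse y) * exp (- inverse y)) \<longlongrightarrow> 0) (at_right 0)"
        by (rule filterlim_compose[OF poly_exp_neg_tendsto_0 filterlim_inverse_at_top_right])
      then show "((\<lambda>y. flat_exp P y / y) \<longlongrightarrow> 0) (at_right 0)"
        by (rule Lim_transform_eventually) (auto simp: eventually_at_right_field flat_exp_def field_simps intro!: exI[of _ 1])
      show "((\<lambda>y. flat_exp P y / y) \<longlongrightarrow> 0) (at_left 0)"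
        by (rule Lim_transform_eventually[OF tendsto_const]) (auto simp: eventually_at_left_field flat_exp_def intro!: exI[of _ "-1"])
    qed
    then show ?thesis by (simp add: 3 has_field_derivative_iff flat_exp_def)
  qed
qed

definition bump :: "real \<Rightarrow> real" where "bump = flat_exp 1"

lemma bump_simps: "bump t = (if t > 0 then exp (- (1 / t)) else 0)"
  by (simp add: bump_def flat_exp_def)

lemma smooth_on_bump: "smooth_on UNIV g \<Longrightarrow> smooth_on UNIV (\<lambda>x. bump (g x))"
  unfolding smooth_on_def bump_def using Ck_on_compose[of flat_exp "\<lambda>P. [:0, 0, 1:] * (P - pderiv P)" g, OF flat_exp_deriv] by blast

definition box_bump :: "'a::euclidean_space \<Rightarrow> 'a \<Rightarrow> 'a \<Rightarrow> real" where
  "box_bump a b x = (\<Prod>i\<in>Basis. bump (x \<bullet> i - a \<bullet> i) * bump (b \<bullet> i - x \<bullet> i))"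

lemma box_bump_pos: "x \<in> box a b \<Longrightarrow> 0 < box_bump a b x"
  by (auto simp: box_bump_def mem_box bump_simps intro!: prod_pos)

lemma box_bump_zero: "x \<notin> box a b \<Longrightarrow> box_bump a b x = 0"
proof -
  assume "x \<notin> box a b"
  then obtain i where "i \<in> Basis" "\<not> (a \<bullet> i < x \<bullet> i \<and> x \<bullet> i < b \<bullet> i)" by (auto simp: mem_box)
  then show "box_bump a b x = 0"
    unfolding box_bump_def by (intro prod_zero) (auto simp: bump_simps intro!: bexI[of _ i])
qed

lemma smooth_on_box_bump: "smooth_on UNIV (box_bump a b)"
proof -
  have "smooth_on UNIV (\<lambda>x. x \<bullet> i + (- (a \<bullet> i)))" "smooth_on UNIV (\<lambda>x. x \<bullet> (- i) + b \<bullet> i)" for i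
    by (intro smooth_on_add smooth_on_inner smooth_on_const)+
  then have "smooth_on UNIV (\<lambda>x. bump (x \<bullet> i - a \<bullet> i) * bump (b \<bullet> i - x \<bullet> i))" for i
    by (intro smooth_on_mult smooth_on_bump) simp_all
  then show ?thesis
    unfolding box_bump_def[abs_def] smooth_on_def by (auto intro!: Ck_on_prod)
qed

text \<open>If \<open>\<psi>\<close> is smooth and positive exactly on the box, then \<open>exp (-1 / (k \<psi>))\<close> tends to 1 on the box as \<open>k\<close> grows and
is 0 outside.  The same flat function thus serves for localisation and for sharpening.\<close>

lemma box_cutoff_exists:
  fixes a b :: "'a::euclidean_space"
  assumes "cbox a b \<subseteq> \<Omega>"
  shows "\<exists>\<phi>. (\<forall>k::nat. \<phi> k \<in> test_functions \<Omega> \<and> (\<forall>x. 0 \<le> \<phi> k x \<and> \<phi> k x \<le> 1)) \<and> (\<forall>k x. x \<notin> box a b \<longrightarrow> \<phi> k x = 0) \<and>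
     (\<forall>x. (\<lambda>k. \<phi> k x) \<longlonglongrightarrow> indicator (box a b) x)"
proof (intro exI conjI allI impI)
  let ?\<phi> = "\<lambda>k::nat. \<lambda>x. bump (real k * box_bump a b x)"
  show "?\<phi> k \<in> test_functions \<Omega>" for k
    unfolding test_functions_def mem_Collect_eq
  proof (intro conjI exI allI impI)
    show "smooth_on UNIV (?\<phi> k)"
      by (intro smooth_on_bump smooth_on_mult smooth_on_const smooth_on_box_bump)
    show "compact (cbox a b)" "cbox a b \<subseteq> \<Omega>" using assms by auto
    fix x assume "x \<notin> cbox a b"
    then have "x \<notin> box a b" using box_subset_cbox by blast
    then show "?\<phi> k x = 0" by (simp add: box_bump_zero bump_simps)
  qed
  show "0 \<le> ?\<phi> k x" "?\<phi> k x \<le> 1" for k x by (auto simp: bump_simps)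
  show "?\<phi> k x = 0" if "x \<notin> box a b" for k x using that by (simp add: box_bump_zero bump_simps)
  show "(\<lambda>k. ?\<phi> k x) \<longlonglongrightarrow> indicator (box a b) x" for x
  proof (cases "x \<in> box a b")
    case True
    let ?c = "box_bump a b x"
    have c: "0 < ?c" by (rule box_bump_pos[OF True])
    have "(\<lambda>k. exp (- (1 / (real k * ?c)))) \<longlonglongrightarrow> exp (- 0)"
    proof (intro tendsto_intros)
      have "(\<lambda>k. (1 / real k) * (1 / ?c)) \<longlonglongrightarrow> 0 * (1 / ?c)"
        by (intro tendsto_intros lim_1_over_n)
      then show "(\<lambda>k. 1 / (real k * ?c)) \<longlonglongrightarrow> 0" by simp
    qed
    then have "(\<lambda>k. ?\<phi> k x) \<longlonglongrightarrow> exp (- 0)"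
      by (rule Lim_transform_eventually) (use c in \<open>auto simp: bump_simps eventually_sequentially intro!: exI[of _ 1]\<close>)
    then show ?thesis using True by simp
  qed (simp add: box_bump_zero bump_simps)
qed

section \<open>The fundamental lemma of the calculus of variations\<close>

lemma classical_grad_inner: 
  assumes "f differentiable (at x)"
  shows "classical_grad f x \<bullet> v = frechet_derivative f (at x) v"
proof -
  have lin: "linear (frechet_derivative f (at x))"
    using assms by (simp add: frechet_derivative_works has_derivative_linear)
  have "frechet_derivative f (at x) v = frechet_derivative f (at x) (\<Sum>i\<in>Basis. (v \<bullet> i) *\<^sub>R i)"
    by (simp add: euclidean_representation)
  also have "\<dots> = (\<Sum>i\<in>Basis. (v \<bullet> i) * frechet_derivative f (at x) i)"
    by (simp add: linear_sum[OF lin] linear_scale[OF lin])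
  finally show ?thesis
    by (simp add: classical_grad_def inner_sum_left inner_commute[of v] mult.commute)
qed

lemma integral_lebesgue_eq_lborel:
  fixes f :: "'a::euclidean_space \<Rightarrow> real"
  assumes "f \<in> borel_measurable borel"
  shows "integral\<^sup>L lebesgue f = integral\<^sup>L lborel f"
  using assms by (intro integral_completion) auto

lemma integrable_compact_support:
  fixes f :: "'a::euclidean_space \<Rightarrow> real"
  assumes "continuous_on UNIV f" "compact K" "\<And>x. x \<notin> K \<Longrightarrow> f x = 0"
  shows "integrable lborel f"
proof -
  have "integrable lborel (\<lambda>x. indicator K x *\<^sub>R f x)"
    using assms by (intro borel_integrable_compact) (auto intro: continuous_on_subset)
  also have "(\<lambda>x. indicator K x *\<^sub>R f x) = f" using assms(3) by (auto simp: indicator_def fun_eq_iff)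
  finally show ?thesis .
qed

lemma deriv_zero_off_support:
  assumes "compact K" "\<And>x. x \<notin> K \<Longrightarrow> \<psi> x = 0" "x \<notin> K"
  shows "frechet_derivative \<psi> (at x) v = (0::real)"
proof -
  have "(\<psi> has_derivative (\<lambda>v. 0)) (at x)"
    by (rule has_derivative_transform_within_open[of "\<lambda>x. 0" _ _ _ "- K"])
       (use assms compact_imp_closed in auto)
  then show ?thesis using frechet_derivative_at by (metis)
qed

text \<open>The integral of \<open>\<psi>(x + t v)\<close> does not depend on \<open>t\<close>, by translation invariance.  Its derivative at \<open>t = 0\<close> is the
integral of the directional derivative, by dominated convergence of the difference quotients.\<close>

lemma integral_directional_derivative_eq_0:
  fixes \<psi> :: "'a::euclidean_space \<Rightarrow> real"
  assumes sm: "smooth_on UNIV \<psi>" and K: "compact K" "\<And>x. x \<notin> K \<Longrightarrow> \<psi> x = 0"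
  shows "(\<integral>x. frechet_derivative \<psi> (at x) v \<partial>lebesgue) = 0"
    and "integrable lborel (\<lambda>x. frechet_derivative \<psi> (at x) v)"
proof -
  let ?D = "\<lambda>x. frechet_derivative \<psi> (at x) v"
  have C1: "Ck_on UNIV 1 \<psi>" and C0: "continuous_on UNIV \<psi>"
    using sm Ck_on.simps(1)[of UNIV \<psi>] unfolding smooth_on_def by blast+
  have diff: "\<psi> differentiable (at x)" and cD: "continuous_on UNIV ?D" for x using C1 by auto
  have D0: "?D x = 0" if "x \<notin> K" for x using deriv_zero_off_support[OF K that] by simp
  show iD: "integrable lborel ?D" using cD K(1) D0 by (rule integrable_compact_support)
  have i\<psi>: "integrable lborel \<psi>" using C0 K by (rule integrable_compact_support)
  obtain B where B: "\<And>x. \<bar>?D x\<bar> \<le> B" 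
  proof -
    have "bounded (?D ` K)" using cD K(1) by (intro compact_imp_bounded compact_continuous_image) (auto intro: continuous_on_subset)
    then obtain b where "\<And>x. x \<in> K \<Longrightarrow> \<bar>?D x\<bar> \<le> b" by (auto simp: bounded_iff)
    then have "\<bar>?D x\<bar> \<le> max b 0" for x using D0[of x] by (cases "x \<in> K") (auto simp: le_max_iff_disj)
    then show ?thesis using that by blast
  qed
  then have B0: "0 \<le> B" using order_trans[OF abs_ge_zero B] by blast
  obtain R where R: "K \<subseteq> cball 0 R" using compact_imp_bounded[OF K(1)] by (auto simp: bounded_iff subset_iff)
  \<comment> \<open>A ball that contains the supports of all difference quotients with step at most 1.\<close>
  define K' where "K' = cball (0::'a) (R + norm v)"
  define t where "t k = 1 / real (Suc k)" for k
  have t: "0 < t k" "t k \<le> 1" for k by (auto simp: t_def)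
  let ?q = "\<lambda>k x. (\<psi> (x + t k *\<^sub>R v) - \<psi> x) / t k"
  have line: "((\<lambda>s. \<psi> (x + s *\<^sub>R v)) has_real_derivative ?D (x + s *\<^sub>R v)) (at s)" for x s
  proof -
    have "((\<lambda>s. x + s *\<^sub>R v) has_derivative (\<lambda>s. s *\<^sub>R v)) (at s)" by (auto intro!: derivative_eq_intros)
    moreover have "(\<psi> has_derivative frechet_derivative \<psi> (at (x + s *\<^sub>R v))) (at (x + s *\<^sub>R v))"
      using diff frechet_derivative_works by blast
    ultimately have "((\<lambda>s. \<psi> (x + s *\<^sub>R v)) has_derivative (\<lambda>h. frechet_derivative \<psi> (at (x + s *\<^sub>R v)) (h *\<^sub>R v))) (at s)"
      by (rule has_derivative_compose)
    moreover have "frechet_derivative \<psi> (at y) (h *\<^sub>R v) = ?D y * h" for y h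
      using linear_scale[OF has_derivative_linear, of \<psi> "frechet_derivative \<psi> (at y)" "at y" h v] diff
      by (simp add: frechet_derivative_works)
    ultimately show ?thesis by (simp add: has_field_derivative_def)
  qed
  have bound: "\<bar>?q k x\<bar> \<le> B * indicator K' x" for k x
  proof (cases "x \<in> K'")
    case True
    obtain s where "\<psi> (x + t k *\<^sub>R v) - \<psi> (x + 0 *\<^sub>R v) = (t k - 0) * ?D (x + s *\<^sub>R v)"
      using MVT2[of 0 "t k" "\<lambda>s. \<psi> (x + s *\<^sub>R v)" "\<lambda>s. ?D (x + s *\<^sub>R v)"] line t by auto
    then have "?q k x = ?D (x + s *\<^sub>R v)" using t[of k] by simp
    then show ?thesis using B True by simp
  next
    case False
    have "norm (x + t k *\<^sub>R v) \<ge> norm x - norm (t k *\<^sub>R v)" using norm_diff_ineq by blast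
    moreover have "norm (t k *\<^sub>R v) \<le> norm v" using t[of k] mult_right_mono[of "t k" 1 "norm v"] by auto
    ultimately have "x \<notin> cball 0 R" "x + t k *\<^sub>R v \<notin> cball 0 R" using False norm_ge_zero[of v] by (auto simp: K'_def simp del: norm_ge_zero)
    then have "x \<notin> K" "x + t k *\<^sub>R v \<notin> K" using R by auto
    then show ?thesis using K(2) False by simp
  qed
  have int_q: "(\<integral>x. ?q k x \<partial>lborel) = 0" for k
  proof -
    have "(\<integral>x. \<psi> (x + t k *\<^sub>R v) \<partial>lborel) = (\<integral>x. \<psi> (t k *\<^sub>R v + x) \<partial>lborel)" by (simp add: add.commute)
    also have "\<dots> = (\<integral>x. \<psi> x \<partial>distr lborel borel ((+) (t k *\<^sub>R v)))"
      using C0 by (intro integral_distr[symmetric]) (auto intro: borel_measurable_continuous_onI)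
    also have "\<dots> = (\<integral>x. \<psi> x \<partial>lborel)" by (simp add: lborel_distr_plus)
    finally have eq: "(\<integral>x. \<psi> (x + t k *\<^sub>R v) \<partial>lborel) = (\<integral>x. \<psi> x \<partial>lborel)" .
    have "integrable lborel (\<lambda>x. \<psi> (x + t k *\<^sub>R v))"
    proof (rule integrable_compact_support)
      show "continuous_on UNIV (\<lambda>x. \<psi> (x + t k *\<^sub>R v))"
        by (rule continuous_on_compose2[OF C0]) (auto intro!: continuous_intros)
      show "compact ((\<lambda>x. x - t k *\<^sub>R v) ` K)" using K(1) by (intro compact_continuous_image continuous_intros)
      fix x assume "x \<notin> (\<lambda>x. x - t k *\<^sub>R v) ` K"
      then have "x + t k *\<^sub>R v \<notin> K" by (metis add_diff_cancel image_eqI)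
      then show "\<psi> (x + t k *\<^sub>R v) = 0" using K by simp
    qed
    then show ?thesis using i\<psi> eq by simp
  qed
  have "(\<lambda>k. \<integral>x. ?q k x \<partial>lborel) \<longlonglongrightarrow> (\<integral>x. ?D x \<partial>lborel)"
  proof (rule integral_dominated_convergence)
    show "integrable lborel (\<lambda>x. B * indicator K' x :: real)"
      using emeasure_bounded_finite[OF bounded_cball, of "0::'a" "R + norm v"]
      by (intro integrable_mult_right integrable_real_indicator) (auto simp: K'_def infinity_ennreal_def)
    show "?D \<in> borel_measurable lborel" using iD by simp
    have "(\<lambda>x. \<psi> (x + t k *\<^sub>R v)) \<in> borel_measurable borel" "\<psi> \<in> borel_measurable borel" for k
      by (auto intro!: borel_measurable_continuous_onI continuous_on_compose2[OF C0] continuous_intros C0)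
    then show "?q k \<in> borel_measurable lborel" for k by simp
    show "AE x in lborel. norm (?q k x) \<le> B * indicator K' x" for k using bound by auto
    show "AE x in lborel. (\<lambda>k. ?q k x) \<longlonglongrightarrow> ?D x"
    proof (rule AE_I2)
      fix x
      have "((\<lambda>s. (\<psi> (x + s *\<^sub>R v) - \<psi> x) / s) \<longlongrightarrow> ?D x) (at 0)"
        using line[of x 0] by (simp add: has_field_derivative_iff)
      moreover have "filterlim t (at 0) sequentially"
      proof (subst filterlim_at, intro conjI)
        show "t \<longlonglongrightarrow> 0" unfolding t_def using LIMSEQ_inverse_real_of_nat by (simp add: inverse_eq_divide)
        show "\<forall>\<^sub>F k in sequentially. t k \<in> UNIV \<and> t k \<noteq> 0" using t(1) by (intro always_eventually) (metis UNIV_I less_irrefl)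
      qed
      ultimately show "(\<lambda>k. ?q k x) \<longlonglongrightarrow> ?D x" by (rule filterlim_compose)
    qed
  qed
  then have "(\<integral>x. ?D x \<partial>lborel) = 0" unfolding int_q by (metis LIMSEQ_const_iff)
  then show "(\<integral>x. ?D x \<partial>lebesgue) = 0"
    using cD by (subst integral_lebesgue_eq_lborel) (auto intro: borel_measurable_continuous_onI)
qed

text \<open>Boxes generate the Borel sets and are stable under intersection, so the integral of \<open>f\<close> vanishes over every Borel
set.  The support condition provides the case of the whole space, which complements require.\<close>

lemma zero_box_integrals_imp_AE_zero:
  fixes f :: "'a::euclidean_space \<Rightarrow> real"
  assumes int: "integrable lebesgue f" and supp: "\<And>x. x \<notin> box a b \<Longrightarrow> f x = 0"
    and zero: "\<And>c d. (\<integral>x. indicator (box c d) x * f x \<partial>lebesgue) = 0"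
  shows "AE x in lebesgue. f x = 0"
proof -
  obtain g where g: "g \<in> borel_measurable lborel" and fg: "AE x in lborel. f x = g x"
    using completion_ex_borel_measurable_real[of f lborel] int by auto
  have fg': "AE x in lebesgue. f x = g x" using fg by (rule AE_completion)
  have g_leb: "g \<in> borel_measurable lebesgue" using g by (rule measurable_completion)
  have "integrable lebesgue g"
    using int fg' integrable_cong_AE[of f lebesgue g] g_leb by auto
  then have g_int: "integrable lborel g" using g integrable_completion by blast
  have LI: "(LINT x:A|lborel. g x) = (\<integral>x. indicator A x * f x \<partial>lebesgue)" if "A \<in> sets borel" for A
  proof -
    have "(LINT x:A|lborel. g x) = (\<integral>x. indicator A x * g x \<partial>lebesgue)"
      unfolding set_lebesgue_integral_def real_scaleR_def using that g by (intro integral_completion[symmetric]) auto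
    also have "\<dots> = (\<integral>x. indicator A x * f x \<partial>lebesgue)"
    proof (rule integral_cong_AE)
      have "A \<in> sets lebesgue" using that by simp
      then show "(\<lambda>x. indicator A x * g x) \<in> borel_measurable lebesgue" "(\<lambda>x. indicator A x * f x) \<in> borel_measurable lebesgue"
        using g_leb int by (auto intro!: borel_measurable_times)
      show "AE x in lebesgue. indicator A x * g x = indicator A x * f x" using fg' by eventually_elim simp
    qed
    finally show ?thesis .
  qed
  have total: "(\<integral>x. g x \<partial>lborel) = 0"
  proof -
    have "(\<integral>x. g x \<partial>lborel) = (LINT x:UNIV|lborel. g x)" by (simp add: set_lebesgue_integral_def)
    also have "\<dots> = (\<integral>x. indicator (box a b) x * f x \<partial>lebesgue)"
      by (subst LI) (auto intro!: Bochner_Integration.integral_cong simp: indicator_def supp)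
    finally show ?thesis using zero by simp
  qed
  have setint: "set_integrable lborel A g" if "A \<in> sets borel" for A
    unfolding set_integrable_def using that g_int by (intro integrable_mult_indicator) auto
  have "(LINT x:A|lborel. g x) = 0" if "A \<in> sets borel" for A
  proof -
    have sig: "A \<in> sigma_sets UNIV (range (\<lambda>(c, d). box c d :: 'a set))"
      using that unfolding borel_eq_box by simp
    have stable: "Int_stable (range (\<lambda>(c, d). box c d :: 'a set))"
      by (auto simp: Int_stable_def box_Int_box)
    have sub: "range (\<lambda>(c, d). box c d :: 'a set) \<subseteq> Pow UNIV" by simp
    show ?thesis
      using stable sub sig
    proof (induction rule: sigma_sets_induct_disjoint)
      case (basic A)
      then show ?case using zero by (auto simp: LI)
    next
      case empty
      then show ?case by (simp add: set_lebesgue_integral_def)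
    next
      case (compl A)
      then have A: "A \<in> sets borel" unfolding borel_eq_box by simp
      have "(LINT x:UNIV - A|lborel. g x) + (LINT x:A|lborel. g x) = (LINT x:(UNIV - A) \<union> A|lborel. g x)"
        by (rule set_integral_Un[symmetric]) (use A in \<open>auto intro!: setint\<close>)
      also have "\<dots> = 0" using total by (simp add: set_lebesgue_integral_def)
      finally show ?case using compl by simp
    next
      case (union A)
      then have A: "A i \<in> sets borel" for i unfolding borel_eq_box by auto
      have "(LINT x:(\<Union>i. A i)|lborel. g x) = (\<Sum>i. (LINT x:(A i)|lborel. g x))"
        by (rule lebesgue_integral_countable_add) (use A union in \<open>auto intro!: setint simp: disjoint_family_on_def\<close>)
      then show ?case using union by simp
    qed
  qed
  then have "AE x in lborel. g x = 0"
    using density_unique_real[of lborel g "\<lambda>_. 0"] g_int by (simp add: set_lebesgue_integral_def)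
  then have "AE x in lborel. f x = 0" using fg by eventually_elim simp
  then show ?thesis by (rule AE_completion)
qed

text \<open>Smooth cut-offs converge to the indicator function of a box, hence the integral of \<open>f\<close> over each box with closure
in \<open>\<Omega>\<close> is zero; countably many such closed boxes cover \<open>\<Omega>\<close>.\<close>

lemma fundamental_lemma_variations:
  fixes f :: "'a::euclidean_space \<Rightarrow> real"
  assumes op: "open \<Omega>" and loc: "\<And>K. compact K \<Longrightarrow> K \<subseteq> \<Omega> \<Longrightarrow> f absolutely_integrable_on K"
    and zero: "\<And>\<phi>. \<phi> \<in> test_functions \<Omega> \<Longrightarrow> integral\<^sup>L (lebesgue_on \<Omega>) (\<lambda>x. f x * \<phi> x) = 0"
  shows "AE x in lebesgue_on \<Omega>. f x = 0"
proof -
  have box_zero: "(\<integral>x. indicator (box c d) x * f x \<partial>lebesgue) = 0" if cd: "cbox c d \<subseteq> \<Omega>" for c d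
  proof -
    obtain \<phi> :: "nat \<Rightarrow> 'a \<Rightarrow> real" where \<phi>: "\<And>k. \<phi> k \<in> test_functions \<Omega>" "\<And>k x. 0 \<le> \<phi> k x \<and> \<phi> k x \<le> 1"
      "\<And>k x. x \<notin> box c d \<Longrightarrow> \<phi> k x = 0" "\<And>x. (\<lambda>k. \<phi> k x) \<longlonglongrightarrow> indicator (box c d) x"
      using box_cutoff_exists[OF cd] by metis
    have "set_integrable lebesgue (cbox c d) f" using loc[of "cbox c d"] cd by simp
    then have "set_integrable lebesgue (box c d) f"
      by (rule set_integrable_subset) (auto simp: box_subset_cbox)
    then have int: "integrable lebesgue (\<lambda>x. indicator (box c d) x * f x)" by (simp add: set_integrable_def)
    have \<phi>m: "\<phi> k \<in> borel_measurable lebesgue" for k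
    proof -
      have "Ck_on UNIV 0 (\<phi> k)" using \<phi>(1)[of k] unfolding test_functions_def smooth_on_def by blast
      then have "\<phi> k \<in> borel_measurable borel" by (intro borel_measurable_continuous_onI) simp
      then show ?thesis by (intro measurable_completion) simp
    qed
    have eq: "\<phi> k x * (indicator (box c d) x * f x) = indicator \<Omega> x *\<^sub>R (f x * \<phi> k x)" for k x
      using \<phi>(3)[of x k] cd box_subset_cbox[of c d] by (auto simp: indicator_def)
    have int0: "(\<integral>x. \<phi> k x * (indicator (box c d) x * f x) \<partial>lebesgue) = 0" for k
      unfolding eq using zero[OF \<phi>(1)[of k]] op by (simp add: integral_restrict_space)
    have "(\<lambda>k. \<integral>x. \<phi> k x * (indicator (box c d) x * f x) \<partial>lebesgue) \<longlonglongrightarrow> (\<integral>x. indicator (box c d) x * (indicator (box c d) x * f x) \<partial>lebesgue)"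
    proof (rule integral_dominated_convergence[where w = "\<lambda>x. \<bar>indicator (box c d) x * f x\<bar>"])
      show "AE x in lebesgue. (\<lambda>k. \<phi> k x * (indicator (box c d) x * f x)) \<longlonglongrightarrow> indicator (box c d) x * (indicator (box c d) x * f x)"
        by (intro AE_I2 tendsto_intros \<phi>(4))
      show "AE x in lebesgue. norm (\<phi> k x * (indicator (box c d) x * f x)) \<le> \<bar>indicator (box c d) x * f x\<bar>" for k
      proof (rule AE_I2)
        fix x
        have "\<bar>\<phi> k x\<bar> \<le> 1" using \<phi>(2)[of k x] by auto
        then show "norm (\<phi> k x * (indicator (box c d) x * f x)) \<le> \<bar>indicator (box c d) x * f x\<bar>"
          unfolding real_norm_def abs_mult[of "\<phi> k x"] by (intro mult_left_le_one_le) auto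
      qed
      show "(\<lambda>x. indicator (box c d) x * (indicator (box c d) x * f x)) \<in> borel_measurable lebesgue"
        by (rule borel_measurable_times[OF _ borel_measurable_integrable[OF int]]) (auto intro!: borel_measurable_indicator)
      show "(\<lambda>x. \<phi> k x * (indicator (box c d) x * f x)) \<in> borel_measurable lebesgue" for k
        by (rule borel_measurable_times[OF \<phi>m borel_measurable_integrable[OF int]])
    qed (use int in auto)
    then have "(\<integral>x. indicator (box c d) x * (indicator (box c d) x * f x) \<partial>lebesgue) = 0"
      unfolding int0 by (simp add: LIMSEQ_const_iff)
    moreover have "indicator (box c d) x * (indicator (box c d) x * f x) = indicator (box c d) x * f x" for x
      by (auto simp: indicator_def)
    ultimately show ?thesis by simp
  qed
  have cbox_AE: "AE x in lebesgue. x \<in> cbox a b \<longrightarrow> f x = 0" if ab: "cbox a b \<subseteq> \<Omega>" for a b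
  proof -
    let ?f = "\<lambda>x. indicator (box a b) x * f x"
    have "AE x in lebesgue. ?f x = 0"
    proof (rule zero_box_integrals_imp_AE_zero)
      have "set_integrable lebesgue (cbox a b) f" using loc[of "cbox a b"] ab by simp
      then have "set_integrable lebesgue (box a b) f"
        by (rule set_integrable_subset) (auto simp: box_subset_cbox)
      then show "integrable lebesgue ?f" by (simp add: set_integrable_def)
      show "?f x = 0" if "x \<notin> box a b" for x using that by simp
      fix c d :: 'a
      obtain c' d' where cd': "box c d \<inter> box a b = box c' d'"
        using box_Int_box[of c d a b] by blast
      have "(\<integral>x. indicator (box c d) x * ?f x \<partial>lebesgue) = (\<integral>x. indicator (box c' d') x * f x \<partial>lebesgue)"
        by (intro Bochner_Integration.integral_cong) (auto simp: indicator_def cd'[symmetric])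
      also have "\<dots> = 0"
      proof (cases "box c' d' = {}")
        case False
        have "closure (box c' d') \<subseteq> closure (box a b)" by (rule closure_mono) (use cd' in blast)
        moreover have "box a b \<noteq> {}" using False cd' by blast
        ultimately show ?thesis using False ab by (intro box_zero) (simp add: closure_box)
      qed simp
      finally show "(\<integral>x. indicator (box c d) x * ?f x \<partial>lebesgue) = 0" .
    qed
    moreover have "AE x in lebesgue. x \<notin> cbox a b - box a b"
      using negligible_frontier_interval[of a b] by (intro AE_not_in) (simp add: negligible_iff_null_sets)
    ultimately show ?thesis by eventually_elim (auto simp: indicator_def split: if_splits)
  qed
  have "\<exists>\<D>. countable \<D> \<and> \<D> \<subseteq> Pow \<Omega> \<and> (\<forall>X\<in>\<D>. \<exists>a b. X = cbox a b) \<and> \<Union>\<D> = \<Omega>"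
    by (rule open_countable_Union_open_cbox[OF op], rule exI, intro conjI ballI)
  then obtain \<D> where D: "countable \<D>" "\<D> \<subseteq> Pow \<Omega>" "\<forall>X\<in>\<D>. \<exists>a b. X = cbox a b" "\<Union>\<D> = \<Omega>" by blast
  have "AE x in lebesgue. \<forall>X\<in>\<D>. x \<in> X \<longrightarrow> f x = 0"
  proof (subst AE_ball_countable[OF D(1)], intro ballI)
    fix X assume X: "X \<in> \<D>"
    then obtain a b where ab: "X = cbox a b" using D(3) by blast
    then have "cbox a b \<subseteq> \<Omega>" using X D(2) by blast
    then show "AE x in lebesgue. x \<in> X \<longrightarrow> f x = 0" unfolding ab by (rule cbox_AE)
  qed
  then have "AE x in lebesgue. x \<in> \<Omega> \<longrightarrow> f x = 0"
    by eventually_elim (use D(4) in auto)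
  then show ?thesis using op by (simp add: AE_restrict_space_iff)
qed

section \<open>Weak gradients\<close>

lemma smooth_on_continuous: "smooth_on UNIV f \<Longrightarrow> continuous_on UNIV f"
  unfolding smooth_on_def using Ck_on.simps(1)[of UNIV f] by blast

lemma smooth_on_differentiable: "smooth_on UNIV f \<Longrightarrow> f differentiable (at x)"
  unfolding smooth_on_def using Ck_on.simps(2)[of UNIV 0 f] by blast

lemma smooth_on_deriv: "smooth_on UNIV f \<Longrightarrow> smooth_on UNIV (\<lambda>x. frechet_derivative f (at x) v)"
  unfolding smooth_on_def using Ck_on.simps(2)[of UNIV _ f] by blast

lemma smooth_on_classical_grad: "smooth_on UNIV f \<Longrightarrow> continuous_on UNIV (classical_grad f)"
  unfolding classical_grad_def[abs_def]
  by (intro continuous_intros smooth_on_continuous smooth_on_deriv)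

lemma test_functions_deriv:
  assumes "\<phi> \<in> test_functions \<Omega>"
  shows "(\<lambda>x. classical_grad \<phi> x \<bullet> v) \<in> test_functions \<Omega>"
proof -
  obtain K where K: "compact K" "K \<subseteq> \<Omega>" "\<And>x. x \<notin> K \<Longrightarrow> \<phi> x = 0" and sm: "smooth_on UNIV \<phi>"
    using assms by (auto simp: test_functions_def)
  have eq: "classical_grad \<phi> x \<bullet> v = frechet_derivative \<phi> (at x) v" for x
    using smooth_on_differentiable[OF sm] by (rule classical_grad_inner)
  show ?thesis
    unfolding eq test_functions_def
    using K smooth_on_deriv[OF sm, of v] deriv_zero_off_support[of K \<phi> _ v] by blast
qed

lemma test_functions_mult:
  assumes "\<phi> \<in> test_functions \<Omega>" "smooth_on UNIV f"
  shows "(\<lambda>x. f x * \<phi> x) \<in> test_functions \<Omega>"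
proof -
  obtain K where K: "compact K" "K \<subseteq> \<Omega>" "\<And>x. x \<notin> K \<Longrightarrow> \<phi> x = 0" and sm: "smooth_on UNIV \<phi>"
    using assms by (auto simp: test_functions_def)
  then show ?thesis
    unfolding test_functions_def using smooth_on_mult[OF assms(2) sm] by auto
qed

lemma test_functions_add:
  assumes "\<phi> \<in> test_functions \<Omega>" "\<psi> \<in> test_functions \<Omega>"
  shows "(\<lambda>x. \<phi> x + \<psi> x) \<in> test_functions \<Omega>"
proof -
  obtain K L where "compact K" "K \<subseteq> \<Omega>" "\<And>x. x \<notin> K \<Longrightarrow> \<phi> x = 0" "smooth_on UNIV \<phi>"
    "compact L" "L \<subseteq> \<Omega>" "\<And>x. x \<notin> L \<Longrightarrow> \<psi> x = 0" "smooth_on UNIV \<psi>"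
    using assms by (auto simp: test_functions_def)
  then have "compact (K \<union> L)" "K \<union> L \<subseteq> \<Omega>" "\<And>x. x \<notin> K \<union> L \<Longrightarrow> \<phi> x + \<psi> x = 0" "smooth_on UNIV (\<lambda>x. \<phi> x + \<psi> x)"
    by (auto intro: smooth_on_add compact_Un)
  then show ?thesis unfolding test_functions_def by blast
qed

lemma borel_measurable_lebesgue_continuous:
  fixes f :: "'a::euclidean_space \<Rightarrow> 'b::euclidean_space"
  assumes "continuous_on UNIV f"
  shows "f \<in> borel_measurable lebesgue"
  using assms by (intro measurable_completion) (simp add: borel_measurable_continuous_onI)

text \<open>A test function vanishes off a compact subset of \<open>\<Omega>\<close>, so pairings over \<open>\<Omega>\<close> are integrals over the whole space.
This is what allows domains to be exchanged below.\<close>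

lemma test_mult_integrable:
  fixes f :: "'a::euclidean_space \<Rightarrow> real"
  assumes op: "open \<Omega>" and loc: "\<And>K. compact K \<Longrightarrow> K \<subseteq> \<Omega> \<Longrightarrow> f absolutely_integrable_on K" and \<phi>: "\<phi> \<in> test_functions \<Omega>"
  shows "integrable (lebesgue_on \<Omega>) (\<lambda>x. f x * \<phi> x)"
    and "integral\<^sup>L (lebesgue_on \<Omega>) (\<lambda>x. f x * \<phi> x) = integral\<^sup>L lebesgue (\<lambda>x. f x * \<phi> x)"
proof -
  obtain K where K: "compact K" "K \<subseteq> \<Omega>" "\<And>x. x \<notin> K \<Longrightarrow> \<phi> x = 0" and sm: "smooth_on UNIV \<phi>"
    using \<phi> by (auto simp: test_functions_def)
  have cont: "continuous_on UNIV \<phi>" by (rule smooth_on_continuous[OF sm])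
  have "bounded (\<phi> ` K)" using cont K(1) by (intro compact_imp_bounded compact_continuous_image) (auto intro: continuous_on_subset)
  then obtain B where B: "\<And>x. x \<in> K \<Longrightarrow> \<bar>\<phi> x\<bar> \<le> B" by (auto simp: bounded_iff)
  have fK: "integrable lebesgue (\<lambda>x. indicator K x * f x)" using loc[OF K(1,2)] by (simp add: set_integrable_def)
  have "integrable lebesgue (\<lambda>x. (indicator K x * f x) * \<phi> x)"
  proof (rule Bochner_Integration.integrable_bound)
    show "integrable lebesgue (\<lambda>x. B * (indicator K x * f x))" using fK by simp
    show "(\<lambda>x. (indicator K x * f x) * \<phi> x) \<in> borel_measurable lebesgue"
      by (rule borel_measurable_times[OF borel_measurable_integrable[OF fK] borel_measurable_lebesgue_continuous[OF cont]])
    show "AE x in lebesgue. norm ((indicator K x * f x) * \<phi> x) \<le> norm (B * (indicator K x * f x))"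
    proof (rule AE_I2)
      fix x show "norm ((indicator K x * f x) * \<phi> x) \<le> norm (B * (indicator K x * f x))"
      proof (cases "x \<in> K")
        case True
        then have "\<bar>\<phi> x\<bar> \<le> \<bar>B\<bar>" using B[of x] by linarith
        then show ?thesis by (simp add: abs_mult mult.commute mult_right_mono)
      qed simp
    qed
  qed
  moreover have "(indicator K x * f x) * \<phi> x = indicator \<Omega> x *\<^sub>R (f x * \<phi> x)" for x
    using K by (auto simp: indicator_def)
  ultimately have int: "integrable lebesgue (\<lambda>x. indicator \<Omega> x *\<^sub>R (f x * \<phi> x))" by simp
  then show "integrable (lebesgue_on \<Omega>) (\<lambda>x. f x * \<phi> x)" using op by (simp add: integrable_restrict_space)
  have eq: "indicator \<Omega> x *\<^sub>R (f x * \<phi> x) = f x * \<phi> x" for x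
    using K by (auto simp: indicator_def)
  have "integral\<^sup>L (lebesgue_on \<Omega>) (\<lambda>x. f x * \<phi> x) = (\<integral>x. indicator \<Omega> x *\<^sub>R (f x * \<phi> x) \<partial>lebesgue)"
    using op by (intro integral_restrict_space) auto
  then show "integral\<^sup>L (lebesgue_on \<Omega>) (\<lambda>x. f x * \<phi> x) = integral\<^sup>L lebesgue (\<lambda>x. f x * \<phi> x)"
    by (simp only: eq)
qed

lemma absolutely_integrable_on_compact:
  fixes f :: "'a::euclidean_space \<Rightarrow> 'b::euclidean_space"
  assumes "continuous_on UNIV f" "compact K"
  shows "f absolutely_integrable_on K"
proof -
  have "integrable lborel (\<lambda>x. indicator K x *\<^sub>R f x)"
    using assms by (intro borel_integrable_compact) (auto intro: continuous_on_subset)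
  from iffD2[OF integrable_completion[OF borel_measurable_integrable[OF this]] this] show ?thesis
    unfolding set_integrable_def .
qed

lemma has_weak_gradD:
  assumes "has_weak_grad \<Omega> f g"
  shows "\<And>K. compact K \<Longrightarrow> K \<subseteq> \<Omega> \<Longrightarrow> f absolutely_integrable_on K"
    and "\<And>K. compact K \<Longrightarrow> K \<subseteq> \<Omega> \<Longrightarrow> g absolutely_integrable_on K"
    and "\<And>K i. compact K \<Longrightarrow> K \<subseteq> \<Omega> \<Longrightarrow> (\<lambda>x. g x \<bullet> i) absolutely_integrable_on K"
    and "\<And>\<phi> i. \<phi> \<in> test_functions \<Omega> \<Longrightarrow> i \<in> Basis \<Longrightarrow>
        integral\<^sup>L (lebesgue_on \<Omega>) (\<lambda>x. f x * (classical_grad \<phi> x \<bullet> i)) =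
        - integral\<^sup>L (lebesgue_on \<Omega>) (\<lambda>x. (g x \<bullet> i) * \<phi> x)"
proof -
  note D = assms[unfolded has_weak_grad_def]
  show f: "f absolutely_integrable_on K" and g: "g absolutely_integrable_on K" if "compact K" "K \<subseteq> \<Omega>" for K
    using D that by simp_all
  show "(\<lambda>x. g x \<bullet> i) absolutely_integrable_on K" if "compact K" "K \<subseteq> \<Omega>" for K i
    by (rule absolutely_integrable_component[OF g[OF that]])
  show "integral\<^sup>L (lebesgue_on \<Omega>) (\<lambda>x. f x * (classical_grad \<phi> x \<bullet> i)) = - integral\<^sup>L (lebesgue_on \<Omega>) (\<lambda>x. (g x \<bullet> i) * \<phi> x)"
    if "\<phi> \<in> test_functions \<Omega>" "i \<in> Basis" for \<phi> i
    using D that by simp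
qed

lemma weak_grad_unique:
  fixes f :: "'a::euclidean_space \<Rightarrow> real"
  assumes op: "open \<Omega>" and g1: "has_weak_grad \<Omega> f g1" and g2: "has_weak_grad \<Omega> f g2"
  shows "AE x in lebesgue_on \<Omega>. g1 x = g2 x"
proof -
  have "AE x in lebesgue_on \<Omega>. g1 x \<bullet> i - g2 x \<bullet> i = 0" if i: "i \<in> Basis" for i
  proof (rule fundamental_lemma_variations[OF op])
    show "(\<lambda>x. g1 x \<bullet> i - g2 x \<bullet> i) absolutely_integrable_on K" if "compact K" "K \<subseteq> \<Omega>" for K
      using has_weak_gradD(3)[OF g1 that] has_weak_gradD(3)[OF g2 that] by (intro set_integral_diff)
    fix \<phi> assume \<phi>: "\<phi> \<in> test_functions \<Omega>"
    have "integral\<^sup>L (lebesgue_on \<Omega>) (\<lambda>x. (g1 x \<bullet> i) * \<phi> x) = integral\<^sup>L (lebesgue_on \<Omega>) (\<lambda>x. (g2 x \<bullet> i) * \<phi> x)"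
      using has_weak_gradD(4)[OF g1 \<phi> i] has_weak_gradD(4)[OF g2 \<phi> i] by simp
    then show "integral\<^sup>L (lebesgue_on \<Omega>) (\<lambda>x. (g1 x \<bullet> i - g2 x \<bullet> i) * \<phi> x) = 0"
      using test_mult_integrable(1)[OF op has_weak_gradD(3)[OF g1] \<phi>, of i] test_mult_integrable(1)[OF op has_weak_gradD(3)[OF g2] \<phi>, of i]
      by (simp add: left_diff_distrib)
  qed
  then have "AE x in lebesgue_on \<Omega>. \<forall>i\<in>Basis. g1 x \<bullet> i - g2 x \<bullet> i = 0"
    by (subst AE_ball_countable) (auto intro: countable_finite)
  then show ?thesis by eventually_elim (auto intro: euclidean_eqI)
qed

text \<open>The choice in \<open>weak_grad\<close> is immaterial up to null sets, so it may be computed from any weak gradient at hand.\<close>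

lemma weak_grad_AE:
  assumes "open \<Omega>" "has_weak_grad \<Omega> f g"
  shows "AE x in lebesgue_on \<Omega>. weak_grad \<Omega> f x = g x"
  using weak_grad_unique[OF assms(1) _ assms(2), of "weak_grad \<Omega> f"] someI[of "has_weak_grad \<Omega> f" g] assms(2)
  unfolding weak_grad_def by blast

lemma has_weak_grad_lincomb:
  assumes op: "open \<Omega>" and f: "has_weak_grad \<Omega> f g" and f': "has_weak_grad \<Omega> f' g'"
  shows "has_weak_grad \<Omega> (\<lambda>x. f x + r * f' x) (\<lambda>x. g x + r *\<^sub>R g' x)"
  unfolding has_weak_grad_def
proof (intro conjI allI impI ballI)
  fix K assume "compact K \<and> K \<subseteq> \<Omega>"
  then have K: "compact K" "K \<subseteq> \<Omega>" by auto
  have "(\<lambda>x. r *\<^sub>R f' x) absolutely_integrable_on K" "(\<lambda>x. r *\<^sub>R g' x) absolutely_integrable_on K"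
    using has_weak_gradD(1)[OF f' K] has_weak_gradD(2)[OF f' K] by (auto intro: absolutely_integrable_scaleR_left)
  then show "(\<lambda>x. f x + r * f' x) absolutely_integrable_on K" "(\<lambda>x. g x + r *\<^sub>R g' x) absolutely_integrable_on K"
    using set_integral_add(1)[OF has_weak_gradD(1)[OF f K]] set_integral_add(1)[OF has_weak_gradD(2)[OF f K]] by simp_all
next
  fix \<phi> and i :: 'a assume \<phi>: "\<phi> \<in> test_functions \<Omega>" and i: "i \<in> Basis"
  note d = test_functions_deriv[OF \<phi>, of i]
  note I = test_mult_integrable(1)[OF op has_weak_gradD(1)[OF f] d] test_mult_integrable(1)[OF op has_weak_gradD(1)[OF f'] d]
    test_mult_integrable(1)[OF op has_weak_gradD(3)[OF f] \<phi>, of i] test_mult_integrable(1)[OF op has_weak_gradD(3)[OF f'] \<phi>, of i]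
  have "integral\<^sup>L (lebesgue_on \<Omega>) (\<lambda>x. (f x + r * f' x) * (classical_grad \<phi> x \<bullet> i)) =
    integral\<^sup>L (lebesgue_on \<Omega>) (\<lambda>x. f x * (classical_grad \<phi> x \<bullet> i) + r * (f' x * (classical_grad \<phi> x \<bullet> i)))"
    by (simp add: algebra_simps)
  also have "\<dots> = integral\<^sup>L (lebesgue_on \<Omega>) (\<lambda>x. f x * (classical_grad \<phi> x \<bullet> i)) + r * integral\<^sup>L (lebesgue_on \<Omega>) (\<lambda>x. f' x * (classical_grad \<phi> x \<bullet> i))"
    using I by simp
  also have "\<dots> = - (integral\<^sup>L (lebesgue_on \<Omega>) (\<lambda>x. (g x \<bullet> i) * \<phi> x) + r * integral\<^sup>L (lebesgue_on \<Omega>) (\<lambda>x. (g' x \<bullet> i) * \<phi> x))"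
    unfolding has_weak_gradD(4)[OF f \<phi> i] has_weak_gradD(4)[OF f' \<phi> i] by simp
  also have "integral\<^sup>L (lebesgue_on \<Omega>) (\<lambda>x. (g x \<bullet> i) * \<phi> x) + r * integral\<^sup>L (lebesgue_on \<Omega>) (\<lambda>x. (g' x \<bullet> i) * \<phi> x)
    = integral\<^sup>L (lebesgue_on \<Omega>) (\<lambda>x. (g x \<bullet> i) * \<phi> x + r * ((g' x \<bullet> i) * \<phi> x))"
    using I by simp
  also have "\<dots> = integral\<^sup>L (lebesgue_on \<Omega>) (\<lambda>x. ((g x + r *\<^sub>R g' x) \<bullet> i) * \<phi> x)"
    by (simp add: algebra_simps inner_simps)
  finally show "integral\<^sup>L (lebesgue_on \<Omega>) (\<lambda>x. (f x + r * f' x) * (classical_grad \<phi> x \<bullet> i)) =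
     - integral\<^sup>L (lebesgue_on \<Omega>) (\<lambda>x. ((g x + r *\<^sub>R g' x) \<bullet> i) * \<phi> x)" .
qed

lemma integral_by_parts_test:
  fixes f :: "'a::euclidean_space \<Rightarrow> real"
  assumes op: "open \<Omega>" and f: "smooth_on UNIV f" and \<phi>: "\<phi> \<in> test_functions \<Omega>"
  shows "integral\<^sup>L (lebesgue_on \<Omega>) (\<lambda>x. f x * (classical_grad \<phi> x \<bullet> i)) =
        - integral\<^sup>L (lebesgue_on \<Omega>) (\<lambda>x. (classical_grad f x \<bullet> i) * \<phi> x)"
proof -
  have sm: "smooth_on UNIV \<phi>" using \<phi> by (simp add: test_functions_def)
  note df = smooth_on_differentiable[OF f] and d\<phi> = smooth_on_differentiable[OF sm]
  note cont = smooth_on_continuous[OF f] smooth_on_classical_grad[OF f]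
  obtain K where K: "compact K" "K \<subseteq> \<Omega>" "\<And>x. x \<notin> K \<Longrightarrow> f x * \<phi> x = 0" and smf: "smooth_on UNIV (\<lambda>x. f x * \<phi> x)"
    using test_functions_mult[OF \<phi> f] by (auto simp: test_functions_def)
  have "((\<lambda>x. f x * \<phi> x) has_derivative (\<lambda>v. f x * frechet_derivative \<phi> (at x) v + frechet_derivative f (at x) v * \<phi> x)) (at x)" for x
    using df d\<phi> by (intro derivative_intros) (auto simp: frechet_derivative_works[symmetric])
  from frechet_derivative_at[OF this]
  have prod: "frechet_derivative (\<lambda>x. f x * \<phi> x) (at x) i = f x * (classical_grad \<phi> x \<bullet> i) + (classical_grad f x \<bullet> i) * \<phi> x" for x
    by (metis classical_grad_inner[OF df] classical_grad_inner[OF d\<phi>])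
  have loc: "f absolutely_integrable_on K" "(\<lambda>x. classical_grad f x \<bullet> i) absolutely_integrable_on K" if "compact K" "K \<subseteq> \<Omega>" for K
    using cont that by (auto intro!: absolutely_integrable_on_compact continuous_intros)
  note I1 = test_mult_integrable[OF op loc(1) test_functions_deriv[OF \<phi>, of i]]
  note I2 = test_mult_integrable[OF op loc(2) \<phi>]
  have "integral\<^sup>L (lebesgue_on \<Omega>) (\<lambda>x. f x * (classical_grad \<phi> x \<bullet> i)) + integral\<^sup>L (lebesgue_on \<Omega>) (\<lambda>x. (classical_grad f x \<bullet> i) * \<phi> x)
    = integral\<^sup>L (lebesgue_on \<Omega>) (\<lambda>x. f x * (classical_grad \<phi> x \<bullet> i) + (classical_grad f x \<bullet> i) * \<phi> x)"
    using I1(1) I2(1) by simp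
  also have "\<dots> = integral\<^sup>L (lebesgue_on \<Omega>) (\<lambda>x. 1 * frechet_derivative (\<lambda>x. f x * \<phi> x) (at x) i)"
    by (simp add: prod)
  also have "\<dots> = integral\<^sup>L lebesgue (\<lambda>x. 1 * frechet_derivative (\<lambda>x. f x * \<phi> x) (at x) i)"
  proof (rule test_mult_integrable(2)[OF op])
    show "(\<lambda>x. 1 :: real) absolutely_integrable_on K" if "compact K" for K :: "'a set"
      using that by (intro absolutely_integrable_on_compact continuous_intros)
    have "(\<lambda>x. classical_grad (\<lambda>x. f x * \<phi> x) x \<bullet> i) \<in> test_functions \<Omega>"
      by (intro test_functions_deriv test_functions_mult \<phi> f)
    then show "(\<lambda>x. frechet_derivative (\<lambda>x. f x * \<phi> x) (at x) i) \<in> test_functions \<Omega>"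
      using classical_grad_inner[OF smooth_on_differentiable[OF smf]] by simp
  qed
  also have "\<dots> = 0" using integral_directional_derivative_eq_0(1)[OF smf K(1,3)] by simp
  finally show ?thesis by simp
qed

lemma has_weak_grad_classical:
  fixes f :: "'a::euclidean_space \<Rightarrow> real"
  assumes "open \<Omega>" "smooth_on UNIV f"
  shows "has_weak_grad \<Omega> f (classical_grad f)"
  unfolding has_weak_grad_def
proof (intro conjI allI impI ballI)
  fix K :: "'a set" assume "compact K \<and> K \<subseteq> \<Omega>"
  then have "compact K" by simp
  then show "f absolutely_integrable_on K" "classical_grad f absolutely_integrable_on K"
    using smooth_on_continuous[OF assms(2)] smooth_on_classical_grad[OF assms(2)]
    by (simp_all add: absolutely_integrable_on_compact)
qed (rule integral_by_parts_test[OF assms])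

lemma test_functions_mono: "\<Omega>' \<subseteq> \<Omega> \<Longrightarrow> \<phi> \<in> test_functions \<Omega>' \<Longrightarrow> \<phi> \<in> test_functions \<Omega>"
  unfolding test_functions_def by blast

text \<open>Fewer test functions have to be considered on the smaller set, and their pairings do not see the difference of
the two domains.\<close>

lemma has_weak_grad_restrict:
  assumes op: "open \<Omega>" "open \<Omega>'" "\<Omega>' \<subseteq> \<Omega>" and f: "has_weak_grad \<Omega> f g"
  shows "has_weak_grad \<Omega>' f g"
  unfolding has_weak_grad_def
proof (intro conjI allI impI ballI)
  fix K assume "compact K \<and> K \<subseteq> \<Omega>'"
  then have K: "compact K" "K \<subseteq> \<Omega>" using op by auto
  show "f absolutely_integrable_on K" "g absolutely_integrable_on K"
    by (rule has_weak_gradD(1)[OF f K] has_weak_gradD(2)[OF f K])+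
next
  fix \<phi> and i :: 'a assume \<phi>': "\<phi> \<in> test_functions \<Omega>'" and i: "i \<in> Basis"
  then have \<phi>: "\<phi> \<in> test_functions \<Omega>" by (intro test_functions_mono[OF op(3)])
  have sub: "K \<subseteq> \<Omega>' \<Longrightarrow> K \<subseteq> \<Omega>" for K using op by auto
  have "integral\<^sup>L (lebesgue_on \<Omega>') (\<lambda>x. f x * (classical_grad \<phi> x \<bullet> i)) = integral\<^sup>L (lebesgue_on \<Omega>) (\<lambda>x. f x * (classical_grad \<phi> x \<bullet> i))"
    using test_mult_integrable(2)[OF op(1) has_weak_gradD(1)[OF f] test_functions_deriv[OF \<phi>, of i]]
      test_mult_integrable(2)[OF op(2) has_weak_gradD(1)[OF f _ sub] test_functions_deriv[OF \<phi>', of i]] by simp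
  moreover have "integral\<^sup>L (lebesgue_on \<Omega>') (\<lambda>x. (g x \<bullet> i) * \<phi> x) = integral\<^sup>L (lebesgue_on \<Omega>) (\<lambda>x. (g x \<bullet> i) * \<phi> x)"
    using test_mult_integrable(2)[OF op(1) has_weak_gradD(3)[OF f] \<phi>, of i]
      test_mult_integrable(2)[OF op(2) has_weak_gradD(3)[OF f _ sub] \<phi>', of i] by simp
  ultimately show "integral\<^sup>L (lebesgue_on \<Omega>') (\<lambda>x. f x * (classical_grad \<phi> x \<bullet> i)) = - integral\<^sup>L (lebesgue_on \<Omega>') (\<lambda>x. (g x \<bullet> i) * \<phi> x)"
    using has_weak_gradD(4)[OF f \<phi> i] by simp
qed

lemma has_weak_grad_cong:
  assumes op: "open \<Omega>" and eq: "\<And>x. x \<in> \<Omega> \<Longrightarrow> f x = f' x" and f: "has_weak_grad \<Omega> f g"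
  shows "has_weak_grad \<Omega> f' g"
proof -
  have "integral\<^sup>L (lebesgue_on \<Omega>) (\<lambda>x. f' x * h x) = integral\<^sup>L (lebesgue_on \<Omega>) (\<lambda>x. f x * h x)" for h
    by (rule Bochner_Integration.integral_cong) (auto simp: eq)
  moreover have "f' absolutely_integrable_on K" if "K \<subseteq> \<Omega>" "f absolutely_integrable_on K" for K
  proof -
    have "set_integrable lebesgue K f = set_integrable lebesgue K f'"
      by (rule set_integrable_cong) (use that eq in auto)
    with that show ?thesis by simp
  qed
  ultimately show ?thesis using f unfolding has_weak_grad_def by (simp del: set_integrable_eq)
qed

text \<open>On an open set where \<open>v\<close> is affine its classical gradient is a weak gradient as well, and weak gradients are
unique.  Applied to the interiors of the elements, this identifies the weak gradient of a finite element
function.\<close>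

lemma weak_grad_of_locally_affine:
  fixes v :: "'a::euclidean_space \<Rightarrow> real"
  assumes op: "open \<Omega>" "open U" "U \<subseteq> \<Omega>" and v: "has_weak_grad \<Omega> v g" and aff: "\<And>x. x \<in> U \<Longrightarrow> v x = p \<bullet> x + q"
  shows "AE x in lebesgue_on U. g x = p"
proof -
  let ?l = "\<lambda>x. x \<bullet> p + q"
  have sm: "smooth_on UNIV ?l" by (intro smooth_on_add smooth_on_inner smooth_on_const)
  have "(?l has_derivative (\<lambda>h. h \<bullet> p)) (at x)" for x by (auto intro!: derivative_eq_intros)
  from frechet_derivative_at[OF this] have fd: "frechet_derivative ?l (at x) = (\<lambda>h. h \<bullet> p)" for x by simp
  have "classical_grad ?l x \<bullet> w = p \<bullet> w" for x w
    using classical_grad_inner[OF smooth_on_differentiable[OF sm], of x w] by (simp add: fd inner_commute)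
  then have grad: "classical_grad ?l x = p" for x by (metis inner_commute vector_eq_ldot)
  have "has_weak_grad U ?l g"
    by (rule has_weak_grad_cong[OF op(2) _ has_weak_grad_restrict[OF op v]]) (simp add: aff inner_commute)
  from weak_grad_unique[OF op(2) this has_weak_grad_classical[OF op(2) sm]] show ?thesis
    by (simp add: grad)
qed

section \<open>Square integrable functions and Sobolev spaces\<close>

lemma L2_inner_integrable:
  assumes "f \<in> L2 \<Omega>" "g \<in> L2 \<Omega>"
  shows "integrable (lebesgue_on \<Omega>) (\<lambda>x. f x \<bullet> g x)"
proof (rule Bochner_Integration.integrable_bound)
  show "integrable (lebesgue_on \<Omega>) (\<lambda>x. (norm (f x))\<^sup>2 + (norm (g x))\<^sup>2)"
    using assms by (intro Bochner_Integration.integrable_add) (auto simp: L2_def)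
  show "(\<lambda>x. f x \<bullet> g x) \<in> borel_measurable (lebesgue_on \<Omega>)"
    using assms by (intro borel_measurable_inner) (auto simp: L2_def)
  show "AE x in lebesgue_on \<Omega>. norm (f x \<bullet> g x) \<le> norm ((norm (f x))\<^sup>2 + (norm (g x))\<^sup>2)"
  proof (rule AE_I2)
    fix x
    have "\<bar>f x \<bullet> g x\<bar> \<le> norm (f x) * norm (g x)" by (rule Cauchy_Schwarz_ineq2)
    also have "\<dots> \<le> (norm (f x))\<^sup>2 + (norm (g x))\<^sup>2"
    proof -
      have "2 * (norm (f x) * norm (g x)) \<le> (norm (f x))\<^sup>2 + (norm (g x))\<^sup>2"
        using sum_squares_bound[of "norm (f x)" "norm (g x)"] by (simp add: mult.assoc)
      moreover have "0 \<le> norm (f x) * norm (g x)" by simp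
      ultimately show ?thesis by linarith
    qed
    finally show "norm (f x \<bullet> g x) \<le> norm ((norm (f x))\<^sup>2 + (norm (g x))\<^sup>2)" by simp
  qed
qed

lemma norm_add_square_le: "(norm (a + b))\<^sup>2 \<le> 2 * (norm a)\<^sup>2 + 2 * (norm b)\<^sup>2" for a b :: "'a::real_inner"
proof -
  have "0 \<le> (norm (a - b))\<^sup>2" by simp
  then show ?thesis by (simp add: power2_norm_eq_inner inner_simps inner_commute)
qed

lemma L2_lincomb:
  assumes "f \<in> L2 \<Omega>" "g \<in> L2 \<Omega>"
  shows "(\<lambda>x. f x + r *\<^sub>R g x) \<in> L2 \<Omega>"
  unfolding L2_def mem_Collect_eq
proof
  show meas: "(\<lambda>x. f x + r *\<^sub>R g x) \<in> borel_measurable (lebesgue_on \<Omega>)"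
    using assms by (intro borel_measurable_add borel_measurable_scaleR) (auto simp: L2_def)
  show "integrable (lebesgue_on \<Omega>) (\<lambda>x. (norm (f x + r *\<^sub>R g x))\<^sup>2)"
  proof (rule Bochner_Integration.integrable_bound)
    show "integrable (lebesgue_on \<Omega>) (\<lambda>x. 2 * (norm (f x))\<^sup>2 + 2 * (r\<^sup>2 * (norm (g x))\<^sup>2))"
      using assms by (intro Bochner_Integration.integrable_add integrable_mult_right) (auto simp: L2_def)
    show "(\<lambda>x. (norm (f x + r *\<^sub>R g x))\<^sup>2) \<in> borel_measurable (lebesgue_on \<Omega>)"
      using meas by measurable
    show "AE x in lebesgue_on \<Omega>. norm ((norm (f x + r *\<^sub>R g x))\<^sup>2) \<le> norm (2 * (norm (f x))\<^sup>2 + 2 * (r\<^sup>2 * (norm (g x))\<^sup>2))"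
    proof (rule AE_I2)
      fix x
      show "norm ((norm (f x + r *\<^sub>R g x))\<^sup>2) \<le> norm (2 * (norm (f x))\<^sup>2 + 2 * (r\<^sup>2 * (norm (g x))\<^sup>2))"
        using norm_add_square_le[of "f x" "r *\<^sub>R g x"] by (simp add: power_mult_distrib)
    qed
  qed
qed

lemma L2_inner_commute: "L2_inner \<Omega> f g = L2_inner \<Omega> g f"
  by (simp add: L2_inner_def inner_commute)

lemma L2_inner_nonneg: "0 \<le> L2_inner \<Omega> f f"
  by (simp add: L2_inner_def)

lemma L2_norm_sq: "(L2_norm \<Omega> f)\<^sup>2 = L2_inner \<Omega> f f"
  by (simp add: L2_norm_def L2_inner_nonneg)

lemma L2_inner_lincomb:
  assumes "f \<in> L2 \<Omega>" "g \<in> L2 \<Omega>" "k \<in> L2 \<Omega>"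
  shows "L2_inner \<Omega> (\<lambda>x. f x + r *\<^sub>R g x) k = L2_inner \<Omega> f k + r * L2_inner \<Omega> g k"
  unfolding L2_inner_def inner_add_left inner_scaleR_left
  using L2_inner_integrable[OF assms(1,3)] L2_inner_integrable[OF assms(2,3)] by simp

lemma L2_inner_sum_le:
  assumes "f \<in> L2 \<Omega>" "g \<in> L2 \<Omega>"
  shows "L2_inner \<Omega> (\<lambda>x. f x + r *\<^sub>R g x) (\<lambda>x. f x + r *\<^sub>R g x) \<le> 2 * L2_inner \<Omega> f f + 2 * (r\<^sup>2 * L2_inner \<Omega> g g)"
proof -
  have exp: "L2_inner \<Omega> (\<lambda>x. f x + s *\<^sub>R g x) (\<lambda>x. f x + s *\<^sub>R g x) = L2_inner \<Omega> f f + 2 * (s * L2_inner \<Omega> f g) + s\<^sup>2 * L2_inner \<Omega> g g" for s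
  proof -
    note fg = L2_lincomb[OF assms, of s]
    have "L2_inner \<Omega> (\<lambda>x. f x + s *\<^sub>R g x) (\<lambda>x. f x + s *\<^sub>R g x) = L2_inner \<Omega> (\<lambda>x. f x + s *\<^sub>R g x) f + s * L2_inner \<Omega> (\<lambda>x. f x + s *\<^sub>R g x) g"
      by (subst L2_inner_lincomb[OF assms fg]) (simp add: L2_inner_commute)
    then show ?thesis
      by (simp add: L2_inner_lincomb[OF assms assms(1)] L2_inner_lincomb[OF assms assms(2)] L2_inner_commute[of \<Omega> g f] algebra_simps power2_eq_square)
  qed
  show ?thesis using L2_inner_nonneg[of \<Omega> "\<lambda>x. f x + (- r) *\<^sub>R g x"] unfolding exp[of "- r"] exp[of r] by (simp add: algebra_simps)
qed

lemma borel_measurable_lebesgue_on_AE: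
  fixes f :: "'a::euclidean_space \<Rightarrow> 'b::euclidean_space"
  assumes op: "open \<Omega>" and f: "f \<in> borel_measurable (lebesgue_on \<Omega>)" and ae: "AE x in lebesgue_on \<Omega>. f x = g x"
  shows "g \<in> borel_measurable (lebesgue_on \<Omega>)"
proof -
  have "(\<lambda>x. indicator \<Omega> x *\<^sub>R f x) \<in> borel_measurable lebesgue"
    using f op by (simp add: borel_measurable_restrict_space_iff)
  moreover have "AE x in lebesgue. indicator \<Omega> x *\<^sub>R f x = indicator \<Omega> x *\<^sub>R g x"
    using ae op by (auto simp: AE_restrict_space_iff indicator_def elim!: eventually_mono)
  ultimately have "(\<lambda>x. indicator \<Omega> x *\<^sub>R g x) \<in> borel_measurable lebesgue" by (rule borel_measurable_AE)
  then show ?thesis using op by (simp add: borel_measurable_restrict_space_iff)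
qed

text \<open>Measurability passes to \<open>g\<close> because the completed Lebesgue measure is used.\<close>

lemma L2_cong_AE:
  fixes f :: "'a::euclidean_space \<Rightarrow> 'b::euclidean_space"
  assumes op: "open \<Omega>" and f: "f \<in> L2 \<Omega>" and ae: "AE x in lebesgue_on \<Omega>. f x = g x"
  shows "g \<in> L2 \<Omega>"
proof -
  have fm: "f \<in> borel_measurable (lebesgue_on \<Omega>)" and fi: "integrable (lebesgue_on \<Omega>) (\<lambda>x. (norm (f x))\<^sup>2)" using f by (auto simp: L2_def)
  have gm: "g \<in> borel_measurable (lebesgue_on \<Omega>)" by (rule borel_measurable_lebesgue_on_AE[OF op fm ae])
  have "integrable (lebesgue_on \<Omega>) (\<lambda>x. (norm (g x))\<^sup>2)"
    by (rule integrable_cong_AE_imp[OF fi]) (use gm ae in \<open>auto elim!: eventually_mono\<close>)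
  then show ?thesis using gm by (simp add: L2_def)
qed

lemma L2_inner_cong_AE:
  assumes L2: "f \<in> L2 \<Omega>" "g \<in> L2 \<Omega>" "f' \<in> L2 \<Omega>" "g' \<in> L2 \<Omega>"
    and ae: "AE x in lebesgue_on \<Omega>. f x = f' x" "AE x in lebesgue_on \<Omega>. g x = g' x"
  shows "L2_inner \<Omega> f g = L2_inner \<Omega> f' g'"
  unfolding L2_inner_def
proof (rule integral_cong_AE)
  show "(\<lambda>x. f x \<bullet> g x) \<in> borel_measurable (lebesgue_on \<Omega>)" "(\<lambda>x. f' x \<bullet> g' x) \<in> borel_measurable (lebesgue_on \<Omega>)"
    using L2 by (auto intro!: borel_measurable_inner simp: L2_def)
  show "AE x in lebesgue_on \<Omega>. f x \<bullet> g x = f' x \<bullet> g' x" using ae by eventually_elim simp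
qed

lemma H1_weak_grad:
  assumes op: "open \<Omega>" and f: "f \<in> H1 \<Omega>"
  shows "has_weak_grad \<Omega> f (weak_grad \<Omega> f)" "weak_grad \<Omega> f \<in> L2 \<Omega>" "f \<in> L2 \<Omega>"
proof -
  obtain g where g: "g \<in> L2 \<Omega>" "has_weak_grad \<Omega> f g" using f by (auto simp: H1_def)
  show "has_weak_grad \<Omega> f (weak_grad \<Omega> f)" unfolding weak_grad_def by (rule someI[of _ g]) (rule g(2))
  have "AE x in lebesgue_on \<Omega>. g x = weak_grad \<Omega> f x" using weak_grad_AE[OF op g(2)] by eventually_elim simp
  then show "weak_grad \<Omega> f \<in> L2 \<Omega>" by (rule L2_cong_AE[OF op g(1)])
  show "f \<in> L2 \<Omega>" using f by (simp add: H1_def)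
qed

lemma H1_lincomb:
  assumes op: "open \<Omega>" and f: "f \<in> H1 \<Omega>" and g: "g \<in> H1 \<Omega>"
  shows "(\<lambda>x. f x + r * g x) \<in> H1 \<Omega>"
    and "AE x in lebesgue_on \<Omega>. weak_grad \<Omega> (\<lambda>x. f x + r * g x) x = weak_grad \<Omega> f x + r *\<^sub>R weak_grad \<Omega> g x"
proof -
  note F = H1_weak_grad[OF op f] and G = H1_weak_grad[OF op g]
  have hw: "has_weak_grad \<Omega> (\<lambda>x. f x + r * g x) (\<lambda>x. weak_grad \<Omega> f x + r *\<^sub>R weak_grad \<Omega> g x)"
    by (rule has_weak_grad_lincomb[OF op F(1) G(1)])
  show "(\<lambda>x. f x + r * g x) \<in> H1 \<Omega>"
    using hw L2_lincomb[OF F(2) G(2)] L2_lincomb[OF F(3) G(3), of r] unfolding H1_def by auto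
  show "AE x in lebesgue_on \<Omega>. weak_grad \<Omega> (\<lambda>x. f x + r * g x) x = weak_grad \<Omega> f x + r *\<^sub>R weak_grad \<Omega> g x"
    by (rule weak_grad_AE[OF op hw])
qed

lemma a_form_commute: "a_form \<Omega> f g = a_form \<Omega> g f"
  by (simp add: a_form_def L2_inner_commute)

lemma a_form_nonneg: "0 \<le> a_form \<Omega> f f"
  by (simp add: a_form_def L2_inner_nonneg)

text \<open>Linearity of the weak gradient holds only almost everywhere, since a representative is chosen separately for
each function; it becomes an identity under the integral.\<close>

lemma L2_inner_weak_grad_lincomb:
  assumes op: "open \<Omega>" and f: "f \<in> H1 \<Omega>" and g: "g \<in> H1 \<Omega>" and k: "k \<in> L2 \<Omega>"
  shows "L2_inner \<Omega> (weak_grad \<Omega> (\<lambda>x. f x + r * g x)) k = L2_inner \<Omega> (weak_grad \<Omega> f) k + r * L2_inner \<Omega> (weak_grad \<Omega> g) k"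
proof -
  note F = H1_weak_grad[OF op f] and G = H1_weak_grad[OF op g]
  have "L2_inner \<Omega> (weak_grad \<Omega> (\<lambda>x. f x + r * g x)) k = L2_inner \<Omega> (\<lambda>x. weak_grad \<Omega> f x + r *\<^sub>R weak_grad \<Omega> g x) k"
    using H1_lincomb(2)[OF op f g] H1_weak_grad(2)[OF op H1_lincomb(1)[OF op f g]] L2_lincomb[OF F(2) G(2)] k
    by (intro L2_inner_cong_AE) auto
  then show ?thesis by (simp add: L2_inner_lincomb[OF F(2) G(2) k])
qed

lemma a_form_lincomb:
  assumes op: "open \<Omega>" and f: "f \<in> H1 \<Omega>" and g: "g \<in> H1 \<Omega>" and k: "k \<in> H1 \<Omega>"
  shows "a_form \<Omega> (\<lambda>x. f x + r * g x) k = a_form \<Omega> f k + r * a_form \<Omega> g k"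
  unfolding a_form_def by (rule L2_inner_weak_grad_lincomb[OF op f g H1_weak_grad(2)[OF op k]])

lemma a_form_sum_le:
  assumes op: "open \<Omega>" and f: "f \<in> H1 \<Omega>" and g: "g \<in> H1 \<Omega>"
  shows "a_form \<Omega> (\<lambda>x. f x + r * g x) (\<lambda>x. f x + r * g x) \<le> 2 * a_form \<Omega> f f + 2 * (r\<^sup>2 * a_form \<Omega> g g)"
proof -
  note F = H1_weak_grad[OF op f] and G = H1_weak_grad[OF op g]
  have "a_form \<Omega> (\<lambda>x. f x + r * g x) (\<lambda>x. f x + r * g x) =
     L2_inner \<Omega> (\<lambda>x. weak_grad \<Omega> f x + r *\<^sub>R weak_grad \<Omega> g x) (\<lambda>x. weak_grad \<Omega> f x + r *\<^sub>R weak_grad \<Omega> g x)"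
    unfolding a_form_def
    using H1_lincomb(2)[OF op f g] H1_weak_grad(2)[OF op H1_lincomb(1)[OF op f g]] L2_lincomb[OF F(2) G(2)]
    by (intro L2_inner_cong_AE) auto
  then show ?thesis using L2_inner_sum_le[OF F(2) G(2)] by (simp add: a_form_def)
qed

lemma L2_compact_support:
  fixes f :: "'a::euclidean_space \<Rightarrow> 'b::euclidean_space"
  assumes op: "open \<Omega>" and f: "continuous_on UNIV f" and K: "compact K" "K \<subseteq> \<Omega>" "\<And>x. x \<notin> K \<Longrightarrow> f x = 0"
  shows "f \<in> L2 \<Omega>"
proof -
  have m: "f \<in> borel_measurable lebesgue" by (rule borel_measurable_lebesgue_continuous[OF f])
  have "(\<lambda>x. (norm (f x))\<^sup>2) absolutely_integrable_on K"
    using f K by (intro absolutely_integrable_on_compact continuous_intros) auto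
  then have "integrable lebesgue (\<lambda>x. indicator K x *\<^sub>R (norm (f x))\<^sup>2)" by (simp add: set_integrable_def)
  moreover have "(\<lambda>x. indicator K x *\<^sub>R (norm (f x))\<^sup>2) = (\<lambda>x. indicator \<Omega> x *\<^sub>R (norm (f x))\<^sup>2)"
    using K by (auto simp: fun_eq_iff indicator_def)
  ultimately have "integrable lebesgue (\<lambda>x. indicator \<Omega> x *\<^sub>R (norm (f x))\<^sup>2)" by (simp only:)
  then show ?thesis using op m by (simp add: L2_def integrable_restrict_space measurable_restrict_space1)
qed

lemma test_functions_H1:
  assumes op: "open \<Omega>" and \<phi>: "\<phi> \<in> test_functions \<Omega>"
  shows "\<phi> \<in> H1 \<Omega>" "AE x in lebesgue_on \<Omega>. weak_grad \<Omega> \<phi> x = classical_grad \<phi> x" "classical_grad \<phi> \<in> L2 \<Omega>"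
proof -
  obtain K where K: "compact K" "K \<subseteq> \<Omega>" "\<And>x. x \<notin> K \<Longrightarrow> \<phi> x = 0" and sm: "smooth_on UNIV \<phi>"
    using \<phi> by (auto simp: test_functions_def)
  have hw: "has_weak_grad \<Omega> \<phi> (classical_grad \<phi>)" by (rule has_weak_grad_classical[OF op sm])
  show "classical_grad \<phi> \<in> L2 \<Omega>"
  proof (rule L2_compact_support[OF op smooth_on_classical_grad[OF sm] K(1,2)])
    fix x assume "x \<notin> K"
    then show "classical_grad \<phi> x = 0" using deriv_zero_off_support[OF K(1,3)] by (simp add: classical_grad_def)
  qed
  moreover have "\<phi> \<in> L2 \<Omega>" by (rule L2_compact_support[OF op smooth_on_continuous[OF sm] K])
  ultimately show "\<phi> \<in> H1 \<Omega>" using hw by (auto simp: H1_def)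
  show "AE x in lebesgue_on \<Omega>. weak_grad \<Omega> \<phi> x = classical_grad \<phi> x" by (rule weak_grad_AE[OF op hw])
qed

lemma H1_norm_sq: "(H1_norm \<Omega> f)\<^sup>2 = L2_inner \<Omega> f f + a_form \<Omega> f f"
  by (simp add: H1_norm_def L2_norm_sq a_form_def L2_inner_nonneg)

text \<open>A substitute for the triangle inequality that avoids square roots; the factor 2 is harmless for the limits and
constants below.\<close>

lemma H1_norm_lincomb_le:
  assumes op: "open \<Omega>" and f: "f \<in> H1 \<Omega>" and g: "g \<in> H1 \<Omega>"
  shows "(H1_norm \<Omega> (\<lambda>x. f x + r * g x))\<^sup>2 \<le> 2 * (H1_norm \<Omega> f)\<^sup>2 + 2 * (r\<^sup>2 * (H1_norm \<Omega> g)\<^sup>2)"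
  using a_form_sum_le[OF assms, of r] L2_inner_sum_le[of f \<Omega> g r] H1_weak_grad(3)[OF op f] H1_weak_grad(3)[OF op g]
  by (simp add: H1_norm_sq algebra_simps)

lemma tendsto_0_of_square:
  fixes f :: "nat \<Rightarrow> real"
  assumes "(\<lambda>k. (f k)\<^sup>2) \<longlonglongrightarrow> 0"
  shows "f \<longlonglongrightarrow> 0"
proof -
  have "(\<lambda>k. sqrt ((f k)\<^sup>2)) \<longlonglongrightarrow> sqrt 0" using assms by (rule tendsto_real_sqrt)
  then show ?thesis by (simp add: tendsto_rabs_zero_iff)
qed

text \<open>Linear combinations of approximating test functions approximate the linear combination.\<close>

lemma H1_0_lincomb:
  assumes op: "open \<Omega>" and f: "f \<in> H1_0 \<Omega>" and g: "g \<in> H1_0 \<Omega>"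
  shows "(\<lambda>x. f x + r * g x) \<in> H1_0 \<Omega>"
proof -
  obtain \<phi> \<psi> where \<phi>: "\<And>k. \<phi> k \<in> test_functions \<Omega>" "(\<lambda>k. H1_norm \<Omega> (\<lambda>x. f x - \<phi> k x)) \<longlonglongrightarrow> 0"
    and \<psi>: "\<And>k. \<psi> k \<in> test_functions \<Omega>" "(\<lambda>k. H1_norm \<Omega> (\<lambda>x. g x - \<psi> k x)) \<longlonglongrightarrow> 0"
    using f g by (auto simp: H1_0_def)
  have fg: "f \<in> H1 \<Omega>" "g \<in> H1 \<Omega>" using f g by (auto simp: H1_0_def)
  let ?\<theta> = "\<lambda>k x. \<phi> k x + r * \<psi> k x"
  have \<theta>: "?\<theta> k \<in> test_functions \<Omega>" for k
    using test_functions_add[OF \<phi>(1) test_functions_mult[OF \<psi>(1) smooth_on_const]] by simp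
  have d: "(\<lambda>x. f x - \<phi> k x) \<in> H1 \<Omega>" "(\<lambda>x. g x - \<psi> k x) \<in> H1 \<Omega>" for k
    using H1_lincomb(1)[OF op fg(1) test_functions_H1(1)[OF op \<phi>(1)], of "-1"]
      H1_lincomb(1)[OF op fg(2) test_functions_H1(1)[OF op \<psi>(1)], of "-1"] by simp_all
  have le: "(H1_norm \<Omega> (\<lambda>x. (f x + r * g x) - ?\<theta> k x))\<^sup>2 \<le>
     2 * (H1_norm \<Omega> (\<lambda>x. f x - \<phi> k x))\<^sup>2 + 2 * (r\<^sup>2 * (H1_norm \<Omega> (\<lambda>x. g x - \<psi> k x))\<^sup>2)" for k
    using H1_norm_lincomb_le[OF op d[of k], of r] by (simp add: algebra_simps)
  have "(\<lambda>k. 2 * (H1_norm \<Omega> (\<lambda>x. f x - \<phi> k x))\<^sup>2 + 2 * (r\<^sup>2 * (H1_norm \<Omega> (\<lambda>x. g x - \<psi> k x))\<^sup>2)) \<longlonglongrightarrow> 2 * 0\<^sup>2 + 2 * (r\<^sup>2 * 0\<^sup>2)"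
    by (intro tendsto_intros \<phi>(2) \<psi>(2))
  then have lim: "(\<lambda>k. 2 * (H1_norm \<Omega> (\<lambda>x. f x - \<phi> k x))\<^sup>2 + 2 * (r\<^sup>2 * (H1_norm \<Omega> (\<lambda>x. g x - \<psi> k x))\<^sup>2)) \<longlonglongrightarrow> 0"
    by simp
  have "(\<lambda>k. (H1_norm \<Omega> (\<lambda>x. (f x + r * g x) - ?\<theta> k x))\<^sup>2) \<longlonglongrightarrow> 0"
    by (rule tendsto_sandwich[OF _ _ tendsto_const lim]) (simp_all only: le zero_le_power2 eventually_True)
  then have "(\<lambda>k. H1_norm \<Omega> (\<lambda>x. (f x + r * g x) - ?\<theta> k x)) \<longlonglongrightarrow> 0" by (rule tendsto_0_of_square)
  then show ?thesis
    using H1_lincomb(1)[OF op fg, of r] \<theta> unfolding H1_0_def mem_Collect_eq by (intro conjI exI[of _ ?\<theta>]) auto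
qed

lemma H1_0_zero:
  assumes op: "open \<Omega>"
  shows "(\<lambda>x. 0) \<in> H1_0 \<Omega>"
proof -
  have t: "(\<lambda>x. 0) \<in> test_functions \<Omega>"
    unfolding test_functions_def using smooth_on_const[of 0] by (auto intro!: exI[of _ "{}"])
  have "H1_norm \<Omega> (\<lambda>x. 0) = 0"
  proof -
    have "a_form \<Omega> (\<lambda>x. 0 + (-1) * 0) (\<lambda>x. 0) = a_form \<Omega> (\<lambda>x. 0) (\<lambda>x. 0) + (-1) * a_form \<Omega> (\<lambda>x. 0) (\<lambda>x. 0)"
      using test_functions_H1(1)[OF op t] by (intro a_form_lincomb[OF op]) auto
    then have "a_form \<Omega> (\<lambda>x. 0) (\<lambda>x. 0) = 0" by simp
    then have "(H1_norm \<Omega> (\<lambda>x. 0))\<^sup>2 = 0" by (simp add: H1_norm_sq L2_inner_def)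
    then show ?thesis by simp
  qed
  then show ?thesis
    using test_functions_H1(1)[OF op t] t unfolding H1_0_def mem_Collect_eq
    by (intro conjI exI[of _ "\<lambda>k x. 0"]) auto
qed

section \<open>Poincare's inequality\<close>

text \<open>Integrating the \<open>i\<close>-th derivative of \<open>x\<^sub>i \<phi>\<^sup>2\<close>, which has integral zero, expresses the integral of \<open>\<phi>\<^sup>2\<close> by that of
\<open>-2 x\<^sub>i \<phi> \<partial>\<^sub>i\<phi>\<close>.  Here \<open>x\<^sub>i\<close> is at most \<open>R\<close>, and half of \<open>\<phi>\<^sup>2\<close> is absorbed by Young's inequality.  Hence only the
radius of a surrounding ball enters the constant.\<close>

lemma poincare_test:
  fixes \<Omega> :: "'a::euclidean_space set"
  assumes op: "open \<Omega>" and R: "\<Omega> \<subseteq> cball 0 R" and \<phi>: "\<phi> \<in> test_functions \<Omega>"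
  shows "L2_inner \<Omega> \<phi> \<phi> \<le> 4 * R\<^sup>2 * a_form \<Omega> \<phi> \<phi>"
proof -
  obtain i :: 'a where i: "i \<in> Basis" using nonempty_Basis by blast
  have sm: "smooth_on UNIV \<phi>" using \<phi> by (simp add: test_functions_def)
  note H = test_functions_H1[OF op \<phi>]
  let ?d = "\<lambda>x. classical_grad \<phi> x \<bullet> i"
  have sq: "(\<lambda>x. \<phi> x * \<phi> x) \<in> test_functions \<Omega>" by (rule test_functions_mult[OF \<phi> sm])
  have dsq: "classical_grad (\<lambda>x. \<phi> x * \<phi> x) x \<bullet> i = 2 * \<phi> x * ?d x" for x
  proof -
    have D: "((\<lambda>x. \<phi> x * \<phi> x) has_derivative (\<lambda>v. \<phi> x * frechet_derivative \<phi> (at x) v + frechet_derivative \<phi> (at x) v * \<phi> x)) (at x)"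
      using smooth_on_differentiable[OF sm] by (intro derivative_intros) (auto simp: frechet_derivative_works[symmetric])
    have diff: "(\<lambda>x. \<phi> x * \<phi> x) differentiable (at x)" using D by (auto simp: differentiable_def)
    have "frechet_derivative (\<lambda>x. \<phi> x * \<phi> x) (at x) =
      (\<lambda>v. \<phi> x * frechet_derivative \<phi> (at x) v + frechet_derivative \<phi> (at x) v * \<phi> x)"
      using frechet_derivative_at[OF D] by (rule sym)
    then show ?thesis
      by (simp add: classical_grad_inner[OF diff] classical_grad_inner[OF smooth_on_differentiable[OF sm]])
  qed
  have x1: "classical_grad (\<lambda>x. x \<bullet> i) x \<bullet> i = 1" for x :: 'a
  proof -
    have D: "((\<lambda>x. x \<bullet> i) has_derivative (\<lambda>h. h \<bullet> i)) (at x)" by (auto intro!: derivative_eq_intros)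
    have "frechet_derivative (\<lambda>x. x \<bullet> i) (at x) = (\<lambda>h. h \<bullet> i)" using frechet_derivative_at[OF D] by (rule sym)
    then show ?thesis using i by (simp add: classical_grad_inner[OF smooth_on_differentiable[OF smooth_on_inner]])
  qed
  have parts: "integral\<^sup>L (lebesgue_on \<Omega>) (\<lambda>x. (x \<bullet> i) * (2 * \<phi> x * ?d x)) = - L2_inner \<Omega> \<phi> \<phi>"
    using integral_by_parts_test[OF op smooth_on_inner sq, of i i] unfolding dsq x1 L2_inner_def by simp
  have I\<phi>: "integrable (lebesgue_on \<Omega>) (\<lambda>x. \<phi> x \<bullet> \<phi> x)"
    by (rule L2_inner_integrable) (rule H1_weak_grad(3)[OF op H(1)])+
  have Ig: "integrable (lebesgue_on \<Omega>) (\<lambda>x. classical_grad \<phi> x \<bullet> classical_grad \<phi> x)"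
    by (rule L2_inner_integrable[OF H(3) H(3)])
  have "L2_inner \<Omega> \<phi> \<phi> = integral\<^sup>L (lebesgue_on \<Omega>) (\<lambda>x. - ((x \<bullet> i) * (2 * \<phi> x * ?d x)))"
    using parts by simp
  also have "\<dots> \<le> integral\<^sup>L (lebesgue_on \<Omega>) (\<lambda>x. 1 / 2 * (\<phi> x \<bullet> \<phi> x) + 2 * R\<^sup>2 * (classical_grad \<phi> x \<bullet> classical_grad \<phi> x))"
  proof (rule integral_mono')
    show "integrable (lebesgue_on \<Omega>) (\<lambda>x. 1 / 2 * (\<phi> x \<bullet> \<phi> x) + 2 * R\<^sup>2 * (classical_grad \<phi> x \<bullet> classical_grad \<phi> x))"
      by (intro Bochner_Integration.integrable_add integrable_mult_right I\<phi> Ig)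
    fix x assume "x \<in> space (lebesgue_on \<Omega>)"
    then have "norm x \<le> R" using R by auto
    then have xi: "\<bar>x \<bullet> i\<bar> \<le> R" using Basis_le_norm[OF i, of x] by linarith
    have R0: "0 \<le> R" using \<open>norm x \<le> R\<close> norm_ge_zero[of x] by linarith
    have di: "(?d x)\<^sup>2 \<le> classical_grad \<phi> x \<bullet> classical_grad \<phi> x"
      using power_mono[OF Basis_le_norm[OF i, of "classical_grad \<phi> x"], of 2] by (simp add: power2_norm_eq_inner)
    have "- ((x \<bullet> i) * (2 * \<phi> x * ?d x)) \<le> \<bar>x \<bullet> i\<bar> * (2 * \<bar>\<phi> x\<bar> * \<bar>?d x\<bar>)"
      by (rule order_trans[OF abs_ge_minus_self]) (simp add: abs_mult)
    also have "\<dots> \<le> R * (2 * \<bar>\<phi> x\<bar> * \<bar>?d x\<bar>)" by (intro mult_right_mono xi) auto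
    also have "\<dots> = 2 * (\<bar>\<phi> x\<bar> * (R * \<bar>?d x\<bar>))" by simp
    also have "\<dots> \<le> 1 / 2 * \<bar>\<phi> x\<bar>\<^sup>2 + 2 * (R * \<bar>?d x\<bar>)\<^sup>2"
      using sum_squares_bound[of "\<bar>\<phi> x\<bar>" "2 * (R * \<bar>?d x\<bar>)"] by (simp add: power_mult_distrib)
    also have "\<dots> = 1 / 2 * (\<phi> x \<bullet> \<phi> x) + 2 * R\<^sup>2 * (?d x)\<^sup>2" by (simp add: power_mult_distrib power2_eq_square)
    also have "\<dots> \<le> 1 / 2 * (\<phi> x \<bullet> \<phi> x) + 2 * R\<^sup>2 * (classical_grad \<phi> x \<bullet> classical_grad \<phi> x)"
      by (intro add_mono mult_left_mono di) auto
    finally show "- ((x \<bullet> i) * (2 * \<phi> x * ?d x)) \<le> 1 / 2 * (\<phi> x \<bullet> \<phi> x) + 2 * R\<^sup>2 * (classical_grad \<phi> x \<bullet> classical_grad \<phi> x)" .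
  qed simp
  also have "\<dots> = 1 / 2 * L2_inner \<Omega> \<phi> \<phi> + 2 * R\<^sup>2 * L2_inner \<Omega> (classical_grad \<phi>) (classical_grad \<phi>)"
    using I\<phi> Ig by (simp add: L2_inner_def)
  also have "L2_inner \<Omega> (classical_grad \<phi>) (classical_grad \<phi>) = a_form \<Omega> \<phi> \<phi>"
    unfolding a_form_def using H H1_weak_grad(2)[OF op H(1)] by (intro L2_inner_cong_AE) (auto elim!: eventually_mono)
  finally show ?thesis by simp
qed

lemma poincare_H1_0:
  fixes \<Omega> :: "'a::euclidean_space set"
  assumes op: "open \<Omega>" and R: "\<Omega> \<subseteq> cball 0 R" and v: "v \<in> H1_0 \<Omega>"
  shows "L2_inner \<Omega> v v \<le> 16 * R\<^sup>2 * a_form \<Omega> v v"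
proof -
  obtain \<phi> where \<phi>: "\<And>k. \<phi> k \<in> test_functions \<Omega>" "(\<lambda>k. H1_norm \<Omega> (\<lambda>x. v x - \<phi> k x)) \<longlonglongrightarrow> 0"
    using v by (auto simp: H1_0_def)
  have vH: "v \<in> H1 \<Omega>" using v by (auto simp: H1_0_def)
  note \<phi>H = test_functions_H1(1)[OF op \<phi>(1)]
  have d: "(\<lambda>x. v x - \<phi> k x) \<in> H1 \<Omega>" for k
    using H1_lincomb(1)[OF op vH \<phi>H, of "-1"] by simp
  let ?q = "\<lambda>k. (H1_norm \<Omega> (\<lambda>x. v x - \<phi> k x))\<^sup>2"
  have le: "L2_inner \<Omega> v v \<le> 16 * R\<^sup>2 * a_form \<Omega> v v + (2 + 16 * R\<^sup>2) * ?q k" for k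
  proof -
    let ?e = "\<lambda>x. v x - \<phi> k x"
    have q: "L2_inner \<Omega> ?e ?e \<le> ?q k" "a_form \<Omega> ?e ?e \<le> ?q k"
      using L2_inner_nonneg[of \<Omega> ?e] a_form_nonneg[of \<Omega> ?e] by (auto simp: H1_norm_sq)
    have 1: "L2_inner \<Omega> v v \<le> 2 * L2_inner \<Omega> ?e ?e + 2 * L2_inner \<Omega> (\<phi> k) (\<phi> k)"
      using L2_inner_sum_le[OF H1_weak_grad(3)[OF op d[of k]] H1_weak_grad(3)[OF op \<phi>H[of k]], of 1] by simp
    have 2: "a_form \<Omega> (\<phi> k) (\<phi> k) \<le> 2 * a_form \<Omega> v v + 2 * a_form \<Omega> ?e ?e"
      using a_form_sum_le[OF op vH d[of k], of "-1"] by simp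
    have "L2_inner \<Omega> (\<phi> k) (\<phi> k) \<le> 4 * R\<^sup>2 * (2 * a_form \<Omega> v v + 2 * ?q k)"
      using poincare_test[OF op R \<phi>(1), of k] mult_left_mono[of "a_form \<Omega> (\<phi> k) (\<phi> k)" "2 * a_form \<Omega> v v + 2 * ?q k" "4 * R\<^sup>2"] 2 q
      by auto
    then have "L2_inner \<Omega> v v \<le> 2 * ?q k + 2 * (4 * R\<^sup>2 * (2 * a_form \<Omega> v v + 2 * ?q k))" using 1 q by linarith
    then show ?thesis by (simp add: algebra_simps)
  qed
  have "(\<lambda>k. 16 * R\<^sup>2 * a_form \<Omega> v v + (2 + 16 * R\<^sup>2) * ?q k) \<longlonglongrightarrow> 16 * R\<^sup>2 * a_form \<Omega> v v + (2 + 16 * R\<^sup>2) * 0\<^sup>2"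
    by (intro tendsto_intros \<phi>(2))
  then have "L2_inner \<Omega> v v \<le> 16 * R\<^sup>2 * a_form \<Omega> v v + (2 + 16 * R\<^sup>2) * 0\<^sup>2"
    by (rule tendsto_lowerbound) (simp_all only: le eventually_True trivial_limit_sequentially not_False_eq_True)
  then show ?thesis by simp
qed

section \<open>The finite element space and its inverse inequality\<close>

lemma integral_homothety:
  fixes F :: "'a::euclidean_space \<Rightarrow> real"
  assumes c: "c \<noteq> 0" and F: "integrable lborel F"
  shows "integrable lborel (\<lambda>x. F (t + c *\<^sub>R x))"
    and "(\<integral>x. F (t + c *\<^sub>R x) \<partial>lborel) = (\<integral>x. F x \<partial>lborel) / \<bar>c\<bar> ^ DIM('a)"
proof -
  have Fm: "F \<in> borel_measurable borel" using F by simp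
  have Tm: "(\<lambda>x. t + c *\<^sub>R x) \<in> lborel \<rightarrow>\<^sub>M borel" by simp
  let ?D = "distr lborel borel (\<lambda>x::'a. t + c *\<^sub>R x)"
  have eq: "lborel = density ?D (\<lambda>_. ennreal (\<bar>c\<bar> ^ DIM('a)))"
    using lborel_affine[OF c, of t] by (simp add: ennreal_power)
  have c0: "0 < \<bar>c\<bar> ^ DIM('a)" using c by simp
  have "integrable (density ?D (\<lambda>_. ennreal (\<bar>c\<bar> ^ DIM('a)))) F" using F eq by simp
  then have "integrable ?D (\<lambda>x. \<bar>c\<bar> ^ DIM('a) * F x)" using Fm by (subst (asm) integrable_density) auto
  then have "integrable ?D F" using c0 by (simp add: integrable_mult_left_iff)
  then show "integrable lborel (\<lambda>x. F (t + c *\<^sub>R x))" using Fm Tm by (subst (asm) integrable_distr_eq) auto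
  have "(\<integral>x. F x \<partial>lborel) = (\<integral>x. F x \<partial>density ?D (\<lambda>_. ennreal (\<bar>c\<bar> ^ DIM('a))))" using eq by simp
  also have "\<dots> = (\<integral>x. \<bar>c\<bar> ^ DIM('a) * F x \<partial>?D)" using Fm by (subst integral_density) auto
  also have "\<dots> = \<bar>c\<bar> ^ DIM('a) * (\<integral>x. F x \<partial>?D)" by simp
  also have "(\<integral>x. F x \<partial>?D) = (\<integral>x. F (t + c *\<^sub>R x) \<partial>lborel)" using Fm Tm by (subst integral_distr) auto
  finally show "(\<integral>x. F (t + c *\<^sub>R x) \<partial>lborel) = (\<integral>x. F x \<partial>lborel) / \<bar>c\<bar> ^ DIM('a)" using c0 by simp
qed

lemma integrable_indicator_compact:
  fixes f :: "'a::euclidean_space \<Rightarrow> real"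
  assumes "compact K" "continuous_on UNIV f"
  shows "integrable lborel (\<lambda>x. indicator K x * f x)"
  using borel_integrable_compact[OF assms(1), of f] assms(2) by (auto intro: continuous_on_subset)

text \<open>Let \<open>e\<close> be the direction of \<open>p\<close>.  The maps \<open>x \<mapsto> (x + c \<plusminus> r e) / 2\<close> send the convex set \<open>K\<close> into itself, because
\<open>c \<plusminus> r e\<close> lies in \<open>K\<close>, and the values of the affine function at the two image points differ by \<open>r \<bar>p\<bar>\<close>.  So
\<open>r\<^sup>2 \<bar>p\<bar>\<^sup>2\<close> is at most twice the sum of the two squared values; integrating over \<open>K\<close> and changing variables costs the
factor \<open>2^n\<close> for each map.\<close>

lemma gradient_le_affine_on_convex:
  fixes K :: "'a::euclidean_space set"
  assumes K: "compact K" "convex K" and r: "0 < r" "cball c r \<subseteq> K"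
  shows "r\<^sup>2 * (\<integral>x. indicator K x * (norm p)\<^sup>2 \<partial>lborel) \<le> 2 ^ (DIM('a) + 2) * (\<integral>x. indicator K x * (p \<bullet> x + q)\<^sup>2 \<partial>lborel)"
proof -
  define e where "e = p /\<^sub>R norm p"
  have e: "norm e \<le> 1" "p \<bullet> e = norm p"
    by (cases "p = 0"; simp add: e_def power2_norm_eq_inner[symmetric] power2_eq_square)+
  define t where "t s = (1 / 2) *\<^sub>R (c + (s * r) *\<^sub>R e)" for s :: real
  let ?F = "\<lambda>x. indicator K x * (p \<bullet> x + q)\<^sup>2"
  let ?T = "\<lambda>s x. t s + (1 / 2) *\<^sub>R x"
  have F_int: "integrable lborel ?F"
    using K by (intro integrable_indicator_compact) (auto intro!: continuous_intros)
  have T_in: "?T s x \<in> K" if "x \<in> K" "\<bar>s\<bar> = 1" for s x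
  proof -
    have "norm ((s * r) *\<^sub>R e) \<le> r * 1" using that r e by (simp add: abs_mult mult_left_le)
    then have "c + (s * r) *\<^sub>R e \<in> cball c r" by (simp add: dist_norm)
    then have "c + (s * r) *\<^sub>R e \<in> K" using r by blast
    then have "(1 / 2) *\<^sub>R (c + (s * r) *\<^sub>R e) + (1 / 2) *\<^sub>R x \<in> K"
      using that K(2) by (intro convexD) auto
    then show ?thesis by (simp add: t_def)
  qed
  have bound: "r\<^sup>2 * (indicator K x * (norm p)\<^sup>2) \<le> 2 * ?F (?T 1 x) + 2 * ?F (?T (-1) x)" for x
  proof (cases "x \<in> K")
    case True
    let ?l = "\<lambda>x. p \<bullet> x + q"
    have sq: "(a - b)\<^sup>2 \<le> 2 * a\<^sup>2 + 2 * b\<^sup>2" for a b :: real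
      using zero_le_power2[of "a + b"] by (simp add: power2_eq_square algebra_simps)
    have "?l (?T 1 x) - ?l (?T (-1) x) = r * norm p" by (simp add: t_def inner_simps e(2) field_simps)
    then have "r\<^sup>2 * (norm p)\<^sup>2 = (?l (?T 1 x) - ?l (?T (-1) x))\<^sup>2" by (simp add: power_mult_distrib)
    also have "\<dots> \<le> 2 * (?l (?T 1 x))\<^sup>2 + 2 * (?l (?T (-1) x))\<^sup>2"
      by (rule sq)
    finally show ?thesis using T_in[OF True, of 1] T_in[OF True, of "-1"] True by simp
  qed simp
  have I1: "integrable lborel (\<lambda>x. r\<^sup>2 * (indicator K x * (norm p)\<^sup>2))"
    using K by (intro integrable_mult_right integrable_indicator_compact) (auto intro!: continuous_intros)
  have I2: "integrable lborel (\<lambda>x. ?F (?T s x))" and E2: "(\<integral>x. ?F (?T s x) \<partial>lborel) = 2 ^ DIM('a) * (\<integral>x. ?F x \<partial>lborel)" for s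
    using integral_homothety[OF _ F_int, of "1/2" "t s"] by (simp_all add: power_divide)
  have "r\<^sup>2 * (\<integral>x. indicator K x * (norm p)\<^sup>2 \<partial>lborel) = (\<integral>x. r\<^sup>2 * (indicator K x * (norm p)\<^sup>2) \<partial>lborel)" by simp
  also have "\<dots> \<le> (\<integral>x. 2 * ?F (?T 1 x) + 2 * ?F (?T (-1) x) \<partial>lborel)"
    by (intro integral_mono I1 Bochner_Integration.integrable_add integrable_mult_right I2 bound)
  also have "\<dots> = 2 * (\<integral>x. ?F (?T 1 x) \<partial>lborel) + 2 * (\<integral>x. ?F (?T (-1) x) \<partial>lborel)"
    by (subst Bochner_Integration.integral_add) (intro integrable_mult_right I2, intro integrable_mult_right I2, simp)
  also have "\<dots> = 2 ^ (DIM('a) + 2) * (\<integral>x. ?F x \<partial>lborel)" unfolding E2 by simp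
  finally show ?thesis .
qed

lemma mesh_element:
  assumes "mesh_of \<Omega>h Th" "K \<in> Th"
  shows "compact K" "convex K"
proof -
  obtain C where "finite C" "K = convex hull C"
    using assms unfolding mesh_of_def simplex by blast
  then show "compact K" "convex K" by (simp_all add: finite_imp_compact_convex_hull)
qed

text \<open>Interiors of different elements are disjoint: the intersection of two elements is a face of both, and a face that
meets the interior is the whole element.\<close>

lemma mesh_basic:
  assumes "mesh_of \<Omega>h Th"
  shows "finite Th" "open \<Omega>h" "\<Omega>h \<subseteq> \<Union>Th" "K \<in> Th \<Longrightarrow> interior K \<subseteq> \<Omega>h" "bounded \<Omega>h"
    "K \<in> Th \<Longrightarrow> K' \<in> Th \<Longrightarrow> K \<noteq> K' \<Longrightarrow> interior K \<inter> interior K' = {}"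
proof -
  have M: "triangulation Th" "\<Omega>h = interior (\<Union>Th)" using assms by (auto simp: mesh_of_def)
  show fin: "finite Th" using M by (simp add: triangulation_def)
  show "open \<Omega>h" "\<Omega>h \<subseteq> \<Union>Th" using M interior_subset by auto
  show "interior K \<subseteq> \<Omega>h" if "K \<in> Th" for K unfolding M(2) by (rule interior_mono) (use that in blast)
  have "bounded (\<Union>Th)" using fin mesh_element(1)[OF assms] compact_imp_bounded by (intro bounded_Union) auto
  then show "bounded \<Omega>h" using M(2) interior_subset bounded_subset by metis
  show "interior K \<inter> interior K' = {}" if "K \<in> Th" "K' \<in> Th" "K \<noteq> K'" for K K'
  proof (rule ccontr)
    assume "interior K \<inter> interior K' \<noteq> {}"
    then obtain x where x: "x \<in> interior K" "x \<in> interior K'" by auto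
    then have xx: "x \<in> K \<inter> K'" using interior_subset by blast
    have "(K \<inter> K') face_of K" using M(1) that unfolding triangulation_def by blast
    moreover have "(K' \<inter> K) face_of K'" using M(1) that unfolding triangulation_def by blast
    ultimately have "K \<inter> K' = K" "K' \<inter> K = K'"
      using face_of_disjoint_interior[of "K \<inter> K'" K] face_of_disjoint_interior[of "K' \<inter> K" K'] x xx by blast+
    then show False using that by blast
  qed
qed

lemma Vh_H1: "v \<in> Vh \<Omega>h Th \<Longrightarrow> v \<in> H1 \<Omega>h" and Vh_H1_0: "v \<in> Vh \<Omega>h Th \<Longrightarrow> v \<in> H1_0 \<Omega>h"
  by (auto simp: Vh_def H1_0_def)

lemma Vh_lincomb:
  assumes op: "open \<Omega>h" and u: "u \<in> Vh \<Omega>h Th" and v: "v \<in> Vh \<Omega>h Th"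
  shows "(\<lambda>x. u x + r * v x) \<in> Vh \<Omega>h Th"
proof -
  have "affine_fun_on K (\<lambda>x. u x + r * v x)" if "affine_fun_on K u" "affine_fun_on K v" for K
  proof -
    obtain a b a' b' where "\<forall>x\<in>K. u x = a \<bullet> x + b" "\<forall>x\<in>K. v x = a' \<bullet> x + b'"
      using \<open>affine_fun_on K u\<close> \<open>affine_fun_on K v\<close> by (auto simp: affine_fun_on_def)
    then have "\<forall>x\<in>K. u x + r * v x = (a + r *\<^sub>R a') \<bullet> x + (b + r * b')" by (simp add: inner_simps algebra_simps)
    then show ?thesis unfolding affine_fun_on_def by blast
  qed
  then show ?thesis using u v H1_0_lincomb[OF op] by (simp add: Vh_def)
qed

lemma Vh_zero: "open \<Omega>h \<Longrightarrow> (\<lambda>x. 0) \<in> Vh \<Omega>h Th"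
  using H1_0_zero[of \<Omega>h] by (auto simp: Vh_def affine_fun_on_def intro!: exI[of _ 0])

text \<open>The estimate on one element is summed over the mesh.  Almost every point of the domain lies in the interior of
exactly one element, because boundaries of convex sets are null sets, and quasi-uniformity bounds \<open>h\<close> by
\<open>2 \<sigma> \<kappa>\<close> times the radius of the inscribed ball.\<close>

lemma inverse_inequality:
  fixes Th :: "'a::euclidean_space set set"
  assumes mesh: "mesh_of \<Omega>h Th" and qu: "quasi_uniform \<sigma> \<kappa> Th" and h: "mesh_size Th = h" "0 < h"
    and v: "v \<in> Vh \<Omega>h Th"
  shows "h\<^sup>2 * a_form \<Omega>h v v \<le> 2 ^ (DIM('a) + 2) * (2 * \<sigma> * \<kappa>)\<^sup>2 * L2_inner \<Omega>h v v"
proof -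
  note B = mesh_basic[OF mesh]
  have op: "open \<Omega>h" by (rule B(2))
  note el = mesh_element[OF mesh]
  have "\<forall>K\<in>Th. \<exists>p q. \<forall>x\<in>K. v x = p \<bullet> x + q" using v by (auto simp: Vh_def affine_fun_on_def)
  then obtain p q where pq: "\<And>K x. K \<in> Th \<Longrightarrow> x \<in> K \<Longrightarrow> v x = p K \<bullet> x + q K" by metis
  note W = H1_weak_grad[OF op Vh_H1[OF v]]
  let ?g = "weak_grad \<Omega>h v"
  let ?C = "2 ^ (DIM('a) + 2) :: real"
  have elem: "h\<^sup>2 * (\<integral>x. indicator K x * (norm (p K))\<^sup>2 \<partial>lborel) \<le> ?C * (2 * \<sigma> * \<kappa>)\<^sup>2 * (\<integral>x. indicator K x * (p K \<bullet> x + q K)\<^sup>2 \<partial>lborel)" if K: "K \<in> Th" for K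
  proof -
    obtain c r where r: "0 < r" "cball c r \<subseteq> K" "diameter K \<le> \<sigma> * (2 * r)" and hK: "h \<le> \<kappa> * diameter K"
      using qu K h(1) unfolding quasi_uniform_def by blast
    have "0 \<le> diameter K" using el(1)[OF K] by (intro diameter_ge_0 compact_imp_bounded)
    moreover have "0 < \<kappa> * diameter K" using hK h by linarith
    ultimately have "0 < \<kappa>" by (simp add: zero_less_mult_iff)
    then have "h \<le> \<kappa> * (\<sigma> * (2 * r))" using mult_left_mono[OF r(3), of \<kappa>] hK by linarith
    then have "h\<^sup>2 \<le> (\<kappa> * (\<sigma> * (2 * r)))\<^sup>2" using h by (intro power_mono) auto
    also have "\<dots> = (2 * \<sigma> * \<kappa>)\<^sup>2 * r\<^sup>2" by (simp add: power_mult_distrib)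
    finally have hr: "h\<^sup>2 \<le> (2 * \<sigma> * \<kappa>)\<^sup>2 * r\<^sup>2" .
    have "h\<^sup>2 * (\<integral>x. indicator K x * (norm (p K))\<^sup>2 \<partial>lborel) \<le> (2 * \<sigma> * \<kappa>)\<^sup>2 * r\<^sup>2 * (\<integral>x. indicator K x * (norm (p K))\<^sup>2 \<partial>lborel)"
      by (rule mult_right_mono[OF hr]) simp
    also have "\<dots> = (2 * \<sigma> * \<kappa>)\<^sup>2 * (r\<^sup>2 * (\<integral>x. indicator K x * (norm (p K))\<^sup>2 \<partial>lborel))" by simp
    also have "\<dots> \<le> (2 * \<sigma> * \<kappa>)\<^sup>2 * (?C * (\<integral>x. indicator K x * (p K \<bullet> x + q K)\<^sup>2 \<partial>lborel))"
      by (rule mult_left_mono[OF gradient_le_affine_on_convex[OF el[OF K] r(1,2)]]) simp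
    finally show ?thesis by (simp add: mult.commute mult.left_commute)
  qed
  have leb: "integrable lebesgue F" "integral\<^sup>L lebesgue F = integral\<^sup>L lborel F" if "integrable lborel F" for F :: "'a \<Rightarrow> real"
    using that integrable_completion[of F lborel] integral_completion[of F lborel] borel_measurable_integrable[OF that] by auto
  have I1: "integrable lborel (\<lambda>x. indicator K x * (norm (p K))\<^sup>2)" if "K \<in> Th" for K
    using el(1)[OF that] by (intro integrable_indicator_compact) (auto intro!: continuous_intros)
  have I2: "integrable lborel (\<lambda>x. indicator K x * (p K \<bullet> x + q K)\<^sup>2)" if "K \<in> Th" for K
    using el(1)[OF that] by (intro integrable_indicator_compact) (auto intro!: continuous_intros)
  have grad_ae: "AE x in lebesgue. \<forall>K\<in>Th. x \<in> interior K \<longrightarrow> ?g x = p K"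
  proof (subst AE_ball_countable[OF countable_finite[OF B(1)]], rule ballI)
    fix K assume K: "K \<in> Th"
    have "AE x in lebesgue_on (interior K). ?g x = p K"
      using pq[OF K] interior_subset by (intro weak_grad_of_locally_affine[OF op open_interior B(4)[OF K] W(1), of "p K" "q K"]) blast
    then show "AE x in lebesgue. x \<in> interior K \<longrightarrow> ?g x = p K" by (simp add: AE_restrict_space_iff)
  qed
  have int_ae: "AE x in lebesgue. \<forall>K\<in>Th. x \<in> K \<longrightarrow> x \<in> interior K"
  proof (subst AE_ball_countable[OF countable_finite[OF B(1)]], rule ballI)
    fix K assume K: "K \<in> Th"
    have "frontier K \<in> null_sets lebesgue"
      using negligible_convex_frontier[OF el(2)[OF K]] by (simp add: negligible_iff_null_sets)
    from AE_not_in[OF this] show "AE x in lebesgue. x \<in> K \<longrightarrow> x \<in> interior K"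
      by eventually_elim (use closure_subset in \<open>auto simp: frontier_def\<close>)
  qed
  have Ig: "integrable lebesgue (\<lambda>x. indicator \<Omega>h x * (?g x \<bullet> ?g x))"
    using L2_inner_integrable[OF W(2,2)] op by (simp add: integrable_restrict_space)
  have Iv: "integrable lebesgue (\<lambda>x. indicator \<Omega>h x * (v x \<bullet> v x))"
    using L2_inner_integrable[OF W(3,3)] op by (simp add: integrable_restrict_space)
  have "a_form \<Omega>h v v = (\<integral>x. indicator \<Omega>h x * (?g x \<bullet> ?g x) \<partial>lebesgue)"
    using op by (simp add: a_form_def L2_inner_def integral_restrict_space)
  also have "\<dots> \<le> (\<integral>x. (\<Sum>K\<in>Th. indicator K x * (norm (p K))\<^sup>2) \<partial>lebesgue)"
  proof (rule integral_mono_AE[OF Ig])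
    show "integrable lebesgue (\<lambda>x. \<Sum>K\<in>Th. indicator K x * (norm (p K))\<^sup>2)"
      using I1 leb by (intro Bochner_Integration.integrable_sum) auto
    show "AE x in lebesgue. indicator \<Omega>h x * (?g x \<bullet> ?g x) \<le> (\<Sum>K\<in>Th. indicator K x * (norm (p K))\<^sup>2)"
      using grad_ae int_ae
    proof eventually_elim
      fix x assume x: "\<forall>K\<in>Th. x \<in> interior K \<longrightarrow> ?g x = p K" "\<forall>K\<in>Th. x \<in> K \<longrightarrow> x \<in> interior K"
      show "indicator \<Omega>h x * (?g x \<bullet> ?g x) \<le> (\<Sum>K\<in>Th. indicator K x * (norm (p K))\<^sup>2)"
      proof (cases "x \<in> \<Omega>h")
        case True
        then obtain K where K: "K \<in> Th" "x \<in> K" using B(3) by blast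
        then have "indicator \<Omega>h x * (?g x \<bullet> ?g x) = indicator K x * (norm (p K))\<^sup>2"
          using x True by (simp add: power2_norm_eq_inner)
        also have "\<dots> \<le> (\<Sum>K\<in>Th. indicator K x * (norm (p K))\<^sup>2)"
          using K B(1) by (intro member_le_sum) auto
        finally show ?thesis .
      qed (auto intro!: sum_nonneg)
    qed
  qed
  also have "\<dots> = (\<Sum>K\<in>Th. \<integral>x. indicator K x * (norm (p K))\<^sup>2 \<partial>lebesgue)"
    using I1 leb by (intro Bochner_Integration.integral_sum) auto
  also have "\<dots> = (\<Sum>K\<in>Th. \<integral>x. indicator K x * (norm (p K))\<^sup>2 \<partial>lborel)"
    by (intro sum.cong refl leb(2) I1)
  finally have "h\<^sup>2 * a_form \<Omega>h v v \<le> h\<^sup>2 * (\<Sum>K\<in>Th. \<integral>x. indicator K x * (norm (p K))\<^sup>2 \<partial>lborel)"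
    by (rule mult_left_mono) simp
  also have "\<dots> = (\<Sum>K\<in>Th. h\<^sup>2 * (\<integral>x. indicator K x * (norm (p K))\<^sup>2 \<partial>lborel))" by (simp only: sum_distrib_left)
  also have "\<dots> \<le> (\<Sum>K\<in>Th. ?C * (2 * \<sigma> * \<kappa>)\<^sup>2 * (\<integral>x. indicator K x * (p K \<bullet> x + q K)\<^sup>2 \<partial>lborel))"
    by (intro sum_mono elem)
  also have "\<dots> = ?C * (2 * \<sigma> * \<kappa>)\<^sup>2 * (\<Sum>K\<in>Th. \<integral>x. indicator K x * (p K \<bullet> x + q K)\<^sup>2 \<partial>lborel)"
    by (simp only: sum_distrib_left)
  also have "(\<Sum>K\<in>Th. \<integral>x. indicator K x * (p K \<bullet> x + q K)\<^sup>2 \<partial>lborel) = (\<Sum>K\<in>Th. \<integral>x. indicator K x * (p K \<bullet> x + q K)\<^sup>2 \<partial>lebesgue)"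
    by (intro sum.cong refl leb(2)[symmetric] I2)
  also have "\<dots> = (\<integral>x. (\<Sum>K\<in>Th. indicator K x * (p K \<bullet> x + q K)\<^sup>2) \<partial>lebesgue)"
    using I2 leb by (intro Bochner_Integration.integral_sum[symmetric]) auto
  also have "?C * (2 * \<sigma> * \<kappa>)\<^sup>2 * \<dots> \<le> ?C * (2 * \<sigma> * \<kappa>)\<^sup>2 * (\<integral>x. indicator \<Omega>h x * (v x \<bullet> v x) \<partial>lebesgue)"
  proof (rule mult_left_mono[OF integral_mono_AE[OF _ Iv]])
    show "integrable lebesgue (\<lambda>x. \<Sum>K\<in>Th. indicator K x * (p K \<bullet> x + q K)\<^sup>2)"
      using I2 leb by (intro Bochner_Integration.integrable_sum) auto
    show "AE x in lebesgue. (\<Sum>K\<in>Th. indicator K x * (p K \<bullet> x + q K)\<^sup>2) \<le> indicator \<Omega>h x * (v x \<bullet> v x)"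
      using int_ae
    proof eventually_elim
      fix x assume x: "\<forall>K\<in>Th. x \<in> K \<longrightarrow> x \<in> interior K"
      show "(\<Sum>K\<in>Th. indicator K x * (p K \<bullet> x + q K)\<^sup>2) \<le> indicator \<Omega>h x * (v x \<bullet> v x)"
      proof (cases "\<exists>K\<in>Th. x \<in> K")
        case True
        then obtain K where K: "K \<in> Th" "x \<in> K" by blast
        have "x \<notin> L" if "L \<in> Th - {K}" for L
          using B(6)[OF K(1), of L] that x K by blast
        then have "(\<Sum>K\<in>Th. indicator K x * (p K \<bullet> x + q K)\<^sup>2) = (\<Sum>L\<in>{K}. indicator L x * (p L \<bullet> x + q L)\<^sup>2)"
          using K B(1) by (intro sum.mono_neutral_right) auto
        also have "\<dots> = v x \<bullet> v x" using K pq[OF K] by (simp add: power2_eq_square)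
        finally show ?thesis using B(4)[OF K(1)] x K by (auto simp: indicator_def)
      next
        case False
        then have "(\<Sum>K\<in>Th. indicator K x * (p K \<bullet> x + q K)\<^sup>2) = 0" by (intro sum.neutral) auto
        then show ?thesis by simp
      qed
    qed
  qed simp
  also have "(\<integral>x. indicator \<Omega>h x * (v x \<bullet> v x) \<partial>lebesgue) = L2_inner \<Omega>h v v"
    using op by (simp add: L2_inner_def integral_restrict_space)
  finally show ?thesis .
qed

text \<open>A ray that starts at a point of \<open>S\<close> and leads away from the origin leaves \<open>S\<close> through a boundary point of larger
norm.\<close>

lemma bounded_by_frontier:
  fixes S :: "'a::euclidean_space set"
  assumes S: "bounded S" "open S" and R: "frontier S \<subseteq> cball 0 R" "0 \<le> R"
  shows "S \<subseteq> cball 0 R"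
proof
  fix x assume x: "x \<in> S"
  show "x \<in> cball 0 R"
  proof (rule ccontr)
    assume "x \<notin> cball 0 R"
    then have xR: "R < norm x" by simp
    then have "x \<noteq> 0" using R by auto
    have "x \<in> interior S" using x S by (simp add: interior_open)
    obtain d where d: "0 < d" "x + d *\<^sub>R x \<in> frontier S"
      by (rule ray_to_frontier[OF S(1) \<open>x \<in> interior S\<close> \<open>x \<noteq> 0\<close>])
    have "norm (x + d *\<^sub>R x) = (1 + d) * norm x"
      using d(1) by (metis abs_of_pos add_pos_pos norm_scaleR scaleR_add_left scaleR_one zero_less_one)
    moreover have "norm x \<le> (1 + d) * norm x" using d(1) by (simp add: distrib_right)
    ultimately show False using d(2) R xR by (auto simp: subset_iff)
  qed
qed

section \<open>Uniform bounds for the domains and the coupling coefficient\<close>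

text \<open>On a domain of positive measure both norms are nonnegative, so the supremum norm of the error alone is below the
bound; on a null set there is nothing to show.\<close>

lemma chih_bound_AE:
  fixes \<Omega>h :: "'a::euclidean_space set"
  assumes ne: "open \<Omega>h" and B: "\<And>x. x \<in> \<Omega>h \<Longrightarrow> \<bar>chi x\<bar> \<le> B" and h: "0 < h"
    and err: "Linf_norm \<Omega>h (\<lambda>x. chi x - chih x) + ereal h * W1inf_norm \<Omega>h (\<lambda>x. chi x - chih x) \<le> ereal c"
  shows "AE x in lebesgue_on \<Omega>h. \<bar>chih x\<bar> \<le> B + c"
proof (cases "emeasure (lebesgue_on \<Omega>h) (space (lebesgue_on \<Omega>h)) = 0")
  case True
  then have "space (lebesgue_on \<Omega>h) \<in> null_sets (lebesgue_on \<Omega>h)" by (simp add: null_sets_def)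
  from AE_not_in[OF this] show ?thesis by (auto elim!: AE_mp)
next
  case False
  have nonneg: "0 \<le> Linf_norm \<Omega>h f" for f :: "'a \<Rightarrow> 'b::euclidean_space"
  proof -
    have "0 = esssup (lebesgue_on \<Omega>h) (\<lambda>x. 0 :: ereal)" using False by (simp add: esssup_const)
    also have "\<dots> \<le> Linf_norm \<Omega>h f" unfolding Linf_norm_def by (intro esssup_mono) auto
    finally show ?thesis .
  qed
  let ?f = "\<lambda>x. chi x - chih x"
  have "0 \<le> W1inf_norm \<Omega>h ?f" unfolding W1inf_norm_def by (intro add_nonneg_nonneg nonneg)
  then have "0 \<le> ereal h * W1inf_norm \<Omega>h ?f" using h by simp
  then have "Linf_norm \<Omega>h ?f \<le> Linf_norm \<Omega>h ?f + ereal h * W1inf_norm \<Omega>h ?f" by (rule add_increasing2) simp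
  then have le: "Linf_norm \<Omega>h ?f \<le> ereal c" using err by (rule order_trans)
  have "AE x in lebesgue_on \<Omega>h. ereal (norm (?f x)) \<le> Linf_norm \<Omega>h ?f" unfolding Linf_norm_def by (rule esssup_AE)
  then have "AE x in lebesgue_on \<Omega>h. norm (?f x) \<le> c" by eventually_elim (use le order_trans in fastforce)
  moreover have "AE x in lebesgue_on \<Omega>h. \<bar>chi x\<bar> \<le> B" using B by (intro AE_I2) simp
  ultimately show ?thesis by eventually_elim (simp add: abs_le_iff)
qed

lemma chi_mult_L2:
  fixes u :: "'a::euclidean_space \<Rightarrow> real"
  assumes chi: "chi \<in> borel_measurable (lebesgue_on \<Omega>)" "AE x in lebesgue_on \<Omega>. \<bar>chi x\<bar> \<le> M" and u: "u \<in> L2 \<Omega>"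
  shows "(\<lambda>x. chi x * u x) \<in> L2 \<Omega>"
  unfolding L2_def mem_Collect_eq
proof
  show meas: "(\<lambda>x. chi x * u x) \<in> borel_measurable (lebesgue_on \<Omega>)"
    using chi(1) u by (auto simp: L2_def)
  show "integrable (lebesgue_on \<Omega>) (\<lambda>x. (norm (chi x * u x))\<^sup>2)"
  proof (rule Bochner_Integration.integrable_bound)
    show "integrable (lebesgue_on \<Omega>) (\<lambda>x. M\<^sup>2 * (norm (u x))\<^sup>2)" using u by (intro integrable_mult_right) (simp add: L2_def)
    show "(\<lambda>x. (norm (chi x * u x))\<^sup>2) \<in> borel_measurable (lebesgue_on \<Omega>)" using meas by measurable
    show "AE x in lebesgue_on \<Omega>. norm ((norm (chi x * u x))\<^sup>2) \<le> norm (M\<^sup>2 * (norm (u x))\<^sup>2)"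
      using chi(2)
    proof eventually_elim
      fix x assume "\<bar>chi x\<bar> \<le> M"
      then have "\<bar>chi x\<bar>\<^sup>2 \<le> M\<^sup>2" by (intro power_mono) auto
      then show "norm ((norm (chi x * u x))\<^sup>2) \<le> norm (M\<^sup>2 * (norm (u x))\<^sup>2)"
        by (simp add: power_mult_distrib mult_right_mono)
    qed
  qed
qed

lemma chi_coupling_le:
  fixes u v :: "'a::euclidean_space \<Rightarrow> real"
  assumes chi: "chi \<in> borel_measurable (lebesgue_on \<Omega>)" "AE x in lebesgue_on \<Omega>. \<bar>chi x\<bar> \<le> M" and u: "u \<in> L2 \<Omega>" and v: "v \<in> L2 \<Omega>"
  shows "L2_inner \<Omega> (\<lambda>x. chi x * u x) v \<le> M * (L2_inner \<Omega> u u + L2_inner \<Omega> v v) / 2"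
proof -
  note I = L2_inner_integrable[OF u u] L2_inner_integrable[OF v v] L2_inner_integrable[OF chi_mult_L2[OF chi u] v]
  have "L2_inner \<Omega> (\<lambda>x. chi x * u x) v \<le> integral\<^sup>L (lebesgue_on \<Omega>) (\<lambda>x. M / 2 * (u x \<bullet> u x + v x \<bullet> v x))"
    unfolding L2_inner_def
  proof (rule integral_mono_AE[OF I(3)])
    show "integrable (lebesgue_on \<Omega>) (\<lambda>x. M / 2 * (u x \<bullet> u x + v x \<bullet> v x))"
      by (intro integrable_mult_right Bochner_Integration.integrable_add I)
    show "AE x in lebesgue_on \<Omega>. (chi x * u x) \<bullet> v x \<le> M / 2 * (u x \<bullet> u x + v x \<bullet> v x)"
      using chi(2)
    proof eventually_elim
      fix x assume M: "\<bar>chi x\<bar> \<le> M"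
      have uv: "\<bar>u x * v x\<bar> \<le> (u x * u x + v x * v x) / 2"
        using sum_squares_bound[of "u x" "v x"] sum_squares_bound[of "u x" "- v x"] by (simp add: abs_le_iff power2_eq_square)
      have "chi x * (u x * v x) \<le> \<bar>chi x\<bar> * \<bar>u x * v x\<bar>" by (metis abs_ge_self abs_mult)
      also have "\<dots> \<le> M * ((u x * u x + v x * v x) / 2)" using M uv by (intro mult_mono) auto
      finally show "(chi x * u x) \<bullet> v x \<le> M / 2 * (u x \<bullet> u x + v x \<bullet> v x)" by (simp add: mult.assoc)
    qed
  qed
  also have "\<dots> = M * (L2_inner \<Omega> u u + L2_inner \<Omega> v v) / 2" using I by (simp add: L2_inner_def)
  finally show ?thesis .
qed

text \<open>The boundary of each approximate domain stays within a fixed distance of the bounded set \<open>frontier \<Omega>\<close>, and a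
bounded open set does not extend beyond its boundary.\<close>

lemma mesh_domain_uniformly_bounded:
  fixes \<Omega> :: "'a::euclidean_space set"
  assumes \<Omega>: "bounded \<Omega>" "\<Omega> \<noteq> {}"
  shows "\<exists>R\<ge>0. \<forall>\<Omega>h Th h. mesh_of \<Omega>h Th \<and> 0 < h \<and> h \<le> 1 \<and>
     (\<forall>x\<in>frontier \<Omega>h. infdist x (frontier \<Omega>) \<le> C * h\<^sup>2) \<longrightarrow> \<Omega>h \<subseteq> cball 0 R"
proof -
  have "\<Omega> \<noteq> UNIV" using \<Omega> not_bounded_UNIV by blast
  then have ne: "frontier \<Omega> \<noteq> {}" using \<Omega> frontier_not_empty by blast
  have "bounded (frontier \<Omega>)" by (rule bounded_subset[OF bounded_closure[OF \<Omega>(1)]]) (auto simp: frontier_def)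
  then obtain b where b: "\<And>x. x \<in> frontier \<Omega> \<Longrightarrow> norm x \<le> b" by (auto simp: bounded_iff)
  define R where "R = \<bar>b\<bar> + \<bar>C\<bar>"
  show ?thesis
  proof (intro exI[of _ R] conjI allI impI)
    show "0 \<le> R" by (simp add: R_def)
    fix \<Omega>h Th and h :: real
    assume "mesh_of \<Omega>h (Th :: 'a set set) \<and> 0 < h \<and> h \<le> 1 \<and> (\<forall>x\<in>frontier \<Omega>h. infdist x (frontier \<Omega>) \<le> C * h\<^sup>2)"
    then have mesh: "mesh_of \<Omega>h Th" and h: "0 < h" "h \<le> 1"
      and dist: "\<forall>x\<in>frontier \<Omega>h. infdist x (frontier \<Omega>) \<le> C * h\<^sup>2" by auto
    show "\<Omega>h \<subseteq> cball 0 R"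
    proof (rule bounded_by_frontier)
      show "bounded \<Omega>h" "open \<Omega>h" using mesh_basic[OF mesh] by auto
      show "frontier \<Omega>h \<subseteq> cball 0 R"
      proof
        fix x assume x: "x \<in> frontier \<Omega>h"
        obtain y where y: "y \<in> frontier \<Omega>" "infdist x (frontier \<Omega>) = dist x y"
          using infdist_attains_inf[OF frontier_closed ne] by metis
        have "norm x \<le> norm y + dist x y" using norm_triangle_sub[of x y] by (simp add: dist_norm)
        also have "dist x y \<le> C * h\<^sup>2" using dist x y by auto
        also have "C * h\<^sup>2 \<le> \<bar>C\<bar> * 1" using h by (intro mult_mono) (auto simp: power_le_one)
        also have "norm y \<le> \<bar>b\<bar>" using b[OF y(1)] by linarith
        finally show "x \<in> cball 0 R" by (simp add: R_def)
      qed
    qed (simp add: R_def)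
  qed
qed

section \<open>Semi-inner products and discrete time calculus\<close>

locale semi_inner =
  fixes q :: "'v::real_vector \<Rightarrow> 'v \<Rightarrow> real"
  assumes bil: "bilinear q" and commute: "q x y = q y x" and nonneg: "0 \<le> q x x"
begin

abbreviation "sq x \<equiv> q x x"

lemmas expand = bilinear_ladd[OF bil] bilinear_radd[OF bil] bilinear_lmul[OF bil] bilinear_rmul[OF bil]
  bilinear_lsub[OF bil] bilinear_rsub[OF bil] bilinear_lneg[OF bil] bilinear_rneg[OF bil]
  bilinear_lzero[OF bil] bilinear_rzero[OF bil]

lemma young:
  assumes "\<delta> > 0"
  shows "\<bar>q x y\<bar> \<le> (\<delta> * q x x + q y y / \<delta>) / 2"
proof -
  have "0 \<le> q (\<delta> *\<^sub>R x - y) (\<delta> *\<^sub>R x - y)" "0 \<le> q (\<delta> *\<^sub>R x + y) (\<delta> *\<^sub>R x + y)"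
    by (rule nonneg)+
  then have "0 \<le> \<delta> * (\<delta> * q x x) + q y y - 2 * (\<delta> * q x y)" "0 \<le> \<delta> * (\<delta> * q x x) + q y y + 2 * (\<delta> * q x y)"
    by (simp_all add: expand commute[of y x] algebra_simps)
  then have "\<bar>q x y\<bar> * \<delta> * 2 \<le> \<delta> * \<delta> * q x x + q y y"
    using assms by (simp add: abs_if algebra_simps)
  also have "\<dots> = (\<delta> * q x x + q y y / \<delta>) * \<delta>"
    using assms by (simp add: field_simps)
  finally show ?thesis
    using assms by simp
qed

lemma add_le: "q (x + y) (x + y) \<le> 2 * q x x + 2 * q y y"
  using young[of 1 x y] by (simp add: expand commute[of y x])

lemma diff_le: "q (x - y) (x - y) \<le> 2 * q x x + 2 * q y y"
  using young[of 1 x y] by (simp add: expand commute[of y x])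

text \<open>The difference of both sides is half the value of the quadratic form at \<open>x - y\<close>: this is the numerical dissipation
of the implicit Euler method.\<close>

lemma backward_difference_test: "(q x x - q y y) / 2 \<le> q (x - y) x"
  using young[of 1 y x] by (simp add: expand)

lemma sum_le:
  assumes "finite A"
  shows "q (\<Sum>i\<in>A. x i) (\<Sum>i\<in>A. x i) \<le> real (card A) * (\<Sum>i\<in>A. q (x i) (x i))"
proof -
  have "q (\<Sum>i\<in>A. x i) (\<Sum>i\<in>A. x i) = (\<Sum>(i,j)\<in>A\<times>A. q (x i) (x j))"
    using bilinear_sum[OF bil] by blast
  also have "\<dots> = (\<Sum>i\<in>A. \<Sum>j\<in>A. q (x i) (x j))"
    by (simp add: sum.cartesian_product)
  also have "\<dots> \<le> (\<Sum>i\<in>A. \<Sum>j\<in>A. (q (x i) (x i) + q (x j) (x j)) / 2)"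
    using young[of 1] by (intro sum_mono) (metis abs_le_D1 div_by_1 mult_1 zero_less_one)
  also have "\<dots> = (\<Sum>i\<in>A. (real (card A) * q (x i) (x i) + (\<Sum>j\<in>A. q (x j) (x j))) / 2)"
    by (simp add: sum_divide_distrib[symmetric] sum.distrib)
  also have "\<dots> = real (card A) * (\<Sum>i\<in>A. q (x i) (x i))"
    by (simp add: sum_divide_distrib[symmetric] sum.distrib sum_distrib_left[symmetric])
  finally show ?thesis .
qed

end

definition bdiff :: "real \<Rightarrow> (nat \<Rightarrow> 'v::real_vector) \<Rightarrow> nat \<Rightarrow> 'v" where
  "bdiff \<tau> u n = (u n - u (n - 1)) /\<^sub>R \<tau>"

definition bdiff2 :: "real \<Rightarrow> (nat \<Rightarrow> 'v::real_vector) \<Rightarrow> nat \<Rightarrow> 'v" where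
  "bdiff2 \<tau> u n = (u n - 2 *\<^sub>R u (n - 1) + u (n - 2)) /\<^sub>R \<tau>\<^sup>2"

definition fdiff2 :: "real \<Rightarrow> (nat \<Rightarrow> 'v::real_vector) \<Rightarrow> nat \<Rightarrow> 'v" where
  "fdiff2 \<tau> u n = (u n - 2 *\<^sub>R u (n + 1) + u (n + 2)) /\<^sub>R \<tau>\<^sup>2"

definition wsum :: "real \<Rightarrow> (nat \<Rightarrow> 'v::real_vector) \<Rightarrow> nat \<Rightarrow> 'v" where
  "wsum \<tau> z n = \<tau> *\<^sub>R (\<Sum>m=0..n. (1 + real m * \<tau>) *\<^sub>R z m)"

definition wsum_bwd :: "real \<Rightarrow> nat \<Rightarrow> (nat \<Rightarrow> 'v::real_vector) \<Rightarrow> nat \<Rightarrow> 'v" where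
  "wsum_bwd \<tau> N Z n = \<tau> *\<^sub>R (\<Sum>m=n..N. (1 + (real N - real m) * \<tau>) *\<^sub>R Z m)"

lemma bdiff_Suc: "\<tau> \<noteq> 0 \<Longrightarrow> \<tau> *\<^sub>R bdiff \<tau> u (Suc n) = u (Suc n) - u n"
  by (simp add: bdiff_def)

lemma bdiff2_eq: "\<tau> \<noteq> 0 \<Longrightarrow> bdiff2 \<tau> u n = (bdiff \<tau> u n - bdiff \<tau> u (n - 1)) /\<^sub>R \<tau>"
proof -
  have "n - 1 - 1 = n - 2" by simp
  then show ?thesis if "\<tau> \<noteq> 0"
    using that unfolding bdiff2_def bdiff_def
    by (simp add: power2_eq_square scaleR_2 del: One_nat_def diff_diff_left flip: scaleR_diff_right)
qed

lemma fdiff2_eq: "fdiff2 \<tau> u n = bdiff2 \<tau> u (n + 2)"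
  by (simp add: fdiff2_def bdiff2_def algebra_simps)

lemma wsum_bwd_eq:
  assumes "n \<le> N"
  shows "wsum_bwd \<tau> N Z n = wsum \<tau> (\<lambda>m. Z (N - m)) (N - n)"
proof -
  have "(\<Sum>m=n..N. (1 + (real N - real m) * \<tau>) *\<^sub>R Z m) = (\<Sum>m=0..N-n. (1 + real m * \<tau>) *\<^sub>R Z (N - m))"
    by (rule sum.reindex_bij_witness[of _ "\<lambda>m. N - m" "\<lambda>m. N - m"]) (use assms in \<open>auto simp: of_nat_diff\<close>)
  then show ?thesis by (simp add: wsum_bwd_def wsum_def)
qed

text \<open>Summation by parts.  A decreasing weight \<open>g\<close> turns a sum of increments into a sum of the values themselves, which
is how the estimates for \<open>z\<close> and \<open>u\<close> below arise.\<close>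

lemma weighted_telescope:
  fixes b g :: "nat \<Rightarrow> real"
  assumes "1 \<le> N"
  shows "(\<Sum>n=2..N. g n * (b n - b (n - 1))) = g (N + 1) * b N - g 2 * b 1 + (\<Sum>n=2..N. (g n - g (n + 1)) * b n)"
  using assms
proof (induction N rule: nat_induct_at_least)
  case base
  then show ?case by (simp add: numeral_2_eq_2)
next
  case (Suc N)
  have *: "(\<Sum>n=2..Suc N. f n) = (\<Sum>n=2..N. f n) + f (Suc N)" for f :: "nat \<Rightarrow> real"
    using Suc.hyps by simp
  show ?case unfolding * Suc.IH by (simp add: left_diff_distrib right_diff_distrib)
qed

lemma sum_reverse: "(\<Sum>n=0..<N - 1. f n) = (\<Sum>n=2..N. f (N - n))" for f :: "nat \<Rightarrow> 'b::comm_monoid_add"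
  by (rule sum.reindex_bij_witness[of _ "\<lambda>m. N - m" "\<lambda>m. N - m"]) auto

lemma sum_shift2: "(\<Sum>n=0..<N - 1. f (n + 2)) = (\<Sum>n=2..N. f n)" for f :: "nat \<Rightarrow> 'b::comm_monoid_add"
  by (rule sum.reindex_bij_witness[of _ "\<lambda>m. m - 2" "\<lambda>m. m + 2"]) auto

section \<open>Multiplier estimates for the discrete wave equation\<close>

text \<open>The forms \<open>p\<close>, \<open>a\<close> and \<open>c\<close> stand for the inner product of \<open>L^2\<close>, the Dirichlet form and the pairing with weight
\<open>\<chi>\<close>.  One constant \<open>K\<close> bounds all data, so that the final constants are explicit functions of \<open>K\<close> alone and hence
independent of the mesh.\<close>

locale discrete_wave = p: semi_inner p + a: semi_inner a
  for p a :: "'v::real_vector \<Rightarrow> 'v \<Rightarrow> real" +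
  fixes c :: "'v \<Rightarrow> 'v \<Rightarrow> real" and h \<tau> T K :: real and N :: nat
  assumes c_bil: "bilinear c"
    and c_bound: "c x y \<le> K * (p x x + p y y) / 2"
    and poincare: "p x x \<le> K * a x x"
    and inverse_ineq: "h\<^sup>2 * a x x \<le> K * p x x"
    and K: "1 \<le> K" "T \<le> K" and T: "0 < T"
    and h: "0 < h" "h \<le> 1" and \<tau>: "\<tau> = T / real N" "\<tau> \<le> K * h" and N: "2 \<le> N"
begin

lemma tau_pos: "0 < \<tau>" and tau_N: "real N * \<tau> = T"
  using \<tau> T N by auto

lemma tau_le: "real n * \<tau> \<le> T" if "n \<le> N" for n
  using that tau_N tau_pos by (metis mult_right_mono of_nat_le_iff less_imp_le)

lemmas c_expand = bilinear_ladd[OF c_bil] bilinear_radd[OF c_bil] bilinear_lmul[OF c_bil] bilinear_rmul[OF c_bil]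

definition "G u z = \<tau> * (\<Sum>n=2..N. p (bdiff2 \<tau> u n) (z n) + a (u n) (z n))"
definition "Gs Z U = \<tau> * (\<Sum>n=0..<N - 1. p (Z n) (fdiff2 \<tau> U n) + a (Z n) (U n))"
definition "coupling V z = \<tau> * (\<Sum>n=2..N. c (V n) (z n))"

text \<open>\<open>R_u\<close> and \<open>R_U\<close> are the polarisations of the parts of \<open>R(u,U)\<close> that depend on \<open>u\<close> and on \<open>U\<close>; their sum is the
stabilisation in \<open>A\<close>.\<close>

definition "R_u u v = a (u 0) (v 0) + a (u N) (v N)
     + p (bdiff \<tau> u 1) (bdiff \<tau> v 1) + p (bdiff \<tau> u N) (bdiff \<tau> v N)"

definition "R_U U V = h\<^sup>2 * a (U N) (V N) + h\<^sup>2 * a (bdiff \<tau> U N) (bdiff \<tau> V N)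
     + h\<^sup>2 * a (bdiff \<tau> U 1) (bdiff \<tau> V 1) + \<tau> * (\<Sum>n=1..N. h\<^sup>2 * a (bdiff \<tau> U n) (bdiff \<tau> V n))"

definition "F_sq u = h\<^sup>2 * (\<tau> * (\<Sum>n=1..N. p.sq (bdiff \<tau> u n) + a.sq (u n)))"
definition "F'_sq U = h\<^sup>2 * (\<tau> * (\<Sum>n=2..N. p.sq (bdiff2 \<tau> U n) + a.sq (bdiff \<tau> U n)
     + p.sq (bdiff \<tau> U n) + a.sq (U n)) + p.sq (bdiff \<tau> U 1) + a.sq (U 1))"
definition "D_sq z = \<tau> * (\<Sum>n=2..N. p.sq (z n)) + \<tau> * (\<Sum>n=2..N. a.sq (wsum \<tau> z n))
     + a.sq (wsum \<tau> z N) + p.sq (z N)"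
definition "D'_sq Z = \<tau> * (\<Sum>n=0..<N - 1. p.sq (Z n))
     + \<tau> * (\<Sum>n=0..<N - 1. a.sq (wsum_bwd \<tau> N Z n))
     + a.sq (wsum_bwd \<tau> N Z 0) + p.sq (Z 0)"

text \<open>With \<open>Gs_eq\<close> below, this reduces every estimate for \<open>Z\<close> to the corresponding one for \<open>z\<close>.\<close>

lemma D'_sq_eq: "D'_sq Z = D_sq (\<lambda>n. Z (N - n))"
proof -
  have "wsum_bwd \<tau> N Z (N - n) = wsum \<tau> (\<lambda>m. Z (N - m)) n" if "n \<le> N" for n
    using wsum_bwd_eq[of "N - n" N \<tau> Z] that by simp
  then show ?thesis
    using wsum_bwd_eq[of 0 N \<tau> Z] N by (simp add: D'_sq_def D_sq_def sum_reverse del: One_nat_def)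
qed

lemma Gs_eq: "Gs Z V = G (\<lambda>n. V (N - n)) (\<lambda>n. Z (N - n))"
proof -
  have "fdiff2 \<tau> V (N - n) = bdiff2 \<tau> (\<lambda>n. V (N - n)) n" if "2 \<le> n" "n \<le> N" for n
  proof -
    have "N - n + 1 = N - (n - 1)" "N - n + 2 = N - (n - 2)" using that by auto
    then show ?thesis by (simp add: fdiff2_def bdiff2_def)
  qed
  then show ?thesis
    by (simp add: Gs_def G_def sum_reverse p.commute a.commute del: One_nat_def)
qed

lemma wsum_01: 
  assumes "z 0 = 0" "z 1 = 0" 
  shows "wsum \<tau> z 0 = 0" "wsum \<tau> z 1 = 0"
  using assms by (simp_all add: wsum_def)

lemma wsum_bdiff: "1 \<le> n \<Longrightarrow> bdiff \<tau> (wsum \<tau> z) n = (1 + real n * \<tau>) *\<^sub>R z n"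
  using tau_pos by (cases n) (simp_all add: wsum_def bdiff_def scaleR_add_right)

text \<open>Write \<open>v = I z\<close>.  Then \<open>\<tau> \<partial>\<^sub>\<tau>\<^sup>2 v\<^sup>n = (1 + n \<tau>) z\<^sup>n - (1 + (n-1) \<tau>) z\<^sup>n\<^sup>-\<^sup>1\<close>, whose product with \<open>z\<^sup>n\<close> exceeds half the increment of
\<open>(1 + n \<tau>) \<parallel>z\<^sup>n\<parallel>\<^sup>2\<close> by at least \<open>\<tau>/2 \<parallel>z\<^sup>n\<parallel>\<^sup>2\<close>.  In the Dirichlet part, \<open>z\<^sup>n = (v\<^sup>n - v\<^sup>n\<^sup>-\<^sup>1) / (\<tau> (1 + n \<tau>))\<close> is a difference
of \<open>v\<close> with the decreasing weight \<open>1 / (1 + n \<tau>)\<close>, so summation by parts yields the sum of \<open>\<parallel>\<nabla>v\<^sup>n\<parallel>\<^sup>2\<close>.\<close>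

lemma G_wsum_ge:
  assumes z: "z 0 = 0" "z 1 = 0"
  shows "D_sq z / (2 * (1 + 2 * K)\<^sup>2) \<le> G (wsum \<tau> z) z"
proof -
  define v where "v = wsum \<tau> z"
  have v1: "v 1 = 0" using wsum_01[OF z] by (simp add: v_def)
  define g where "g n = 1 / (1 + real n * \<tau>)" for n :: nat
  have g_pos: "0 < 1 + real n * \<tau>" for n using tau_pos by (simp add: add_pos_nonneg)
  have tT: "\<tau> \<le> T" using tau_le[of 1] N by simp
  have g_ge: "1 / (1 + 2 * K) \<le> g n" if "n \<le> N + 1" for n
  proof -
    have "real n * \<tau> \<le> real (N + 1) * \<tau>" using that tau_pos by (intro mult_right_mono) auto
    also have "\<dots> \<le> 2 * K" using tau_N tT K by (simp add: algebra_simps)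
    finally show ?thesis unfolding g_def using g_pos K by (intro divide_left_mono) auto
  qed
  have g_diff: "g n - g (n + 1) = \<tau> * (g n * g (n + 1))" for n
    using g_pos[of n] g_pos[of "n+1"] by (simp add: g_def field_simps)
  let ?k = "1 / (2 * (1 + 2 * K)\<^sup>2)"
  have k: "?k \<le> 1/2" "0 < ?k" using K by (auto simp: field_simps) 
  have step: "((1 + real n * \<tau>) * p.sq (z n) - (1 + real (n-1) * \<tau>) * p.sq (z (n-1))) / 2
       + \<tau> / 2 * p.sq (z n) \<le> \<tau> * p (bdiff2 \<tau> v n) (z n)" if n: "n \<in> {2..N}" for n
  proof -
    define r where "r = 1 + real (n-1) * \<tau>"
    have rn: "1 + real n * \<tau> = r + \<tau>" using n by (simp add: r_def algebra_simps)
    have w: "bdiff \<tau> v (n - 1) = r *\<^sub>R z (n - 1)"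
      unfolding v_def r_def by (rule wsum_bdiff) (use n in auto)
    have "\<tau> * p (bdiff2 \<tau> v n) (z n) = (r + \<tau>) * p.sq (z n) - r * p (z (n-1)) (z n)"
    proof -
      have "\<tau> *\<^sub>R bdiff2 \<tau> v n = (r + \<tau>) *\<^sub>R z n - r *\<^sub>R z (n-1)"
        using n tau_pos wsum_bdiff[of n z] w by (simp add: bdiff2_eq v_def rn)
      then have "p (\<tau> *\<^sub>R bdiff2 \<tau> v n) (z n) = p ((r + \<tau>) *\<^sub>R z n - r *\<^sub>R z (n-1)) (z n)" by simp
      then show ?thesis by (simp only: p.expand real_scaleR_def)
    qed
    moreover have "r * p (z (n-1)) (z n) \<le> r * ((p.sq (z (n-1)) + p.sq (z n)) / 2)"
      using p.young[of 1 "z (n-1)" "z n"] g_pos[of "n-1"] by (intro mult_left_mono) (auto simp: r_def)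
    moreover have "(r + \<tau>) * p.sq (z n) = r * p.sq (z n) + \<tau> * p.sq (z n)"
      "r * ((p.sq (z (n-1)) + p.sq (z n)) / 2) = r * p.sq (z (n-1)) / 2 + r * p.sq (z n) / 2"
      by (simp_all add: distrib_right distrib_left add_divide_distrib)
    moreover have "((r + \<tau>) * p.sq (z n) - r * p.sq (z (n-1))) / 2 + \<tau> / 2 * p.sq (z n)
      = r * p.sq (z n) / 2 + \<tau> * p.sq (z n) - r * p.sq (z (n-1)) / 2"
      by (simp add: field_simps)
    ultimately show ?thesis unfolding rn r_def[symmetric] by linarith
  qed
  have "(1 + T) / 2 * p.sq (z N) + 1/2 * (\<tau> * (\<Sum>n=2..N. p.sq (z n)))
     = (\<Sum>n=2..N. ((1 + real n * \<tau>) * p.sq (z n) - (1 + real (n-1) * \<tau>) * p.sq (z (n-1))) / 2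
       + \<tau> / 2 * p.sq (z n))"
    using weighted_telescope[of N "\<lambda>_. 1/2" "\<lambda>n. (1 + real n * \<tau>) * p.sq (z n)"] N z tau_N
    by (simp add: sum.distrib sum_distrib_left p.expand)
  also have "\<dots> \<le> (\<Sum>n=2..N. \<tau> * p (bdiff2 \<tau> v n) (z n))"
    by (rule sum_mono) (rule step)
  also have "\<dots> = \<tau> * (\<Sum>n=2..N. p (bdiff2 \<tau> v n) (z n))"
    by (simp add: sum_distrib_left)
  finally have "(1 + T) / 2 * p.sq (z N) + 1/2 * (\<tau> * (\<Sum>n=2..N. p.sq (z n)))
     \<le> \<tau> * (\<Sum>n=2..N. p (bdiff2 \<tau> v n) (z n))" .
  moreover have "?k * p.sq (z N) \<le> (1 + T) / 2 * p.sq (z N)"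
    using order_trans[OF k(1), of "(1 + T) / 2"] T by (intro mult_right_mono p.nonneg) simp
  moreover have "?k * (\<tau> * (\<Sum>n=2..N. p.sq (z n))) \<le> 1/2 * (\<tau> * (\<Sum>n=2..N. p.sq (z n)))"
    using k tau_pos p.nonneg by (intro mult_right_mono mult_nonneg_nonneg sum_nonneg) auto
  ultimately have P': "?k * p.sq (z N) + ?k * (\<tau> * (\<Sum>n=2..N. p.sq (z n))) \<le> \<tau> * (\<Sum>n=2..N. p (bdiff2 \<tau> v n) (z n))"
    by linarith
  have "(\<Sum>n=2..N. g n / 2 * (a.sq (v n) - a.sq (v (n-1)))) \<le> (\<Sum>n=2..N. \<tau> * a (v n) (z n))"
  proof (rule sum_mono)
    fix n assume n: "n \<in> {2..N}"
    have "v n - v (n - 1) = \<tau> *\<^sub>R bdiff \<tau> v n" using tau_pos by (simp add: bdiff_def)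
    also have "\<dots> = (\<tau> * (1 + real n * \<tau>)) *\<^sub>R z n" using n by (simp add: v_def wsum_bdiff)
    finally have "g n *\<^sub>R (v n - v (n - 1)) = \<tau> *\<^sub>R z n" using g_pos[of n] by (simp add: g_def)
    then have "\<tau> * a (v n) (z n) = g n * a (v n - v (n - 1)) (v n)"
      using a.expand(3)[of "g n" "v n - v (n - 1)" "v n"] a.expand(3)[of \<tau> "z n" "v n"]
      by (simp only: a.commute[of "v n" "z n"] real_scaleR_def)
    moreover have "g n * ((a.sq (v n) - a.sq (v (n-1))) / 2) \<le> g n * a (v n - v (n-1)) (v n)"
      using a.backward_difference_test[of "v n" "v (n-1)"] g_pos[of n] by (intro mult_left_mono) (auto simp: g_def)
    ultimately show "g n / 2 * (a.sq (v n) - a.sq (v (n-1))) \<le> \<tau> * a (v n) (z n)" by simp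
  qed
  moreover have "(\<Sum>n=2..N. g n / 2 * (a.sq (v n) - a.sq (v (n-1))))
     = g (N+1) / 2 * a.sq (v N) + (\<Sum>n=2..N. \<tau> * (g n * g (n + 1)) / 2 * a.sq (v n))"
    using weighted_telescope[of N "\<lambda>n. g n / 2" "\<lambda>n. a.sq (v n)"] N v1 g_diff
    by (simp add: a.expand diff_divide_distrib[symmetric])
  moreover have "?k * a.sq (v N) \<le> g (N+1) / 2 * a.sq (v N)"
  proof (rule mult_right_mono[OF _ a.nonneg])
    have "1 + 2 * K \<le> (1 + 2 * K)\<^sup>2" using self_le_power[of "1 + 2 * K" 2] K by simp
    then have "1 / (2 * (1 + 2 * K)\<^sup>2) \<le> 1 / (2 * (1 + 2 * K))" using K by (intro divide_left_mono) auto
    then have *: "?k \<le> 1 / (1 + 2*K) / 2" by simp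
    show "?k \<le> g (N+1) / 2"
      by (rule order_trans[OF *]) (rule divide_right_mono[OF g_ge], simp_all)
  qed
  moreover have "(\<Sum>n=2..N. \<tau> * ?k * a.sq (v n)) \<le> (\<Sum>n=2..N. \<tau> * (g n * g (n + 1)) / 2 * a.sq (v n))"
  proof (intro sum_mono mult_right_mono a.nonneg)
    fix n assume n: "n \<in> {2..N}"
    have "1 / (1 + 2 * K) * (1 / (1 + 2 * K)) \<le> g n * g (n + 1)"
      using g_ge[of n] g_ge[of "n+1"] n K g_pos[of n] by (intro mult_mono) (auto simp: g_def)
    then have le: "\<tau> * (1 / (1 + 2 * K) * (1 / (1 + 2 * K))) \<le> \<tau> * (g n * g (n + 1))"
      using tau_pos by (intro mult_left_mono) auto
    have eq: "\<tau> * ?k = \<tau> * (1 / (1 + 2 * K) * (1 / (1 + 2 * K))) / 2" by (simp add: power2_eq_square)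
    show "\<tau> * ?k \<le> \<tau> * (g n * g (n + 1)) / 2" unfolding eq by (rule divide_right_mono[OF le]) simp
  qed
  ultimately have "?k * a.sq (v N) + ?k * (\<tau> * (\<Sum>n=2..N. a.sq (v n))) \<le> \<tau> * (\<Sum>n=2..N. a (v n) (z n))"
    by (simp add: sum_distrib_left mult.assoc mult.left_commute)
  with P' show ?thesis
    by (simp add: G_def D_sq_def v_def sum.distrib algebra_simps add_divide_distrib)
qed

lemma Gs_wsum_bwd_ge:
  assumes "Z N = 0" "Z (N - 1) = 0"
  shows "D'_sq Z / (2 * (1 + 2 * K)\<^sup>2) \<le> Gs Z (wsum_bwd \<tau> N Z)"
proof -
  have *: "bdiff2 \<tau> (\<lambda>n. wsum_bwd \<tau> N Z (N - n)) n = bdiff2 \<tau> (wsum \<tau> (\<lambda>n. Z (N - n))) n"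
     "wsum_bwd \<tau> N Z (N - n) = wsum \<tau> (\<lambda>n. Z (N - n)) n" if "n \<in> {2..N}" for n
    using that by (auto simp: bdiff2_def wsum_bwd_eq)
  have "Gs Z (wsum_bwd \<tau> N Z) = G (wsum \<tau> (\<lambda>n. Z (N - n))) (\<lambda>n. Z (N - n))"
    unfolding Gs_eq G_def by (intro arg_cong[where f="\<lambda>s. \<tau> * s"] sum.cong refl) (simp add: *)
  then show ?thesis
    using G_wsum_ge[of "\<lambda>n. Z (N - n)"] assms D'_sq_eq by simp
qed

definition "A_bilinear u U z Z v V w W = G v z + Gs Z V - coupling V z + R_u u v + R_U U V + G u w - coupling U w + Gs W U"

lemma bdiff_lincomb: "bdiff \<tau> (\<lambda>n. u n + r *\<^sub>R v n) n = bdiff \<tau> u n + r *\<^sub>R bdiff \<tau> v n"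
  by (simp add: bdiff_def algebra_simps)

lemma G_left: "G (\<lambda>n. u n + r *\<^sub>R v n) z = G u z + r * G v z"
proof -
  have "bdiff2 \<tau> (\<lambda>n. u n + r *\<^sub>R v n) n = bdiff2 \<tau> u n + r *\<^sub>R bdiff2 \<tau> v n" for n
    by (simp add: bdiff2_def algebra_simps)
  then show ?thesis
    by (simp add: G_def p.expand a.expand sum.distrib sum_distrib_left algebra_simps)
qed

lemma G_right: "G u (\<lambda>n. - z n + r *\<^sub>R w n) = - G u z + r * G u w"
  by (simp add: G_def p.expand a.expand sum.distrib sum_distrib_left sum_subtractf sum_negf algebra_simps)

lemma Gs_right: "Gs Z (\<lambda>n. U n + r *\<^sub>R V n) = Gs Z U + r * Gs Z V"
  by (simp add: Gs_eq G_left)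

lemma Gs_left: "Gs (\<lambda>n. - Z n + r *\<^sub>R W n) U = - Gs Z U + r * Gs W U"
  by (simp only: Gs_eq G_right)

lemma coupling_left: "coupling (\<lambda>n. U n + r *\<^sub>R V n) z = coupling U z + r * coupling V z"
  by (simp add: coupling_def c_expand sum.distrib sum_distrib_left algebra_simps)

lemma coupling_right: "coupling U (\<lambda>n. - z n + r *\<^sub>R w n) = - coupling U z + r * coupling U w"
  by (simp add: coupling_def c_expand bilinear_rneg[OF c_bil] bilinear_rsub[OF c_bil] sum.distrib sum_distrib_left sum_subtractf sum_negf algebra_simps)

lemma R_u_nonneg: "0 \<le> R_u u u"
  unfolding R_u_def using p.nonneg a.nonneg by (intro add_nonneg_nonneg) auto

lemma R_U_nonneg: "0 \<le> R_U U U"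
  unfolding R_U_def using tau_pos a.nonneg by (intro add_nonneg_nonneg mult_nonneg_nonneg sum_nonneg) auto

lemma R_u_lincomb: "R_u u (\<lambda>n. v n + r *\<^sub>R w n) = R_u u v + r * R_u u w"
  by (simp add: R_u_def bdiff_lincomb p.expand a.expand distrib_left)

lemma R_U_lincomb: "R_U U (\<lambda>n. V n + r *\<^sub>R W n) = R_U U V + r * R_U U W"
proof -
  have "(\<Sum>n=1..N. h\<^sup>2 * (x n + r * y n)) = (\<Sum>n=1..N. h\<^sup>2 * x n) + r * (\<Sum>n=1..N. h\<^sup>2 * y n)" for x y :: "nat \<Rightarrow> real"
    by (simp add: distrib_left sum.distrib sum_distrib_left mult.left_commute)
  then show ?thesis
    unfolding R_U_def bdiff_lincomb a.expand real_scaleR_def by (simp add: distrib_left mult.left_commute)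
qed

lemma R_u_commute: "R_u u v = R_u v u"
  by (simp add: R_u_def p.commute a.commute)

lemma R_U_commute: "R_U u v = R_U v u"
  by (simp add: R_U_def a.commute)

text \<open>Both inequalities say that a form nonnegative on the diagonal satisfies Young's inequality; they are stated for
sequences because \<open>R_u\<close> and \<open>R_U\<close> act on those.\<close>

lemma young_from_nonneg:
  fixes s :: "(nat \<Rightarrow> 'v) \<Rightarrow> (nat \<Rightarrow> 'v) \<Rightarrow> real"
  assumes lin: "\<And>u v w r. s u (\<lambda>n. v n + r *\<^sub>R w n) = s u v + r * s u w"
    and comm: "\<And>u v. s u v = s v u" and nonneg: "\<And>u. 0 \<le> s u u"
  shows "s u u / 2 - r\<^sup>2 * s v v / 2 \<le> s u (\<lambda>n. u n + r *\<^sub>R v n)"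
    and "s (\<lambda>n. u n + r *\<^sub>R v n) (\<lambda>n. u n + r *\<^sub>R v n) \<le> 2 * s u u + 2 * (r\<^sup>2 * s v v)"
proof -
  have sq: "s (\<lambda>n. u n + r *\<^sub>R v n) (\<lambda>n. u n + r *\<^sub>R v n) = s u u + 2 * (r * s u v) + r\<^sup>2 * s v v" for r
  proof -
    have "s (\<lambda>n. u n + r *\<^sub>R v n) (\<lambda>n. u n + r *\<^sub>R v n) = s (\<lambda>n. u n + r *\<^sub>R v n) u + r * s (\<lambda>n. u n + r *\<^sub>R v n) v"
      by (rule lin)
    also have "\<dots> = s u u + r * s u v + r * (s v u + r * s v v)"
      by (simp only: comm[of "\<lambda>n. u n + r *\<^sub>R v n"] lin)
    also have "\<dots> = s u u + 2 * (r * s u v) + r\<^sup>2 * s v v"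
      by (simp add: comm[of v u] algebra_simps power2_eq_square)
    finally show ?thesis .
  qed
  show "s u u / 2 - r\<^sup>2 * s v v / 2 \<le> s u (\<lambda>n. u n + r *\<^sub>R v n)"
    using nonneg[of "\<lambda>n. u n + r *\<^sub>R v n"] unfolding sq lin by linarith
  show "s (\<lambda>n. u n + r *\<^sub>R v n) (\<lambda>n. u n + r *\<^sub>R v n) \<le> 2 * s u u + 2 * (r\<^sup>2 * s v v)"
    using nonneg[of "\<lambda>n. u n + (-r) *\<^sub>R v n"] unfolding sq[of "-r"] sq[of r] by (simp add: algebra_simps)
qed

lemma R_u_young:
  "R_u u u / 2 - r\<^sup>2 * R_u v v / 2 \<le> R_u u (\<lambda>n. u n + r *\<^sub>R v n)"
  "R_u (\<lambda>n. u n + r *\<^sub>R v n) (\<lambda>n. u n + r *\<^sub>R v n) \<le> 2 * R_u u u + 2 * (r\<^sup>2 * R_u v v)"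
  by (rule young_from_nonneg[OF R_u_lincomb R_u_commute R_u_nonneg])+

lemma R_U_young:
  "R_U u u / 2 - r\<^sup>2 * R_U v v / 2 \<le> R_U u (\<lambda>n. u n + r *\<^sub>R v n)"
  "R_U (\<lambda>n. u n + r *\<^sub>R v n) (\<lambda>n. u n + r *\<^sub>R v n) \<le> 2 * R_U u u + 2 * (r\<^sup>2 * R_U v v)"
  by (rule young_from_nonneg[OF R_U_lincomb R_U_commute R_U_nonneg])+

lemma R_u_wsum_le:
  assumes z: "z 0 = 0" "z 1 = 0"
  shows "R_u (wsum \<tau> z) (wsum \<tau> z) \<le> (1 + K)\<^sup>2 * D_sq z"
proof -
  have "R_u (wsum \<tau> z) (wsum \<tau> z) =
     a.sq (wsum \<tau> z N) + (1 + T)\<^sup>2 * p.sq (z N)"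
    using wsum_01[OF z] z N wsum_bdiff[of 1 z] wsum_bdiff[of N z] tau_N
    by (simp add: R_u_def p.expand a.expand power2_eq_square)
  also have "\<dots> \<le> (1 + K)\<^sup>2 * a.sq (wsum \<tau> z N) + (1 + K)\<^sup>2 * p.sq (z N)"
  proof (rule add_mono)
    have "1 * a.sq (wsum \<tau> z N) \<le> (1 + K)\<^sup>2 * a.sq (wsum \<tau> z N)"
      using K a.nonneg by (intro mult_right_mono) (auto simp: one_le_power)
    then show "a.sq (wsum \<tau> z N) \<le> (1 + K)\<^sup>2 * a.sq (wsum \<tau> z N)" by simp
    show "(1 + T)\<^sup>2 * p.sq (z N) \<le> (1 + K)\<^sup>2 * p.sq (z N)"
      using K T p.nonneg by (intro mult_right_mono power_mono) auto
  qed
  also have "\<dots> = (1 + K)\<^sup>2 * (a.sq (wsum \<tau> z N) + p.sq (z N))" by (simp add: distrib_left)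
  also have "\<dots> \<le> (1 + K)\<^sup>2 * D_sq z"
  proof (rule mult_left_mono)
    have "0 \<le> \<tau> * (\<Sum>n=2..N. p.sq (z n))" "0 \<le> \<tau> * (\<Sum>n=2..N. a.sq (wsum \<tau> z n))"
      using tau_pos p.nonneg a.nonneg by (auto intro!: mult_nonneg_nonneg sum_nonneg)
    then show "a.sq (wsum \<tau> z N) + p.sq (z N) \<le> D_sq z" by (simp add: D_sq_def)
  qed simp
  finally show ?thesis .
qed

text \<open>The time differences of the backward sum are multiples of \<open>Z\<close>, whose gradients are reduced to \<open>Z\<close> by the inverse
inequality.  The backward sum vanishes at the last two times, which removes the terms at the final time.\<close>

lemma R_U_wsum_bwd_le:
  assumes Z: "Z N = 0" "Z (N - 1) = 0"
  shows "R_U (wsum_bwd \<tau> N Z) (wsum_bwd \<tau> N Z) \<le> K * (1 + K)\<^sup>2 * D'_sq Z"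
proof -
  define V where "V = wsum_bwd \<tau> N Z"
  have "V N = 0" "V (N - 1) = 0"
    using wsum_01[of "\<lambda>n. Z (N - n)"] Z N wsum_bwd_eq[of N N \<tau> Z] wsum_bwd_eq[of "N-1" N \<tau> Z]
    by (auto simp: V_def simp del: One_nat_def)
  then have VN: "V N = 0" "bdiff \<tau> V N = 0" by (simp_all add: bdiff_def)
  have dV: "h\<^sup>2 * a.sq (bdiff \<tau> V n) \<le> K * (1 + K)\<^sup>2 * p.sq (Z (n - 1))" if n: "n \<in> {1..N}" for n
  proof -
    let ?r = "1 + (real N - real (n - 1)) * \<tau>"
    have *: "(\<Sum>m=n-1..N. f m) = f (n - 1) + (\<Sum>m=n..N. f m)" for f :: "nat \<Rightarrow> 'v"
      using n sum.atLeast_Suc_atMost[of "n - 1" N f] by (auto simp: Suc_diff_le le_diff_conv)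
    have "V (n - 1) = V n + (\<tau> * ?r) *\<^sub>R Z (n - 1)"
      unfolding V_def wsum_bwd_def * by (simp add: scaleR_add_right)
    then have "V n - V (n - 1) = - (\<tau> *\<^sub>R (?r *\<^sub>R Z (n - 1)))" by simp
    then have "bdiff \<tau> V n = - (?r *\<^sub>R Z (n - 1))"
      unfolding bdiff_def using tau_pos by simp
    then have "bdiff \<tau> V n = (- ?r) *\<^sub>R Z (n - 1)" by (simp only: scaleR_minus_left)
    then have "a.sq (bdiff \<tau> V n) = ?r\<^sup>2 * a.sq (Z (n - 1))"
      by (simp only: a.expand real_scaleR_def power2_eq_square mult.assoc minus_mult_minus mult_minus_left mult_minus_right minus_minus)
    then have "h\<^sup>2 * a.sq (bdiff \<tau> V n) = ?r\<^sup>2 * (h\<^sup>2 * a.sq (Z (n - 1)))" by simp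
    also have "\<dots> \<le> (1 + K)\<^sup>2 * (K * p.sq (Z (n - 1)))"
    proof (rule mult_mono[OF power_mono inverse_ineq])
      have e: "real N - real (n - 1) = real (N - (n - 1))" using n by (intro of_nat_diff[symmetric]) auto
      have "(real N - real (n - 1)) * \<tau> \<le> T" "0 \<le> (real N - real (n - 1)) * \<tau>"
        unfolding e using tau_le[of "N - (n - 1)"] tau_pos by auto
      then show "?r \<le> 1 + K" "0 \<le> ?r" using K by auto
    qed (use a.nonneg in auto)
    finally show ?thesis by (simp add: ac_simps)
  qed
  let ?k = "K * (1 + K)\<^sup>2"
  have k: "0 \<le> ?k" using K by simp
  have "R_U V V = h\<^sup>2 * a.sq (bdiff \<tau> V 1) + \<tau> * (\<Sum>n=1..N. h\<^sup>2 * a.sq (bdiff \<tau> V n))"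
    using VN by (simp add: R_U_def a.expand)
  also have "\<dots> \<le> ?k * p.sq (Z (1 - 1)) + \<tau> * (\<Sum>n=1..N. ?k * p.sq (Z (n - 1)))"
    using tau_pos N by (intro add_mono mult_left_mono sum_mono dV) auto
  also have "\<dots> = ?k * (p.sq (Z 0) + \<tau> * (\<Sum>n=1..N. p.sq (Z (n - 1))))"
    by (simp add: sum_distrib_left algebra_simps)
  also have "(\<Sum>n=1..N. p.sq (Z (n - 1))) = (\<Sum>n=0..<N. p.sq (Z n))"
    by (rule sum.reindex_bij_witness[of _ Suc "\<lambda>n. n - 1"]) auto
  also have "\<dots> = (\<Sum>n=0..<N - 1. p.sq (Z n))"
  proof -
    have "{0..<N} = insert (N - 1) {0..<N - 1}" using N by auto
    then show ?thesis using Z by (simp add: p.expand)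
  qed
  also have "?k * (p.sq (Z 0) + \<tau> * (\<Sum>n=0..<N - 1. p.sq (Z n))) \<le> ?k * D'_sq Z"
  proof (rule mult_left_mono[OF _ k])
    have "0 \<le> \<tau> * (\<Sum>n=0..<N - 1. a.sq (wsum_bwd \<tau> N Z n))"
      using tau_pos a.nonneg by (auto intro!: mult_nonneg_nonneg sum_nonneg)
    then show "p.sq (Z 0) + \<tau> * (\<Sum>n=0..<N - 1. p.sq (Z n)) \<le> D'_sq Z"
      using a.nonneg by (simp add: D'_sq_def)
  qed
  finally show ?thesis by (simp add: V_def)
qed

text \<open>Replacing the first argument by its multiple \<open>\<delta> x\<close> introduces the free parameter of Young's inequality.\<close>

lemma coupling_le:
  assumes "\<delta> > 0"
  shows "coupling V z \<le> K / 2 * (\<delta> * (\<tau> * (\<Sum>n=2..N. p.sq (V n))) + \<tau> * (\<Sum>n=2..N. p.sq (z n)) / \<delta>)"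
proof -
  have "c x y \<le> K / 2 * (\<delta> * p.sq x) + K / 2 * (p.sq y / \<delta>)" for x y
  proof -
    have "c (\<delta> *\<^sub>R x) y \<le> K * (p.sq (\<delta> *\<^sub>R x) + p.sq y) / 2" by (rule c_bound)
    then have "\<delta> * c x y \<le> \<delta> * (K / 2 * (\<delta> * p.sq x) + K / 2 * (p.sq y / \<delta>))"
      using assms by (simp add: c_expand p.expand algebra_simps)
    then show ?thesis using assms by simp
  qed
  then have "(\<Sum>n=2..N. c (V n) (z n)) \<le> (\<Sum>n=2..N. K / 2 * (\<delta> * p.sq (V n)) + K / 2 * (p.sq (z n) / \<delta>))"
    by (intro sum_mono) auto
  then have "coupling V z \<le> \<tau> * (\<Sum>n=2..N. K / 2 * (\<delta> * p.sq (V n)) + K / 2 * (p.sq (z n) / \<delta>))"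
    unfolding coupling_def using tau_pos by (intro mult_left_mono) auto
  also have "\<dots> = K / 2 * (\<delta> * (\<tau> * (\<Sum>n=2..N. p.sq (V n))) + \<tau> * (\<Sum>n=2..N. p.sq (z n)) / \<delta>)"
    by (simp add: sum.distrib sum_distrib_left sum_divide_distrib algebra_simps)
  finally show ?thesis .
qed

text \<open>The values of the backward sum are bounded by their gradients (Poincare), and those are part of \<open>D'\<close>.\<close>

lemma coupling_wsum_bwd_le:
  assumes Z: "Z N = 0" "Z (N - 1) = 0" and "\<delta> > 0"
  shows "coupling (wsum_bwd \<tau> N Z) z \<le> K\<^sup>2 * (\<delta> * D'_sq Z + D_sq z / \<delta>)"
proof -
  let ?V = "wsum_bwd \<tau> N Z"
  have V: "?V N = 0" "?V (N - 1) = 0"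
    using wsum_01[of "\<lambda>n. Z (N - n)"] Z N wsum_bwd_eq[of N N \<tau> Z] wsum_bwd_eq[of "N-1" N \<tau> Z]
    by (auto simp del: One_nat_def)
  have "(\<Sum>n=2..N. p.sq (?V n)) \<le> (\<Sum>n=2..N. K * a.sq (?V n))"
    by (intro sum_mono poincare)
  also have "\<dots> \<le> (\<Sum>n=0..N. K * a.sq (?V n))"
    using K a.nonneg by (intro sum_mono2) auto
  also have "\<dots> = (\<Sum>n=0..<N-1. K * a.sq (?V n))"
  proof (rule sum.mono_neutral_right)
    have "i = N \<or> i = N - 1" if "i \<in> {0..N} - {0..<N - 1}" for i using that by auto
    then show "\<forall>i\<in>{0..N} - {0..<N - 1}. K * a.sq (?V i) = 0"
      using V by (metis a.expand(9) mult_zero_right)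
  qed auto
  finally have "\<tau> * (\<Sum>n=2..N. p.sq (?V n)) \<le> \<tau> * (K * (\<Sum>n=0..<N-1. a.sq (?V n)))"
    using tau_pos by (intro mult_left_mono) (auto simp: sum_distrib_left)
  also have "\<dots> = K * (\<tau> * (\<Sum>n=0..<N-1. a.sq (?V n)))" by simp
  also have "\<dots> \<le> K * D'_sq Z"
  proof -
    have "0 \<le> \<tau> * (\<Sum>n=0..<N - 1. p.sq (Z n))"
      using tau_pos p.nonneg by (auto intro!: mult_nonneg_nonneg sum_nonneg)
    then show ?thesis using K a.nonneg[of "?V 0"] p.nonneg[of "Z 0"] by (intro mult_left_mono) (auto simp: D'_sq_def)
  qed
  finally have 1: "\<tau> * (\<Sum>n=2..N. p.sq (?V n)) \<le> K * D'_sq Z" .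
  have 2: "\<tau> * (\<Sum>n=2..N. p.sq (z n)) \<le> D_sq z" "0 \<le> D_sq z"
  proof -
    have "0 \<le> \<tau> * (\<Sum>n=2..N. a.sq (wsum \<tau> z n))" "0 \<le> \<tau> * (\<Sum>n=2..N. p.sq (z n))"
      using tau_pos p.nonneg a.nonneg by (auto intro!: mult_nonneg_nonneg sum_nonneg)
    then show "\<tau> * (\<Sum>n=2..N. p.sq (z n)) \<le> D_sq z" "0 \<le> D_sq z" using a.nonneg p.nonneg by (auto simp: D_sq_def)
  qed
  have "coupling ?V z \<le> K / 2 * (\<delta> * (K * D'_sq Z) + D_sq z / \<delta>)"
    using coupling_le[OF \<open>\<delta> > 0\<close>, of ?V z] 1 2 K \<open>\<delta> > 0\<close>
    by (elim order_trans) (intro mult_left_mono add_mono divide_right_mono; simp)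
  also have "\<dots> = K * (\<delta> * (K * D'_sq Z)) / 2 + K * (D_sq z / \<delta>) / 2" by (simp add: algebra_simps)
  also have "\<dots> \<le> K\<^sup>2 * (\<delta> * D'_sq Z) + K\<^sup>2 * (D_sq z / \<delta>)"
  proof -
    have "0 \<le> K\<^sup>2 * (\<delta> * D'_sq Z)" 
      using \<open>\<delta> > 0\<close> tau_pos p.nonneg a.nonneg 
      by (intro mult_nonneg_nonneg) (auto simp: D'_sq_def intro!: add_nonneg_nonneg mult_nonneg_nonneg sum_nonneg)
    moreover have "K * (D_sq z / \<delta>) \<le> K\<^sup>2 * (D_sq z / \<delta>)"
      using 2 K \<open>\<delta> > 0\<close> by (intro mult_right_mono) (auto simp: power2_eq_square)
    moreover have "0 \<le> K * (D_sq z / \<delta>)" using 2 K \<open>\<delta> > 0\<close> by simp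
    moreover have *: "K * (\<delta> * (K * D'_sq Z)) = K\<^sup>2 * (\<delta> * D'_sq Z)" by (simp add: power2_eq_square)
    ultimately show ?thesis unfolding * by argo
  qed
  finally show ?thesis by (simp add: distrib_left)
qed

text \<open>The test sequences that recover \<open>F\<close> and the second differences in \<open>F'\<close>.  The weight \<open>2T - n \<tau>\<close> decreases by \<open>\<tau>\<close> per
step and stays nonnegative up to the index \<open>N + 1\<close> that summation by parts reaches.\<close>

definition "u_multiplier u n = (if n \<in> {2..N} then (h\<^sup>2 * (2 * T - real n * \<tau>)) *\<^sub>R bdiff \<tau> u n else 0)"
definition "U_multiplier U n = (if n < N - 1 then h\<^sup>2 *\<^sub>R fdiff2 \<tau> U n else 0)"
definition "diff2_sq U = h\<^sup>2 * (\<tau> * (\<Sum>n=2..N. p.sq (bdiff2 \<tau> U n)))"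

lemma K_power: "m \<le> n \<Longrightarrow> K ^ m \<le> K ^ n"
  using K by (rule_tac power_increasing) auto

lemma h2: "0 < h\<^sup>2" "h\<^sup>2 \<le> 1"
  using h by (auto simp: power_le_one)

lemma R_u_ge: "a.sq (u 0) \<le> R_u u u" "p.sq (bdiff \<tau> u 1) \<le> R_u u u"
  using p.nonneg a.nonneg by (auto simp: R_u_def intro!: add_increasing add_increasing2 add_nonneg_nonneg)

lemma R_U_ge: "h\<^sup>2 * a.sq (U N) \<le> R_U U U" "h\<^sup>2 * a.sq (bdiff \<tau> U N) \<le> R_U U U"
   "h\<^sup>2 * a.sq (bdiff \<tau> U 1) \<le> R_U U U"
   "\<tau> * (\<Sum>n=1..N. h\<^sup>2 * a.sq (bdiff \<tau> U n)) \<le> R_U U U"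
   "h\<^sup>2 * a.sq (U N) + \<tau> * (\<Sum>n=1..N. h\<^sup>2 * a.sq (bdiff \<tau> U n)) \<le> R_U U U"
proof -
  have "0 \<le> h\<^sup>2 * a.sq x" for x using a.nonneg by simp
  moreover have "0 \<le> \<tau> * (\<Sum>n=1..N. h\<^sup>2 * a.sq (bdiff \<tau> U n))"
    using a.nonneg tau_pos by (intro mult_nonneg_nonneg sum_nonneg) auto
  ultimately show "h\<^sup>2 * a.sq (U N) \<le> R_U U U" "h\<^sup>2 * a.sq (bdiff \<tau> U N) \<le> R_U U U"
   "h\<^sup>2 * a.sq (bdiff \<tau> U 1) \<le> R_U U U"
   "\<tau> * (\<Sum>n=1..N. h\<^sup>2 * a.sq (bdiff \<tau> U n)) \<le> R_U U U"
   "h\<^sup>2 * a.sq (U N) + \<tau> * (\<Sum>n=1..N. h\<^sup>2 * a.sq (bdiff \<tau> U n)) \<le> R_U U U"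
    unfolding R_U_def by (simp_all add: add_increasing add_increasing2)
qed

text \<open>Every \<open>U\<^sup>n\<close> is the final value minus the sum of the later increments.\<close>

lemma energy_U_le:
  assumes "n \<le> N"
  shows "h\<^sup>2 * a.sq (U n) \<le> 2 * K * R_U U U"
proof -
  let ?d = "bdiff \<tau> U"
  have tele: "U n = U N - \<tau> *\<^sub>R (\<Sum>m=n+1..N. ?d m)"
    using assms
  proof (induction N rule: dec_induct)
    case (step m)
    then show ?case using bdiff_Suc[of \<tau> U m] tau_pos by (simp add: scaleR_add_right)
  qed simp
  have "a.sq (\<tau> *\<^sub>R (\<Sum>m=n+1..N. ?d m)) = \<tau>\<^sup>2 * a.sq (\<Sum>m=n+1..N. ?d m)"
    by (simp add: a.expand power2_eq_square)
  also have "\<dots> \<le> \<tau>\<^sup>2 * (real N * (\<Sum>m=1..N. a.sq (?d m)))"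
  proof (rule mult_left_mono)
    have "a.sq (\<Sum>m=n+1..N. ?d m) \<le> real (card {n+1..N}) * (\<Sum>m=n+1..N. a.sq (?d m))"
      by (rule a.sum_le) simp
    also have "\<dots> \<le> real N * (\<Sum>m=1..N. a.sq (?d m))"
      using a.nonneg by (intro mult_mono sum_mono2 sum_nonneg) auto
    finally show "a.sq (\<Sum>m=n+1..N. ?d m) \<le> real N * (\<Sum>m=1..N. a.sq (?d m))" .
  qed simp
  also have "\<dots> = T * (\<tau> * (\<Sum>m=1..N. a.sq (?d m)))"
    using tau_N by (simp add: power2_eq_square ac_simps flip: tau_N)
  also have "\<dots> \<le> K * (\<tau> * (\<Sum>m=1..N. a.sq (?d m)))"
    using K a.nonneg tau_pos by (intro mult_right_mono mult_nonneg_nonneg sum_nonneg) auto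
  finally have 1: "a.sq (\<tau> *\<^sub>R (\<Sum>m=n+1..N. ?d m)) \<le> K * (\<tau> * (\<Sum>m=1..N. a.sq (?d m)))" .
  have "a.sq (U n) \<le> 2 * a.sq (U N) + 2 * (K * (\<tau> * (\<Sum>m=1..N. a.sq (?d m))))"
    using a.diff_le[of "U N" "\<tau> *\<^sub>R (\<Sum>m=n+1..N. ?d m)"] 1 unfolding tele[symmetric] by linarith
  also have "\<dots> \<le> 2 * (K * a.sq (U N)) + 2 * (K * (\<tau> * (\<Sum>m=1..N. a.sq (?d m))))"
    using mult_right_mono[OF K(1) a.nonneg, of "U N"] by simp
  finally have "h\<^sup>2 * a.sq (U n) \<le> h\<^sup>2 * (2 * (K * a.sq (U N)) + 2 * (K * (\<tau> * (\<Sum>m=1..N. a.sq (?d m)))))"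
    by (rule mult_left_mono) simp
  also have "\<dots> = 2 * K * (h\<^sup>2 * a.sq (U N) + \<tau> * (\<Sum>n=1..N. h\<^sup>2 * a.sq (?d n)))"
    by (simp add: sum_distrib_left algebra_simps)
  also have "\<dots> \<le> 2 * K * R_U U U"
    using R_U_ge(5)[of U] K by (intro mult_left_mono) auto
  finally show ?thesis .
qed

lemma time_sum_le:
  assumes "A \<subseteq> {0..N}" "\<And>n. n \<in> A \<Longrightarrow> f n \<le> B" "0 \<le> B"
  shows "\<tau> * (\<Sum>n\<in>A. f n) \<le> 2 * K * B"
proof -
  have "(\<Sum>n\<in>A. f n) \<le> real (card A) * B" using sum_bounded_above[of A f B] assms by simp
  also have "\<dots> \<le> (real N + 1) * B"
    using card_mono[OF _ assms(1)] assms(3) by (intro mult_right_mono) auto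
  finally have "\<tau> * (\<Sum>n\<in>A. f n) \<le> \<tau> * ((real N + 1) * B)" using tau_pos by simp
  also have "\<dots> = (T + \<tau>) * B" by (simp add: algebra_simps flip: tau_N)
  also have "\<dots> \<le> 2 * K * B" using tau_le[of 1] N K assms(3) by (intro mult_right_mono) auto
  finally show ?thesis .
qed

lemma U_lower_order_le:
  "h\<^sup>2 * (\<tau> * (\<Sum>n=2..N. p.sq (U n))) \<le> 4 * K ^ 3 * R_U U U"
proof -
  have "\<tau> * (\<Sum>n\<in>{2..N}. h\<^sup>2 * p.sq (U n)) \<le> 2 * K * (K * (2 * K * R_U U U))"
  proof (rule time_sum_le)
    show "0 \<le> K * (2 * K * R_U U U)" using K R_U_nonneg by simp
    fix n assume "n \<in> {2..N}"
    then have "K * (h\<^sup>2 * a.sq (U n)) \<le> K * (2 * K * R_U U U)"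
      using K by (intro mult_left_mono energy_U_le) auto
    moreover have "h\<^sup>2 * p.sq (U n) \<le> h\<^sup>2 * (K * a.sq (U n))"
      by (intro mult_left_mono poincare) simp
    ultimately show "h\<^sup>2 * p.sq (U n) \<le> K * (2 * K * R_U U U)"
      by (simp add: mult.left_commute)
  qed auto
  then show ?thesis by (simp add: sum_distrib_left power3_eq_cube mult.assoc mult.left_commute)
qed

lemma weight_bounds:
  assumes "n \<le> N + 1"
  shows "0 \<le> 2 * T - real n * \<tau>" "2 * T - real n * \<tau> \<le> 2 * K"
proof -
  have "real n * \<tau> \<le> real (N + 1) * \<tau>" using assms tau_pos by (intro mult_right_mono) auto
  also have "\<dots> \<le> 2 * T" using tau_N tau_le[of 1] N by (simp add: algebra_simps)
  finally show "0 \<le> 2 * T - real n * \<tau>" by simp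
  have "0 \<le> real n * \<tau>" using tau_pos by simp
  then show "2 * T - real n * \<tau> \<le> 2 * K" using K by linarith
qed

lemma u_multiplier_norm_le: "\<tau> * (\<Sum>n=2..N. p.sq (u_multiplier u n)) \<le> 4 * K\<^sup>2 * h\<^sup>2 * F_sq u"
proof -
  define e where "e n = p.sq (bdiff \<tau> u n) + a.sq (u n)" for n
  define g where "g n = 2 * T - real n * \<tau>" for n :: nat
  have e_nn: "0 \<le> e n" for n using p.nonneg a.nonneg by (simp add: e_def)
  note gT = weight_bounds[folded g_def]
  have F_sq_e: "F_sq u = h\<^sup>2 * (\<tau> * (\<Sum>n=1..N. e n))" by (simp add: F_sq_def e_def)
    have "\<tau> * (\<Sum>n=2..N. p.sq (u_multiplier u n)) \<le> (2 * K * h\<^sup>2)\<^sup>2 * (\<tau> * (\<Sum>n=1..N. e n))"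
    proof -
      have "(\<Sum>n=2..N. p.sq (u_multiplier u n)) \<le> (\<Sum>n=2..N. (2 * K * h\<^sup>2)\<^sup>2 * e n)"
      proof (rule sum_mono)
        fix n assume n: "n \<in> {2..N}"
        have "p.sq (u_multiplier u n) = (h\<^sup>2 * g n)\<^sup>2 * p.sq (bdiff \<tau> u n)"
          using n by (simp add: u_multiplier_def g_def p.expand power2_eq_square)
        also have "\<dots> \<le> (2 * K * h\<^sup>2)\<^sup>2 * e n"
        proof (rule mult_mono[OF power_mono])
          show "h\<^sup>2 * g n \<le> 2 * K * h\<^sup>2" using mult_left_mono[OF gT(2)[of n], of "h\<^sup>2"] n by (simp add: ac_simps)
          show "0 \<le> h\<^sup>2 * g n" using gT(1)[of n] n by simp
        qed (use p.nonneg a.nonneg in \<open>auto simp: e_def\<close>)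
        finally show "p.sq (u_multiplier u n) \<le> (2 * K * h\<^sup>2)\<^sup>2 * e n" .
      qed
      also have "\<dots> \<le> (\<Sum>n=1..N. (2 * K * h\<^sup>2)\<^sup>2 * e n)"
        using e_nn by (intro sum_mono2) auto
      also have "\<dots> = (2 * K * h\<^sup>2)\<^sup>2 * (\<Sum>n=1..N. e n)" by (simp add: sum_distrib_left)
      finally show ?thesis using tau_pos by (simp add: mult.left_commute)
    qed
    also have "\<dots> = 4 * K\<^sup>2 * h\<^sup>2 * F_sq u" by (simp add: F_sq_e power2_eq_square)
    finally show ?thesis .
qed

text \<open>The multiplier turns \<open>G\<close> into weighted increments of the energy \<open>e n\<close>, and summation by parts leaves half the
time integral of the energy minus a multiple of the initial energy.  The latter contains \<open>\<parallel>\<nabla>u\<^sup>1\<parallel>\<close>, which is bounded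
by \<open>\<parallel>\<nabla>u\<^sup>0\<parallel>\<close> and \<open>\<tau> \<parallel>\<nabla>\<partial>\<^sub>\<tau>u\<^sup>1\<parallel>\<close>; here the inverse inequality and \<open>\<tau> \<le> K h\<close> enter.\<close>

lemma G_u_multiplier_ge:
  "F_sq u / 4 - 21 * K ^ 7 * (R_u u u + R_U U U) \<le> G u (u_multiplier u) - coupling U (u_multiplier u)"
proof -
  define e where "e n = p.sq (bdiff \<tau> u n) + a.sq (u n)" for n
  define g where "g n = 2 * T - real n * \<tau>" for n :: nat
  have e_nn: "0 \<le> e n" for n using p.nonneg a.nonneg by (simp add: e_def)
  note gT = weight_bounds[folded g_def]
  have F_sq_e: "F_sq u = h\<^sup>2 * (\<tau> * (\<Sum>n=1..N. e n))" by (simp add: F_sq_def e_def)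
  have e_sum: "(\<Sum>n=1..N. e n) = e 1 + (\<Sum>n=2..N. e n)"
    using N sum.atLeast_Suc_atMost[of 1 N e] by (simp add: numeral_2_eq_2)
  have "h\<^sup>2 / 2 * (\<Sum>n=2..N. g n * (e n - e (n - 1))) \<le> G u (u_multiplier u)"
  proof -
    have "h\<^sup>2 * g n * ((e n - e (n - 1)) / 2) \<le> \<tau> * (p (bdiff2 \<tau> u n) (u_multiplier u n) + a (u n) (u_multiplier u n))" if n: "n \<in> {2..N}" for n
    proof -
      have w: "u_multiplier u n = (h\<^sup>2 * g n) *\<^sub>R bdiff \<tau> u n" using n by (simp add: u_multiplier_def g_def)
      have "\<tau> *\<^sub>R bdiff2 \<tau> u n = bdiff \<tau> u n - bdiff \<tau> u (n - 1)" using tau_pos by (simp add: bdiff2_eq)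
      then have 1: "\<tau> * p (bdiff2 \<tau> u n) (bdiff \<tau> u n) = p (bdiff \<tau> u n - bdiff \<tau> u (n - 1)) (bdiff \<tau> u n)"
        using p.expand(3)[of \<tau> "bdiff2 \<tau> u n" "bdiff \<tau> u n"] by simp
      have "\<tau> *\<^sub>R bdiff \<tau> u n = u n - u (n - 1)" using tau_pos by (simp add: bdiff_def)
      then have 2: "\<tau> * a (u n) (bdiff \<tau> u n) = a (u n - u (n - 1)) (u n)"
        using a.expand(4)[of "u n" \<tau> "bdiff \<tau> u n"] a.commute[of "u n"] by (simp del: a.expand)
      have "(e n - e (n - 1)) / 2 \<le> p (bdiff \<tau> u n - bdiff \<tau> u (n - 1)) (bdiff \<tau> u n) + a (u n - u (n - 1)) (u n)"
        unfolding e_def using p.backward_difference_test[of "bdiff \<tau> u n" "bdiff \<tau> u (n - 1)"] a.backward_difference_test[of "u n" "u (n - 1)"]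
        by argo
      then have "h\<^sup>2 * g n * ((e n - e (n - 1)) / 2) \<le> h\<^sup>2 * g n * (\<tau> * p (bdiff2 \<tau> u n) (bdiff \<tau> u n) + \<tau> * a (u n) (bdiff \<tau> u n))"
        using gT[of n] n unfolding 1 2 by (intro mult_left_mono) auto
      also have "\<dots> = \<tau> * (p (bdiff2 \<tau> u n) (u_multiplier u n) + a (u n) (u_multiplier u n))"
        unfolding w p.expand(4) a.expand(4) by (simp add: algebra_simps)
      finally show ?thesis .
    qed
    then have "(\<Sum>n=2..N. h\<^sup>2 * g n * ((e n - e (n - 1)) / 2)) \<le> (\<Sum>n=2..N. \<tau> * (p (bdiff2 \<tau> u n) (u_multiplier u n) + a (u n) (u_multiplier u n)))"
      by (rule sum_mono)
    then show ?thesis by (simp add: G_def sum_distrib_left mult.assoc)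
  qed
  moreover have "(\<Sum>n=2..N. g n * (e n - e (n - 1))) \<ge> \<tau> * (\<Sum>n=1..N. e n) - 2 * K * e 1"
  proof -
    have gd: "g n - g (n + 1) = \<tau>" for n by (simp add: g_def algebra_simps)
    have "(\<Sum>n=2..N. g n * (e n - e (n - 1))) = g (N + 1) * e N - g 2 * e 1 + \<tau> * (\<Sum>n=2..N. e n)"
      using weighted_telescope[of N g e] N unfolding gd by (simp add: sum_distrib_left)
    moreover have "0 \<le> g (N + 1) * e N" using gT e_nn by simp
    moreover have "\<tau> * e 1 + g 2 * e 1 \<le> 2 * K * e 1"
    proof -
      have "\<tau> + g 2 \<le> 2 * K" using tau_pos K by (simp add: g_def)
      then have "(\<tau> + g 2) * e 1 \<le> 2 * K * e 1" using e_nn by (rule mult_right_mono)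
      then show ?thesis by (simp only: distrib_right)
    qed
    ultimately show ?thesis unfolding e_sum distrib_left by linarith
  qed
  then have "h\<^sup>2 / 2 * (\<tau> * (\<Sum>n=1..N. e n) - 2 * K * e 1) \<le> h\<^sup>2 / 2 * (\<Sum>n=2..N. g n * (e n - e (n - 1)))"
    by (intro mult_left_mono) auto
  moreover have "h\<^sup>2 / 2 * (\<tau> * (\<Sum>n=1..N. e n) - 2 * K * e 1) = F_sq u / 2 - h\<^sup>2 * (K * e 1)"
    by (simp add: F_sq_e algebra_simps)
  moreover have "h\<^sup>2 * (K * e 1) \<le> 5 * K ^ 7 * R_u u u"
  proof -
    have u1: "u 1 = u 0 + \<tau> *\<^sub>R bdiff \<tau> u 1" using tau_pos by (simp add: bdiff_def)
    have "a.sq (u 1) \<le> 2 * a.sq (u 0) + 2 * (\<tau>\<^sup>2 * a.sq (bdiff \<tau> u 1))"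
      using a.add_le[of "u 0" "\<tau> *\<^sub>R bdiff \<tau> u 1"] unfolding u1[symmetric] a.expand(3,4)
      by (simp add: power2_eq_square)
    also have "\<tau>\<^sup>2 * a.sq (bdiff \<tau> u 1) \<le> (K * h)\<^sup>2 * a.sq (bdiff \<tau> u 1)"
      using \<tau> tau_pos a.nonneg by (intro mult_right_mono power_mono) auto
    also have "\<dots> = K\<^sup>2 * (h\<^sup>2 * a.sq (bdiff \<tau> u 1))" by (simp add: power_mult_distrib)
    also have "\<dots> \<le> K\<^sup>2 * (K * p.sq (bdiff \<tau> u 1))"
      by (intro mult_left_mono inverse_ineq) auto
    also have "\<dots> = K ^ 3 * p.sq (bdiff \<tau> u 1)" by (simp add: power3_eq_cube power2_eq_square)
    also have "\<dots> \<le> K ^ 3 * R_u u u" using R_u_ge K by (intro mult_left_mono) auto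
    finally have "a.sq (u 1) \<le> 2 * R_u u u + 2 * (K ^ 3 * R_u u u)" using R_u_ge[of u] by linarith
    then have "e 1 \<le> 3 * R_u u u + 2 * (K ^ 3 * R_u u u)" using R_u_ge[of u] unfolding e_def by linarith
    also have "\<dots> \<le> 5 * (K ^ 3 * R_u u u)"
      using mult_right_mono[OF one_le_power[OF K(1), of 3] R_u_nonneg[of u]] by simp
    finally have "K * e 1 \<le> K * (5 * (K ^ 3 * R_u u u))" using K by simp
    also have "\<dots> = 5 * (K ^ 4 * R_u u u)" by (simp add: power_numeral_reduce)
    also have "\<dots> \<le> 5 * (K ^ 7 * R_u u u)"
      using mult_right_mono[OF K_power[of 4 7] R_u_nonneg[of u]] by simp
    finally have "K * e 1 \<le> 5 * (K ^ 7 * R_u u u)" .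
    moreover have "h\<^sup>2 * (K * e 1) \<le> 1 * (K * e 1)"
      using h2 K e_nn[of 1] by (intro mult_right_mono) auto
    ultimately show ?thesis by simp
  qed
  moreover have "coupling U (u_multiplier u) \<le> F_sq u / 4 + 16 * K ^ 7 * R_U U U"
  proof -
    \<comment> \<open>With this parameter in Young's inequality the multiplier part becomes exactly \<open>F_sq u / 4\<close>.\<close>
    have d: "0 < 8 * K ^ 3 * h\<^sup>2" using h2 K by simp
    note w = u_multiplier_norm_le[of u]
    have "coupling U (u_multiplier u) \<le> K / 2 * (8 * K ^ 3 * h\<^sup>2 * (\<tau> * (\<Sum>n=2..N. p.sq (U n))) + \<tau> * (\<Sum>n=2..N. p.sq (u_multiplier u n)) / (8 * K ^ 3 * h\<^sup>2))"
      by (rule coupling_le[OF d])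
    also have "\<dots> \<le> K / 2 * (8 * K ^ 3 * (4 * K ^ 3 * R_U U U) + (4 * K\<^sup>2 * h\<^sup>2 * F_sq u) / (8 * K ^ 3 * h\<^sup>2))"
      using mult_left_mono[OF U_lower_order_le[of U], of "8 * K ^ 3"] w d K
      by (intro mult_left_mono add_mono divide_right_mono) (auto simp: mult.assoc)
    also have "\<dots> = 16 * K ^ 7 * R_U U U + F_sq u / 4"
      using h(1) K by (simp add: field_simps power_numeral_reduce)
    finally show ?thesis by simp
  qed
  moreover have "21 * K ^ 7 * (R_u u u + R_U U U) \<ge> 5 * K ^ 7 * R_u u u + 16 * K ^ 7 * R_U U U"
    using R_u_nonneg[of u] R_U_nonneg[of U] K by (simp add: distrib_left)
  ultimately show ?thesis by linarith
qed

lemma sum_by_parts: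
  fixes D U :: "nat \<Rightarrow> 'v"
  assumes "2 \<le> M" "\<And>n. D (Suc n) = (U (Suc n) - U n) /\<^sub>R \<tau>"
  shows "(\<Sum>n=0..<M - 1. a (D (n + 2) - D (n + 1)) (U n)) =
     a (D M) (U (M - 2)) - a (D 1) (U 0) - \<tau> * (\<Sum>n=1..<M - 1. a (D (n + 1)) (D n))"
  using assms(1)
proof (induction M rule: nat_induct_at_least)
  case base
  then show ?case by (simp add: a.expand numeral_2_eq_2)
next
  case (Suc M)
  obtain k where k: "M = Suc (Suc k)" using Suc.hyps by (auto dest!: le_Suc_ex)
  have "U (Suc k) - U k = \<tau> *\<^sub>R D (Suc k)" using assms(2) tau_pos by simp
  then have "a (D (Suc (Suc k))) (U (Suc k)) - a (D (Suc (Suc k))) (U k) = \<tau> * a (D (Suc (Suc k))) (D (Suc k))"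
    by (metis a.expand(4) a.expand(6) real_scaleR_def)
  then show ?case using Suc.IH by (simp add: k a.expand algebra_simps)
qed

text \<open>The mass part is exactly the sum of squares.  In the Dirichlet part the outer difference of the second difference is
moved to the other factor, so that only first differences of \<open>U\<close> and its values near the two end times remain.\<close>

lemma Gs_U_multiplier_ge:
  "diff2_sq U - 6 * K * R_U U U \<le> Gs (U_multiplier U) U"
proof -
  let ?d = "bdiff \<tau> U"
  let ?R = "R_U U U"
  have W: "U_multiplier U n = h\<^sup>2 *\<^sub>R bdiff2 \<tau> U (n + 2)" if "n \<in> {0..<N - 1}" for n
    using that by (simp add: U_multiplier_def fdiff2_eq)
  have "Gs (U_multiplier U) U = \<tau> * (\<Sum>n=0..<N - 1. h\<^sup>2 * p.sq (bdiff2 \<tau> U (n + 2)) + h\<^sup>2 * a (bdiff2 \<tau> U (n + 2)) (U n))"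
    unfolding Gs_def by (intro arg_cong[where f="\<lambda>x. \<tau> * x"] sum.cong refl) (simp add: W fdiff2_eq p.expand a.expand)
  also have "\<dots> = diff2_sq U + h\<^sup>2 * (\<Sum>n=0..<N - 1. \<tau> * a (bdiff2 \<tau> U (n + 2)) (U n))"
    unfolding diff2_sq_def sum_shift2[symmetric, of "\<lambda>n. p.sq (bdiff2 \<tau> U n)"]
    by (simp add: sum.distrib sum_distrib_left algebra_simps)
  also have "(\<Sum>n=0..<N - 1. \<tau> * a (bdiff2 \<tau> U (n + 2)) (U n)) = (\<Sum>n=0..<N - 1. a (?d (n + 2) - ?d (n + 1)) (U n))"
  proof (rule sum.cong[OF refl])
    fix n
    have "\<tau> *\<^sub>R bdiff2 \<tau> U (n + 2) = ?d (n + 2) - ?d (n + 1)" using tau_pos by (simp add: bdiff2_eq)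
    then show "\<tau> * a (bdiff2 \<tau> U (n + 2)) (U n) = a (?d (n + 2) - ?d (n + 1)) (U n)"
      by (metis a.expand(3) real_scaleR_def)
  qed
  also have "\<dots> = a (?d N) (U (N - 2)) - a (?d 1) (U 0) - \<tau> * (\<Sum>n=1..<N - 1. a (?d (n + 1)) (?d n))"
    by (rule sum_by_parts) (use N in \<open>auto simp: bdiff_def\<close>)
  finally have *: "Gs (U_multiplier U) U = diff2_sq U + (h\<^sup>2 * a (?d N) (U (N - 2)) - h\<^sup>2 * a (?d 1) (U 0) - \<tau> * (\<Sum>n=1..<N - 1. h\<^sup>2 * a (?d (n + 1)) (?d n)))"
    by (simp add: algebra_simps sum_distrib_left)
  have Y: "\<bar>h\<^sup>2 * a x y\<bar> \<le> (h\<^sup>2 * a.sq x + h\<^sup>2 * a.sq y) / 2" for x y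
    using mult_left_mono[OF a.young[of 1 x y], of "h\<^sup>2"] by (simp add: abs_mult distrib_left)
  have "(\<Sum>n=1..<N - 1. h\<^sup>2 * a (?d (n + 1)) (?d n)) \<le> (\<Sum>n=1..<N - 1. (h\<^sup>2 * a.sq (?d (n + 1)) + h\<^sup>2 * a.sq (?d n)) / 2)"
    by (intro sum_mono order_trans[OF abs_ge_self Y])
  also have "\<dots> = (\<Sum>n=1..<N - 1. h\<^sup>2 * a.sq (?d (n + 1))) / 2 + (\<Sum>n=1..<N - 1. h\<^sup>2 * a.sq (?d n)) / 2"
    by (simp add: sum.distrib sum_divide_distrib add_divide_distrib)
  also have "(\<Sum>n=1..<N - 1. h\<^sup>2 * a.sq (?d (n + 1))) = (\<Sum>n=2..<N. h\<^sup>2 * a.sq (?d n))"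
    by (rule sum.reindex_bij_witness[of _ "\<lambda>n. n - 1" Suc]) auto
  also have "(\<Sum>n=2..<N. h\<^sup>2 * a.sq (?d n)) / 2 + (\<Sum>n=1..<N - 1. h\<^sup>2 * a.sq (?d n)) / 2
    \<le> (\<Sum>n=1..N. h\<^sup>2 * a.sq (?d n)) / 2 + (\<Sum>n=1..N. h\<^sup>2 * a.sq (?d n)) / 2"
    using a.nonneg h2 by (intro add_mono divide_right_mono sum_mono2) auto
  finally have "\<tau> * (\<Sum>n=1..<N - 1. h\<^sup>2 * a (?d (n + 1)) (?d n)) \<le> \<tau> * (\<Sum>n=1..N. h\<^sup>2 * a.sq (?d n))"
    using tau_pos by (intro mult_left_mono) auto
  with R_U_ge(4)[of U] have 1: "\<tau> * (\<Sum>n=1..<N - 1. h\<^sup>2 * a (?d (n + 1)) (?d n)) \<le> ?R" by linarith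
  have R: "?R \<le> K * ?R" using mult_right_mono[OF K(1) R_U_nonneg[of U]] by simp
  have "- (h\<^sup>2 * a (?d N) (U (N - 2))) \<le> (?R + 2 * K * ?R) / 2"
    using Y[of "?d N" "U (N - 2)"] R_U_ge(2)[of U] energy_U_le[of "N - 2" U] by (simp add: abs_le_iff)
  moreover have "h\<^sup>2 * a (?d 1) (U 0) \<le> (?R + 2 * K * ?R) / 2"
    using Y[of "?d 1" "U 0"] R_U_ge(3)[of U] energy_U_le[of 0 U] by (simp add: abs_le_iff)
  moreover have eq: "2 * K * ?R = 2 * (K * ?R)" "6 * K * ?R = 6 * (K * ?R)" by simp_all
  ultimately show ?thesis using 1 R R_U_nonneg[of U] unfolding * eq by argo
qed

lemma F'_sq_le: "F'_sq U \<le> diff2_sq U + 11 * K ^ 3 * R_U U U"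
proof -
  let ?d = "bdiff \<tau> U"
  let ?R = "R_U U U"
  let ?S = "\<tau> * (\<Sum>n=2..N. h\<^sup>2 * a.sq (?d n))"
  have R: "?R \<le> K ^ 3 * ?R" "K * ?R \<le> K ^ 3 * ?R" "K\<^sup>2 * ?R \<le> K ^ 3 * ?R"
    using mult_right_mono[OF K_power[of 0 3] R_U_nonneg[of U]] mult_right_mono[OF K_power[of 1 3] R_U_nonneg[of U]]
       mult_right_mono[OF K_power[of 2 3] R_U_nonneg[of U]] by auto
  have S: "?S \<le> ?R"
  proof -
    have "?S \<le> \<tau> * (\<Sum>n=1..N. h\<^sup>2 * a.sq (?d n))"
      using tau_pos a.nonneg by (intro mult_left_mono sum_mono2) auto
    with R_U_ge(4)[of U] show ?thesis by linarith
  qed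
  have P: "h\<^sup>2 * p.sq x \<le> K * (h\<^sup>2 * a.sq x)" for x
    using mult_left_mono[OF poincare[of x], of "h\<^sup>2"] h2 by (simp add: mult.left_commute)
  have 1: "\<tau> * (\<Sum>n=2..N. h\<^sup>2 * p.sq (?d n)) \<le> K * ?R"
  proof -
    have "\<tau> * (\<Sum>n=2..N. h\<^sup>2 * p.sq (?d n)) \<le> \<tau> * (\<Sum>n=2..N. K * (h\<^sup>2 * a.sq (?d n)))"
      using tau_pos by (intro mult_left_mono sum_mono P) auto
    also have "\<dots> = K * ?S" by (simp add: sum_distrib_left mult.left_commute)
    also have "\<dots> \<le> K * ?R" using S K by (intro mult_left_mono) auto
    finally show ?thesis .
  qed
  have 2: "\<tau> * (\<Sum>n=2..N. h\<^sup>2 * a.sq (U n)) \<le> 2 * K * (2 * K * ?R)"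
    by (rule time_sum_le) (use energy_U_le K R_U_nonneg[of U] in auto)
  have 3: "h\<^sup>2 * p.sq (?d 1) \<le> K * ?R"
    using P[of "?d 1"] mult_left_mono[OF R_U_ge(3)[of U], of K] K by linarith
  have 4: "h\<^sup>2 * a.sq (U 1) \<le> 2 * K * ?R" using energy_U_le[of 1 U] N by simp
  have "F'_sq U = diff2_sq U + ?S + \<tau> * (\<Sum>n=2..N. h\<^sup>2 * p.sq (?d n)) + \<tau> * (\<Sum>n=2..N. h\<^sup>2 * a.sq (U n))
     + h\<^sup>2 * p.sq (?d 1) + h\<^sup>2 * a.sq (U 1)"
    by (simp add: F'_sq_def diff2_sq_def sum.distrib sum_distrib_left distrib_left mult.left_commute)
  also have "\<dots> \<le> diff2_sq U + ?R + K * ?R + 4 * (K\<^sup>2 * ?R) + K * ?R + 2 * (K * ?R)"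
    using S 1 2 3 4 by (simp add: power2_eq_square mult.assoc)
  also have "\<dots> \<le> diff2_sq U + 11 * K ^ 3 * ?R" using R R_U_nonneg[of U] by (simp add: mult.assoc)
  finally show ?thesis .
qed

lemma U_multiplier_norm_le: "\<tau> * (\<Sum>n=0..<N - 1. p.sq (U_multiplier U n)) \<le> diff2_sq U"
proof -
  have "\<tau> * (\<Sum>n=0..<N - 1. p.sq (U_multiplier U n)) = \<tau> * (\<Sum>n=0..<N - 1. h\<^sup>2 * (h\<^sup>2 * p.sq (bdiff2 \<tau> U (n + 2))))"
    by (intro arg_cong[where f="\<lambda>x. \<tau> * x"] sum.cong refl) (simp add: U_multiplier_def fdiff2_eq p.expand)
  also have "\<dots> = h\<^sup>2 * diff2_sq U"
    unfolding diff2_sq_def sum_shift2[symmetric, of "\<lambda>n. p.sq (bdiff2 \<tau> U n)"]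
    by (simp add: sum_distrib_left mult.left_commute)
  also have "\<dots> \<le> 1 * diff2_sq U"
    using h2 tau_pos p.nonneg unfolding diff2_sq_def by (intro mult_right_mono mult_nonneg_nonneg sum_nonneg) auto
  finally show ?thesis by simp
qed

lemma diff2_sq_le: "diff2_sq U \<le> F'_sq U" and diff2_sq_nonneg: "0 \<le> diff2_sq U" and F_sq_nonneg: "0 \<le> F_sq u"
  and D_sq_nonneg: "0 \<le> D_sq z" and D'_sq_nonneg: "0 \<le> D'_sq Z"
  and D_sq_ge: "\<tau> * (\<Sum>n=2..N. p.sq (z n)) \<le> D_sq z"
  and D'_sq_ge: "\<tau> * (\<Sum>n=0..<N - 1. p.sq (Z n)) \<le> D'_sq Z"
proof -
  have "(\<Sum>n=2..N. p.sq (bdiff2 \<tau> U n)) \<le> (\<Sum>n=2..N. p.sq (bdiff2 \<tau> U n) + a.sq (bdiff \<tau> U n)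
     + p.sq (bdiff \<tau> U n) + a.sq (U n))"
    using p.nonneg a.nonneg by (intro sum_mono) (simp add: add_nonneg_nonneg add.assoc)
  then have "\<tau> * (\<Sum>n=2..N. p.sq (bdiff2 \<tau> U n)) \<le> \<tau> * (\<Sum>n=2..N. p.sq (bdiff2 \<tau> U n) + a.sq (bdiff \<tau> U n)
     + p.sq (bdiff \<tau> U n) + a.sq (U n))" using tau_pos by simp
  then show "diff2_sq U \<le> F'_sq U" unfolding diff2_sq_def F'_sq_def
    using p.nonneg[of "bdiff \<tau> U 1"] a.nonneg[of "U 1"] by (intro mult_left_mono) auto
  show "0 \<le> diff2_sq U" "0 \<le> F_sq u"
    unfolding diff2_sq_def F_sq_def using tau_pos p.nonneg a.nonneg by (auto intro!: mult_nonneg_nonneg sum_nonneg add_nonneg_nonneg)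
  show "0 \<le> D_sq z" "0 \<le> D'_sq Z"
    unfolding D_sq_def D'_sq_def using tau_pos p.nonneg a.nonneg by (auto intro!: mult_nonneg_nonneg sum_nonneg add_nonneg_nonneg)
  have "0 \<le> \<tau> * (\<Sum>n=2..N. a.sq (wsum \<tau> z n))" "0 \<le> \<tau> * (\<Sum>n=0..<N - 1. a.sq (wsum_bwd \<tau> N Z n))"
    using tau_pos a.nonneg by (auto intro!: mult_nonneg_nonneg sum_nonneg)
  then show "\<tau> * (\<Sum>n=2..N. p.sq (z n)) \<le> D_sq z" "\<tau> * (\<Sum>n=0..<N - 1. p.sq (Z n)) \<le> D'_sq Z"
    unfolding D_sq_def D'_sq_def using p.nonneg a.nonneg by (auto intro!: add_nonneg_nonneg add_increasing2)
qed

definition "stability_sq u U z Z = R_u u u + R_U U U + F_sq u + F'_sq U + D_sq z + D'_sq Z"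
definition "C_sq v V w W = R_u v v + R_U V V + \<tau> * (\<Sum>n=2..N. p.sq (w n)) + \<tau> * (\<Sum>n=0..<N - 1. p.sq (W n))"

end

section \<open>The inf-sup estimate for abstract forms\<close>

text \<open>The sizes of the perturbations.  The choice of \<open>b3\<close> keeps a quarter of \<open>R\<close>, \<open>b1\<close> maximises \<open>b1 k - b1\<^sup>2 L / 2\<close>, and
\<open>b2\<close> is so small that the coupling term, split with parameter \<open>\<delta>\<close>, takes at most half of the gain in \<open>D\<close> and
a quarter of that in \<open>D'\<close>.\<close>

lemma weighted_estimates_combine:
  fixes k L R F E D D' :: real
  assumes b1: "b1 = k / L" and b2: "b2 = k ^ 3 / (16 * L ^ 3)" and b3: "b3 = 1 / (8 * L)" and \<delta>: "\<delta> = k / (4 * L)"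
  assumes k: "0 < k" "k \<le> 1" and L: "1 \<le> L" and nn: "0 \<le> R" "0 \<le> F" "0 \<le> E" "0 \<le> D" "0 \<le> D'"
  shows "k ^ 4 / (64 * L ^ 3) * (R + F + E + D + D') \<le>
    R / 2 - b1\<^sup>2 * (L * D) / 2 - b2\<^sup>2 * (L * D') / 2 + b1 * (k * D) + b2 * (k * D' - L * (\<delta> * D' + D / \<delta>))
    + b3 * (F / 4 - L * R) + b3 * (E - L * R)"
proof -
  have L0: "0 < L" using L by simp
  let ?C = "k ^ 4 / (64 * L ^ 3)"
  have C_le: "?C \<le> x / (64 * y)" if "k ^ 4 \<le> x" "y \<le> L ^ 3" "0 < y" for x y
    using that L0 k order_trans[OF zero_le_power[of k 4] that(1)] by (intro frac_le) auto
  have kp: "k ^ 4 \<le> 1" "k ^ 4 \<le> k\<^sup>2" using k power_decreasing[of 0 4 k] power_decreasing[of 2 4 k] by auto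
  have Lp: "1 \<le> L ^ 3" "L \<le> L ^ 3" using L power_increasing[of 0 3 L] power_increasing[of 1 3 L] by auto
  have b3L: "b3 * L = 1 / 8" and \<delta>L: "L * \<delta> = k / 4" using L0 by (simp_all add: b3 \<delta>)
  have cR: "?C \<le> 1 / 2 - 2 * (b3 * L)" using C_le[OF kp(1) Lp(1)] by (simp add: b3L)
  have cF: "?C \<le> b3 / 4" "?C \<le> b3"
  proof -
    have "b3 = 8 * (1 / (64 * L))" "0 \<le> 1 / (64 * L)" using L0 by (auto simp: b3)
    then show "?C \<le> b3 / 4" "?C \<le> b3" using C_le[OF kp(1) Lp(2) L0] by linarith+
  qed
  have "b1 * k - b1\<^sup>2 * L / 2 - b2 * L / \<delta> = k\<^sup>2 / (4 * L)"
    using L0 k by (simp add: b1 b2 \<delta> field_simps power_numeral_reduce)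
  moreover have "?C \<le> k\<^sup>2 / (4 * L)"
  proof -
    have "k\<^sup>2 / (4 * L) = 16 * (k\<^sup>2 / (64 * L))" "0 \<le> k\<^sup>2 / (64 * L)" using L0 by auto
    then show ?thesis using C_le[OF kp(2) Lp(2) L0] by linarith
  qed
  ultimately have cD: "?C \<le> b1 * k - b1\<^sup>2 * L / 2 - b2 * L / \<delta>" by simp
  have cD': "?C \<le> b2 * (k - L * \<delta>) - b2\<^sup>2 * L / 2"
  proof -
    have b2_pos: "0 < b2" using k L0 by (simp add: b2)
    have "b2 * L = k ^ 3 / (16 * L\<^sup>2)" using L0 by (simp add: b2 field_simps power_numeral_reduce)
    also have "\<dots> \<le> k / (16 * 1)"
      using k L power_decreasing[of 1 3 k] by (intro frac_le) (auto simp: one_le_power)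
    finally have "b2 * (b2 * L) \<le> b2 * (k / 16)" using b2_pos by (intro mult_left_mono) auto
    moreover have "?C = b2 * k / 4" by (simp add: b2 power_numeral_reduce)
    moreover have "b2\<^sup>2 * L / 2 = b2 * (b2 * L) / 2" by (simp add: power2_eq_square)
    moreover have "0 < b2 * k" using b2_pos k by simp
    moreover have "b2 * (k - L * \<delta>) = 3 / 4 * (b2 * k)" "b2 * (k / 16) = b2 * k / 16" by (simp_all add: \<delta>L)
    ultimately show ?thesis by linarith
  qed
  have "?C * (R + F + E + D + D') = ?C * R + ?C * F + ?C * E + ?C * D + ?C * D'" by (simp only: distrib_left)
  also have "\<dots> \<le> (1 / 2 - 2 * (b3 * L)) * R + b3 / 4 * F + b3 * E + (b1 * k - b1\<^sup>2 * L / 2 - b2 * L / \<delta>) * D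
      + (b2 * (k - L * \<delta>) - b2\<^sup>2 * L / 2) * D'"
    by (intro add_mono mult_right_mono cR cF cD cD' nn)
  also have "\<dots> = R / 2 - b1\<^sup>2 * (L * D) / 2 - b2\<^sup>2 * (L * D') / 2 + b1 * (k * D) + b2 * (k * D' - L * (\<delta> * D' + D / \<delta>))
    + b3 * (F / 4 - L * R) + b3 * (E - L * R)"
    by (simp add: algebra_simps)
  finally show ?thesis .
qed

context discrete_wave
begin

text \<open>The estimates are added with the weights from \<open>weighted_estimates_combine\<close>.  The constant \<open>L\<close> dominates all
polynomials in \<open>K\<close> that occur in them.\<close>

lemma discrete_inf_sup:
  assumes z: "z 0 = 0" "z 1 = 0" and Z: "Z N = 0" "Z (N - 1) = 0"
    and k: "k = 1 / (2 * (1 + 2 * K)\<^sup>2)" and L: "L = 40 * K ^ 7"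
    and b: "b1 = k / L" "b2 = k ^ 3 / (16 * L ^ 3)" "b3 = 1 / (8 * L)"
    and v: "v = (\<lambda>n. u n + b1 *\<^sub>R wsum \<tau> z n)" and V: "V = (\<lambda>n. U n + b2 *\<^sub>R wsum_bwd \<tau> N Z n)"
    and w: "w = (\<lambda>n. - z n + b3 *\<^sub>R u_multiplier u n)" and W: "W = (\<lambda>n. - Z n + b3 *\<^sub>R U_multiplier U n)"
  shows "k ^ 4 / (128 * L ^ 4) * stability_sq u U z Z \<le> A_bilinear u U z Z v V w W"
    and "k ^ 4 / (128 * L ^ 4) * C_sq v V w W \<le> stability_sq u U z Z"
proof -
  let ?R = "R_u u u + R_U U U"
  note nn = R_u_nonneg[of u] R_U_nonneg[of U] F_sq_nonneg[of u] diff2_sq_nonneg[of U] D_sq_nonneg[of z] D'_sq_nonneg[of Z]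
  have R: "0 \<le> ?R" using nn by simp
  have K7: "1 \<le> K ^ 7" "K \<le> K ^ 7" "K\<^sup>2 \<le> K ^ 7" "K ^ 3 \<le> K ^ 7" 
    using K_power[of 0 7] K_power[of 1 7] K_power[of 2 7] K_power[of 3 7] by auto
  have K2: "(1 + K)\<^sup>2 \<le> 4 * K\<^sup>2"
  proof -
    have "(1 + K)\<^sup>2 \<le> (2 * K)\<^sup>2" using K by (intro power_mono) auto
    then show ?thesis by (simp add: power_mult_distrib)
  qed
  have L_ge: "1 \<le> L" "(1 + K)\<^sup>2 \<le> L" "K * (1 + K)\<^sup>2 \<le> L" "K\<^sup>2 \<le> L" "21 * K ^ 7 \<le> L" "6 * K \<le> L" "11 * K ^ 3 \<le> L"
    "4 * K\<^sup>2 \<le> L"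
  proof -
    have "K * (1 + K)\<^sup>2 \<le> K * (4 * K\<^sup>2)" using K K2 by (intro mult_left_mono) auto
    also have "\<dots> = 4 * K ^ 3" by (simp add: power_numeral_reduce)
    finally show "K * (1 + K)\<^sup>2 \<le> L" using K7 unfolding L by linarith
  qed (use K7 K2 K in \<open>unfold L, linarith+\<close>)
  have L0: "0 < L" using L_ge by simp
  have k01: "0 < k" "k \<le> 1"
  proof -
    have "0 < 1 + 2 * K" using K by simp
    then show "0 < k" by (simp add: k)
    have "1 \<le> (1 + 2 * K)\<^sup>2" using K by (intro one_le_power) auto
    then have "1 / (2 * (1 + 2 * K)\<^sup>2) \<le> 1 / 1" by (intro frac_le) auto
    then show "k \<le> 1" unfolding k by simp
  qed
  have b_le: "0 < b1" "b1 \<le> 1" "0 < b2" "b2 \<le> 1" "0 < b3" "b3 \<le> 1"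
  proof -
    have "k ^ 3 \<le> 1" using k01 by (intro power_le_one) auto
    moreover have "1 \<le> L ^ 3" using L_ge(1) by (rule one_le_power)
    ultimately have "k ^ 3 \<le> 16 * L ^ 3" "k \<le> L" "1 \<le> 8 * L" using k01 L_ge(1) by linarith+
    then show "0 < b1" "b1 \<le> 1" "0 < b2" "b2 \<le> 1" "0 < b3" "b3 \<le> 1"
      using k01(1) L0 by (auto simp: b)
  qed
  have scale: "c * X \<le> L * X" if "c \<le> L" "0 \<le> X" for c X using that by (rule mult_right_mono)
  let ?V = "wsum_bwd \<tau> N Z" and ?v = "wsum \<tau> z"
  define \<delta> where "\<delta> = k / (4 * L)"
  have \<delta>0: "0 < \<delta>" using k01 L0 by (simp add: \<delta>_def)
  have S1: "R_u ?v ?v \<le> L * D_sq z"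
    using R_u_wsum_le[OF z] scale[OF L_ge(2) nn(5)] by linarith
  have S2: "R_U ?V ?V \<le> L * D'_sq Z"
    using R_U_wsum_bwd_le[OF Z] scale[OF L_ge(3) nn(6)] by linarith
  have G1: "k * D_sq z \<le> G ?v z" using G_wsum_ge[OF z] by (simp add: k)
  have G2: "k * D'_sq Z \<le> Gs Z ?V" using Gs_wsum_bwd_ge[OF Z] by (simp add: k)
  have X: "0 \<le> \<delta> * D'_sq Z + D_sq z / \<delta>" using nn \<delta>0 by simp
  have c1: "coupling ?V z \<le> L * (\<delta> * D'_sq Z + D_sq z / \<delta>)"
    using coupling_wsum_bwd_le[OF Z \<delta>0, of z] scale[OF L_ge(4) X] by linarith
  have G3: "F_sq u / 4 - L * ?R \<le> G u (u_multiplier u) - coupling U (u_multiplier u)"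
    using G_u_multiplier_ge[of u U] scale[OF L_ge(5) R] by linarith
  have G4: "diff2_sq U - L * ?R \<le> Gs (U_multiplier U) U"
  proof -
    have "L * R_U U U \<le> L * ?R" using nn L0 by (intro mult_left_mono) auto
    then show ?thesis using Gs_U_multiplier_ge[of U] scale[OF L_ge(6) nn(2)] by linarith
  qed
  have st1: "R_u u u / 2 - b1\<^sup>2 * (L * D_sq z) / 2 \<le> R_u u v"
    using R_u_young(1)[where u=u and r=b1 and v="?v"] mult_left_mono[OF S1, of "b1\<^sup>2"] unfolding v by simp
  have st2: "R_U U U / 2 - b2\<^sup>2 * (L * D'_sq Z) / 2 \<le> R_U U V"
    using R_U_young(1)[where u=U and r=b2 and v="?V"] mult_left_mono[OF S2, of "b2\<^sup>2"] unfolding V by simp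
  have A_eq: "A_bilinear u U z Z v V w W = R_u u v + R_U U V + b1 * G ?v z + b2 * (Gs Z ?V - coupling ?V z)
     + b3 * (G u (u_multiplier u) - coupling U (u_multiplier u)) + b3 * Gs (U_multiplier U) U"
  proof -
    have "A_bilinear u U z Z v V w W = G v z + Gs Z V - coupling V z + (R_u u v + R_U U V) + G u w - coupling U w + Gs W U"
      by (simp add: A_bilinear_def)
    also have "\<dots> = R_u u v + R_U U V + b1 * G ?v z + b2 * (Gs Z ?V - coupling ?V z)
     + b3 * (G u (u_multiplier u) - coupling U (u_multiplier u)) + b3 * Gs (U_multiplier U) U"
      unfolding v V w W G_left G_right Gs_left Gs_right coupling_left coupling_right
      by (simp add: right_diff_distrib)
    finally show ?thesis .
  qed
  have main: "k ^ 4 / (64 * L ^ 3) * (?R + F_sq u + diff2_sq U + D_sq z + D'_sq Z) \<le> A_bilinear u U z Z v V w W"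
  proof -
    have "k ^ 4 / (64 * L ^ 3) * (?R + F_sq u + diff2_sq U + D_sq z + D'_sq Z) \<le>
      ?R / 2 - b1\<^sup>2 * (L * D_sq z) / 2 - b2\<^sup>2 * (L * D'_sq Z) / 2 + b1 * (k * D_sq z) + b2 * (k * D'_sq Z - L * (\<delta> * D'_sq Z + D_sq z / \<delta>))
      + b3 * (F_sq u / 4 - L * ?R) + b3 * (diff2_sq U - L * ?R)"
      by (rule weighted_estimates_combine[OF b \<delta>_def k01 L_ge(1) R nn(3-6)])
    also have "\<dots> \<le> A_bilinear u U z Z v V w W"
    proof -
      have "b2 * (k * D'_sq Z - L * (\<delta> * D'_sq Z + D_sq z / \<delta>)) \<le> b2 * (Gs Z ?V - coupling ?V z)"
        using b_le c1 G2 by (intro mult_left_mono) auto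
      moreover note mult_left_mono[OF G1 less_imp_le[OF b_le(1)]] mult_left_mono[OF G3 less_imp_le[OF b_le(5)]]
        mult_left_mono[OF G4 less_imp_le[OF b_le(5)]]
      ultimately show ?thesis unfolding A_eq using st1 st2 by argo
    qed
    finally show ?thesis .
  qed
  have EF: "F'_sq U \<le> diff2_sq U + L * R_U U U" using F'_sq_le[of U] scale[OF L_ge(7) nn(2)] by linarith
  have F0: "0 \<le> F'_sq U" using diff2_sq_le[of U] nn by linarith
  have "stability_sq u U z Z \<le> 2 * L * (?R + F_sq u + diff2_sq U + D_sq z + D'_sq Z)"
  proof -
    let ?X = "?R + F_sq u + diff2_sq U + D_sq z + D'_sq Z"
    have "stability_sq u U z Z \<le> ?X + L * R_U U U" using EF by (simp add: stability_sq_def)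
    moreover have "L * R_U U U \<le> L * ?X" using nn L0 by (intro mult_left_mono) auto
    moreover have "?X \<le> L * ?X"
      using scale[OF L_ge(1), of ?X] nn by simp
    moreover have "2 * L * ?X = L * ?X + L * ?X" by simp
    ultimately show ?thesis by linarith
  qed
  then have "k ^ 4 / (128 * L ^ 4) * stability_sq u U z Z \<le> k ^ 4 / (128 * L ^ 4) * (2 * L * (?R + F_sq u + diff2_sq U + D_sq z + D'_sq Z))"
    by (rule mult_left_mono) (use k01 L0 in auto)
  also have "\<dots> = k ^ 4 / (64 * L ^ 3) * (?R + F_sq u + diff2_sq U + D_sq z + D'_sq Z)"
    using L0 by (simp add: field_simps power_numeral_reduce)
  finally show "k ^ 4 / (128 * L ^ 4) * stability_sq u U z Z \<le> A_bilinear u U z Z v V w W" using main by linarith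
  have sq_le: "b\<^sup>2 * X \<le> X" if "0 < b" "b \<le> 1" "0 \<le> X" for b X :: real
    using mult_right_mono[OF power_le_one[of b 2] that(3)] that by simp
  have sum_young: "\<tau> * (\<Sum>n\<in>A. p.sq (- x n + b3 *\<^sub>R y n)) \<le>
      2 * (\<tau> * (\<Sum>n\<in>A. p.sq (x n))) + 2 * (\<tau> * (\<Sum>n\<in>A. p.sq (y n)))" for A and x y :: "nat \<Rightarrow> 'v"
  proof -
    have "p.sq (- x n + b3 *\<^sub>R y n) \<le> 2 * p.sq (x n) + 2 * p.sq (y n)" for n
      using p.add_le[of "- x n" "b3 *\<^sub>R y n"] sq_le[OF b_le(5,6) p.nonneg[of "y n"]]
      unfolding p.expand real_scaleR_def by (simp add: power2_eq_square)
    then have "(\<Sum>n\<in>A. p.sq (- x n + b3 *\<^sub>R y n)) \<le> (\<Sum>n\<in>A. 2 * p.sq (x n) + 2 * p.sq (y n))"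
      by (intro sum_mono)
    then have "\<tau> * (\<Sum>n\<in>A. p.sq (- x n + b3 *\<^sub>R y n)) \<le> \<tau> * (\<Sum>n\<in>A. 2 * p.sq (x n) + 2 * p.sq (y n))"
      using tau_pos by (intro mult_left_mono) auto
    then show ?thesis by (simp add: sum.distrib sum_distrib_left algebra_simps)
  qed
  have "R_u v v \<le> 2 * R_u u u + 2 * (L * D_sq z)"
    using R_u_young(2)[where u=u and r=b1 and v="?v"] sq_le[OF b_le(1,2) R_u_nonneg[of ?v]] S1 unfolding v by linarith
  moreover have "R_U V V \<le> 2 * R_U U U + 2 * (L * D'_sq Z)"
    using R_U_young(2)[where u=U and r=b2 and v="?V"] sq_le[OF b_le(3,4) R_U_nonneg[of ?V]] S2 unfolding V by linarith
  moreover have "\<tau> * (\<Sum>n=2..N. p.sq (w n)) \<le> 2 * (L * D_sq z) + 2 * (L * F_sq u)"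
  proof -
    have "4 * K\<^sup>2 * h\<^sup>2 * F_sq u \<le> L * 1 * F_sq u"
      using nn h2 L_ge(8) L0 by (intro mult_right_mono mult_mono) auto
    then show ?thesis
      using sum_young[of z "u_multiplier u" "{2..N}"] D_sq_ge[of z] u_multiplier_norm_le[of u] scale[OF L_ge(1) nn(5)] unfolding w by simp
  qed
  moreover have "\<tau> * (\<Sum>n=0..<N - 1. p.sq (W n)) \<le> 2 * (L * D'_sq Z) + 2 * (L * F'_sq U)"
    using sum_young[of Z "U_multiplier U" "{0..<N - 1}"] D'_sq_ge[of Z] U_multiplier_norm_le[of U] diff2_sq_le[of U]
      scale[OF L_ge(1) nn(6)] scale[OF L_ge(1) F0] unfolding W by simp
  moreover have "R_u u u \<le> L * R_u u u" "R_U U U \<le> L * R_U U U"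
    using scale[OF L_ge(1) nn(1)] scale[OF L_ge(1) nn(2)] by simp_all
  moreover have "0 \<le> L * R_u u u" "0 \<le> L * R_U U U" "0 \<le> L * F_sq u" "0 \<le> L * F'_sq U" "0 \<le> L * D_sq z" "0 \<le> L * D'_sq Z"
    using nn F0 L0 by simp_all
  moreover have "4 * L * stability_sq u U z Z = 4 * (L * R_u u u + L * R_U U U + L * F_sq u + L * F'_sq U + L * D_sq z + L * D'_sq Z)"
    by (simp add: stability_sq_def distrib_left)
  ultimately have C: "C_sq v V w W \<le> 4 * L * stability_sq u U z Z" unfolding C_sq_def by argo
  have S0: "0 \<le> stability_sq u U z Z" using nn F0 by (simp add: stability_sq_def)
  have "k ^ 4 / (128 * L ^ 4) * C_sq v V w W \<le> k ^ 4 / (128 * L ^ 4) * (4 * L * stability_sq u U z Z)"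
    using C by (rule mult_left_mono) (use k01 L0 in auto)
  also have "\<dots> = (k ^ 4 / (32 * L ^ 3)) * stability_sq u U z Z"
    using L0 by (simp add: field_simps power_numeral_reduce)
  also have "\<dots> \<le> 1 * stability_sq u U z Z"
  proof (rule mult_right_mono[OF _ S0])
    have "k ^ 4 \<le> 1" using k01 by (intro power_le_one) auto
    moreover have "1 \<le> L ^ 3" using L_ge(1) by (rule one_le_power)
    ultimately have "k ^ 4 \<le> 32 * L ^ 3" by linarith
    then show "k ^ 4 / (32 * L ^ 3) \<le> 1" using L0 by simp
  qed
  finally show "k ^ 4 / (128 * L ^ 4) * C_sq v V w W \<le> stability_sq u U z Z" by simp
qed

end

section \<open>Functions as vectors\<close>

text \<open>The abstract estimates are about sequences in a real vector space, hence functions are equipped with pointwise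
scalar multiplication.\<close>

instantiation "fun" :: (type, real_vector) real_vector
begin

definition scaleR_fun :: "real \<Rightarrow> ('a \<Rightarrow> 'b) \<Rightarrow> 'a \<Rightarrow> 'b" where
  "scaleR_fun r f = (\<lambda>x. r *\<^sub>R f x)"

instance
  by standard (simp_all add: scaleR_fun_def fun_eq_iff algebra_simps)

end

lemma scaleR_fun_apply [simp]: "(r *\<^sub>R f) x = r *\<^sub>R f x"
  by (simp add: scaleR_fun_def)

lemma sum_fun_apply: "(\<Sum>i\<in>A. f i) x = (\<Sum>i\<in>A. f i x)" for f :: "'i \<Rightarrow> 'a \<Rightarrow> 'b::real_vector"
  by (induction A rule: infinite_finite_induct) auto

lemma dt_eq_bdiff: "dt \<tau> u n = bdiff \<tau> u n"
  by (simp add: dt_def bdiff_def fun_eq_iff)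

lemma dtt_eq_bdiff2: "dtt \<tau> u n = bdiff2 \<tau> u n"
  by (simp add: dtt_def bdiff2_def fun_eq_iff)

lemma dtt_fwd_eq_fdiff2: "dtt_fwd \<tau> u n = fdiff2 \<tau> u n"
  by (simp add: dtt_fwd_def fdiff2_def fun_eq_iff)

lemma I_op_eq_wsum: "I_op \<tau> z n = wsum \<tau> z n"
  by (simp add: I_op_def wsum_def fun_eq_iff sum_fun_apply)

lemma I_op_bwd_eq_wsum_bwd: "I_op_bwd \<tau> N z n = wsum_bwd \<tau> N z n"
  by (simp add: I_op_bwd_def wsum_bwd_def fun_eq_iff sum_fun_apply)

lemma subspace_Vh:
  assumes "open \<Omega>h"
  shows "subspace (Vh \<Omega>h Th)"
proof (rule subspaceI)
  show "0 \<in> Vh \<Omega>h Th" using Vh_zero[OF assms] by (simp add: zero_fun_def)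
  show "x + y \<in> Vh \<Omega>h Th" if "x \<in> Vh \<Omega>h Th" "y \<in> Vh \<Omega>h Th" for x y
    using Vh_lincomb[OF assms that, of 1] by (simp add: plus_fun_def)
  show "c *\<^sub>R x \<in> Vh \<Omega>h Th" if "x \<in> Vh \<Omega>h Th" for c x
    using Vh_lincomb[OF assms Vh_zero[OF assms] that, of c] by (simp add: scaleR_fun_def)
qed

text \<open>The forms on the finite element space are bilinear on that subspace only.  Composing them with a linear projection
gives forms that are bilinear on all functions.\<close>

lemma linear_projection_exists:
  assumes "subspace S"
  shows "\<exists>P. linear P \<and> range P \<subseteq> S \<and> (\<forall>v\<in>S. P v = v)"
proof -
  obtain g where "g ` UNIV \<subseteq> S" "linear g" "\<forall>v\<in>S. g (id v) = v"
    using linear_exists_left_inverse_on[OF linear_id assms inj_on_id] by blast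
  then show ?thesis by auto
qed

lemma bilinear_via_projection:
  fixes B :: "('a \<Rightarrow> real) \<Rightarrow> ('a \<Rightarrow> real) \<Rightarrow> real"
  assumes P: "linear P" "range P \<subseteq> S" and zero: "0 \<in> S"
    and left: "\<And>f g k r. f \<in> S \<Longrightarrow> g \<in> S \<Longrightarrow> k \<in> S \<Longrightarrow> B (\<lambda>x. f x + r * g x) k = B f k + r * B g k"
    and right: "\<And>f g k r. f \<in> S \<Longrightarrow> g \<in> S \<Longrightarrow> k \<in> S \<Longrightarrow> B k (\<lambda>x. f x + r * g x) = B k f + r * B k g"
  shows "bilinear (\<lambda>u v. B (P u) (P v))"
proof -
  have S: "P u \<in> S" for u using P(2) by blast
  have add: "P (x + y) = (\<lambda>t. P x t + 1 * P y t)" for x y using linear_add[OF P(1)] by (simp add: plus_fun_def)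
  have scale: "P (c *\<^sub>R x) = (\<lambda>t. 0 t + c * P x t)" for c x using linear_scale[OF P(1)] by (simp add: scaleR_fun_def)
  have zl: "B 0 k = 0" "B k 0 = 0" if "k \<in> S" for k
    using left[OF zero zero that, of "-1"] right[OF zero zero that, of "-1"] by (simp_all add: zero_fun_def)
  show ?thesis
    unfolding bilinear_def
  proof (intro conjI allI linearI)
    fix x y z c
    show "B (P z) (P (x + y)) = B (P z) (P x) + B (P z) (P y)" unfolding add right[OF S S S] by simp
    show "B (P (x + y)) (P z) = B (P x) (P z) + B (P y) (P z)" unfolding add left[OF S S S] by simp
    show "B (P z) (P (c *\<^sub>R x)) = c *\<^sub>R B (P z) (P x)" unfolding scale right[OF zero S S] by (simp add: zl S)
    show "B (P (c *\<^sub>R x)) (P z) = c *\<^sub>R B (P x) (P z)" unfolding scale left[OF zero S S] by (simp add: zl S)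
  qed
qed

lemma subspace_time_ops:
  assumes S: "subspace S" and u: "\<And>n. u n \<in> S"
  shows "bdiff \<tau> u n \<in> S" "bdiff2 \<tau> u n \<in> S" "fdiff2 \<tau> u n \<in> S" "wsum \<tau> u n \<in> S" "wsum_bwd \<tau> N u n \<in> S"
  unfolding bdiff_def bdiff2_def fdiff2_def wsum_def wsum_bwd_def
  using S u by (auto intro!: subspace_scale subspace_add subspace_diff subspace_sum)

section \<open>From abstract forms to finite elements\<close>

lemma weak_grad_bdiff:
  assumes op: "open \<Omega>" and U: "U n \<in> H1 \<Omega>" "U (n - 1) \<in> H1 \<Omega>"
  shows "AE x in lebesgue_on \<Omega>. weak_grad \<Omega> (bdiff \<tau> U n) x = dt \<tau> (\<lambda>n. weak_grad \<Omega> (U n)) n x"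
    and "bdiff \<tau> U n \<in> H1 \<Omega>" and "dt \<tau> (\<lambda>n. weak_grad \<Omega> (U n)) n \<in> L2 \<Omega>"
proof -
  note h = H1_lincomb[OF op U, of "-1"]
  let ?D = "\<lambda>x. U n x + (-1) * U (n - 1) x"
  have z: "(\<lambda>x. 0) \<in> H1 \<Omega>" using H1_0_zero[OF op] by (simp add: H1_0_def)
  have zg: "AE x in lebesgue_on \<Omega>. weak_grad \<Omega> (\<lambda>x. 0) x = 0"
    using H1_lincomb(2)[OF op z z, of "-1"] by simp
  have eq: "bdiff \<tau> U n = (\<lambda>x. 0 + (1 / \<tau>) * ?D x)"
    by (simp add: bdiff_def fun_eq_iff divide_inverse)
  show "bdiff \<tau> U n \<in> H1 \<Omega>" unfolding eq by (rule H1_lincomb(1)[OF op z h(1)])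
  show ae: "AE x in lebesgue_on \<Omega>. weak_grad \<Omega> (bdiff \<tau> U n) x = dt \<tau> (\<lambda>n. weak_grad \<Omega> (U n)) n x"
    using H1_lincomb(2)[OF op z h(1), of "1 / \<tau>"] h(2) zg unfolding eq
    by eventually_elim (simp add: dt_def divide_inverse)
  show "dt \<tau> (\<lambda>n. weak_grad \<Omega> (U n)) n \<in> L2 \<Omega>"
    using H1_weak_grad(2)[OF op H1_lincomb(1)[OF op z h(1)]] ae unfolding eq by (rule L2_cong_AE[OF op])
qed

lemma L2_inner_dt_weak_grad:
  assumes op: "open \<Omega>" and "\<And>n. U n \<in> H1 \<Omega>" "\<And>n. V n \<in> H1 \<Omega>"
  shows "L2_inner \<Omega> (dt \<tau> (\<lambda>n. weak_grad \<Omega> (U n)) n) (dt \<tau> (\<lambda>n. weak_grad \<Omega> (V n)) n) = a_form \<Omega> (bdiff \<tau> U n) (bdiff \<tau> V n)"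
proof -
  note U = weak_grad_bdiff[where U=U and n=n and \<tau>=\<tau>, OF op assms(2) assms(2)]
    and V = weak_grad_bdiff[where U=V and n=n and \<tau>=\<tau>, OF op assms(3) assms(3)]
  show ?thesis unfolding a_form_def
    by (rule L2_inner_cong_AE[symmetric, OF H1_weak_grad(2)[OF op U(2)] H1_weak_grad(2)[OF op V(2)] U(3) V(3) U(1) V(1)])
qed

lemma L2_inner_scaleR: "L2_inner \<Omega> (\<lambda>x. r *\<^sub>R f x) (\<lambda>x. r *\<^sub>R g x) = r\<^sup>2 * L2_inner \<Omega> f g"
  by (simp add: L2_inner_def power2_eq_square mult.assoc)

text \<open>The forms composed with a projection onto the finite element space satisfy the assumptions of \<open>discrete_wave\<close>,
and on sequences in that space the abstract quantities are the concrete ones.\<close>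

lemma fem_inf_sup:
  fixes \<Omega>h :: "'a::euclidean_space set"
  assumes op: "open \<Omega>h"
    and chi: "chi \<in> borel_measurable (lebesgue_on \<Omega>h)" "AE x in lebesgue_on \<Omega>h. \<bar>chi x\<bar> \<le> K"
    and poincare: "\<And>v. v \<in> Vh \<Omega>h Th \<Longrightarrow> L2_inner \<Omega>h v v \<le> K * a_form \<Omega>h v v"
    and inverse: "\<And>v. v \<in> Vh \<Omega>h Th \<Longrightarrow> h\<^sup>2 * a_form \<Omega>h v v \<le> K * L2_inner \<Omega>h v v"
    and K: "1 \<le> K" "T \<le> K" and T: "0 < T" and h: "0 < h" "h \<le> 1"
    and \<tau>: "\<tau> = T / real N" "\<tau> \<le> K * h" and N: "2 \<le> N"
    and x: "x \<in> Vh4N \<Omega>h Th N"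
    and k: "k = 1 / (2 * (1 + 2 * K)\<^sup>2)" and L: "L = 40 * K ^ 7"
  shows "\<exists>y\<in>Vh4N \<Omega>h Th N. A_form \<Omega>h chi h \<tau> N x y \<ge> k ^ 4 / (128 * L ^ 4) * stab_sq \<Omega>h h \<tau> N x \<and>
     stab_sq \<Omega>h h \<tau> N x \<ge> k ^ 4 / (128 * L ^ 4) * norm_C_sq \<Omega>h h \<tau> N y"
proof -
  let ?S = "Vh \<Omega>h Th"
  note sub = subspace_Vh[OF op, of Th]
  obtain P where P: "linear P" "range P \<subseteq> ?S" "\<And>v. v \<in> ?S \<Longrightarrow> P v = v"
    using linear_projection_exists[OF sub] by blast
  have PS: "P v \<in> ?S" for v using P(2) by blast
  have S_H1: "v \<in> H1 \<Omega>h" if "v \<in> ?S" for v using that by (rule Vh_H1)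
  have S_L2: "v \<in> L2 \<Omega>h" if "v \<in> ?S" for v using H1_weak_grad(3)[OF op S_H1[OF that]] .
  note chi_L2 = chi_mult_L2[OF chi S_L2]
  define p where "p = (\<lambda>u v. L2_inner \<Omega>h (P u) (P v))"
  define a where "a = (\<lambda>u v. a_form \<Omega>h (P u) (P v))"
  define c where "c = (\<lambda>u v. L2_inner \<Omega>h (\<lambda>x. chi x * P u x) (P v))"
  have L2l: "L2_inner \<Omega>h (\<lambda>x. f x + r * g x) k = L2_inner \<Omega>h f k + r * L2_inner \<Omega>h g k"
    if "f \<in> L2 \<Omega>h" "g \<in> L2 \<Omega>h" "k \<in> L2 \<Omega>h" for f g k :: "'a \<Rightarrow> real" and r
    using L2_inner_lincomb[OF that] by simp
  have L2r: "L2_inner \<Omega>h k (\<lambda>x. f x + r * g x) = L2_inner \<Omega>h k f + r * L2_inner \<Omega>h k g"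
    if "f \<in> L2 \<Omega>h" "g \<in> L2 \<Omega>h" "k \<in> L2 \<Omega>h" for f g k :: "'a \<Rightarrow> real" and r
    using L2l[OF that] by (simp only: L2_inner_commute[of \<Omega>h k])
  have p_bil: "bilinear p" unfolding p_def
    by (rule bilinear_via_projection[OF P(1,2) subspace_0[OF sub]]) (intro L2l L2r S_L2; assumption)+
  have a_bil: "bilinear a" unfolding a_def
  proof (rule bilinear_via_projection[OF P(1,2) subspace_0[OF sub]])
    fix f g k r assume S: "f \<in> ?S" "g \<in> ?S" "k \<in> ?S"
    show 1: "a_form \<Omega>h (\<lambda>x. f x + r * g x) k = a_form \<Omega>h f k + r * a_form \<Omega>h g k"
      by (rule a_form_lincomb[OF op S_H1[OF S(1)] S_H1[OF S(2)] S_H1[OF S(3)]])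
    then show "a_form \<Omega>h k (\<lambda>x. f x + r * g x) = a_form \<Omega>h k f + r * a_form \<Omega>h k g"
      by (simp only: a_form_commute[of \<Omega>h k])
  qed
  have c_bil: "bilinear c" unfolding c_def
  proof (rule bilinear_via_projection[OF P(1,2) subspace_0[OF sub]])
    fix f g k r assume S: "f \<in> ?S" "g \<in> ?S" "k \<in> ?S"
    have "(\<lambda>x. chi x * (f x + r * g x)) = (\<lambda>x. chi x * f x + r * (chi x * g x))" by (simp add: fun_eq_iff algebra_simps)
    then show "L2_inner \<Omega>h (\<lambda>x. chi x * (f x + r * g x)) k = L2_inner \<Omega>h (\<lambda>x. chi x * f x) k + r * L2_inner \<Omega>h (\<lambda>x. chi x * g x) k"
      using L2l[OF chi_L2[OF S(1)] chi_L2[OF S(2)] S_L2[OF S(3)]] by simp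
    show "L2_inner \<Omega>h (\<lambda>x. chi x * k x) (\<lambda>x. f x + r * g x) = L2_inner \<Omega>h (\<lambda>x. chi x * k x) f + r * L2_inner \<Omega>h (\<lambda>x. chi x * k x) g"
      by (rule L2r[OF S_L2[OF S(1)] S_L2[OF S(2)] chi_L2[OF S(3)]])
  qed
  interpret discrete_wave p a c h \<tau> T K N
  proof
    show "bilinear p" "bilinear a" "bilinear c" by fact+
    fix x y
    show "p x y = p y x" "a x y = a y x" by (simp_all add: p_def a_def L2_inner_commute a_form_commute)
    show "0 \<le> p x x" "0 \<le> a x x" by (simp_all add: p_def a_def L2_inner_nonneg a_form_nonneg)
    show "c x y \<le> K * (p x x + p y y) / 2"
      unfolding c_def p_def by (rule chi_coupling_le[OF chi S_L2[OF PS] S_L2[OF PS]])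
    show "p x x \<le> K * a x x" unfolding p_def a_def by (rule poincare[OF PS])
    show "h\<^sup>2 * a x x \<le> K * p x x" unfolding p_def a_def by (rule inverse[OF PS])
  qed fact+
  have p_eq: "p u v = L2_inner \<Omega>h u v" and a_eq: "a u v = a_form \<Omega>h u v" and c_eq: "c u v = L2_inner \<Omega>h (\<lambda>x. chi x * u x) v"
    if "u \<in> ?S" "v \<in> ?S" for u v
    using that by (simp_all add: p_def a_def c_def P(3))
  note ops = subspace_time_ops[OF sub]
  note to_ops = dt_eq_bdiff dtt_eq_bdiff2 dtt_fwd_eq_fdiff2 I_op_eq_wsum I_op_bwd_eq_wsum_bwd
  have G_conv: "G_form \<Omega>h \<tau> N u z = G u z" if "\<And>n. u n \<in> ?S" "\<And>n. z n \<in> ?S" for u z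
    by (simp add: G_form_def G_def to_ops p_eq a_eq ops that)
  have Gs_conv: "Gstar_form \<Omega>h \<tau> N z u = Gs z u" if "\<And>n. u n \<in> ?S" "\<And>n. z n \<in> ?S" for u z
    by (simp add: Gstar_form_def Gs_def to_ops p_eq a_eq ops that)
  have coupling_conv: "\<tau> * (\<Sum>n=2..N. L2_inner \<Omega>h (\<lambda>x. chi x * V n x) (z n)) = coupling V z" if "\<And>n. V n \<in> ?S" "\<And>n. z n \<in> ?S" for V z
    by (simp add: coupling_def c_eq that)
  have grad_conv: "L2_inner \<Omega>h (bdiff \<tau> (\<lambda>n. weak_grad \<Omega>h (U n)) n) (bdiff \<tau> (\<lambda>n. weak_grad \<Omega>h (V n)) n) = a (bdiff \<tau> U n) (bdiff \<tau> V n)"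
    if "\<And>n. U n \<in> ?S" "\<And>n. V n \<in> ?S" for U V n
    by (subst L2_inner_dt_weak_grad[OF op S_H1[OF that(1)] S_H1[OF that(2)], unfolded dt_eq_bdiff]) (simp add: a_eq ops that)
  have A_conv: "A_form \<Omega>h chi h \<tau> N (u, U, z, Z) (v, V, w, W) = A_bilinear u U z Z v V w W"
    if S: "\<And>n. u n \<in> ?S" "\<And>n. U n \<in> ?S" "\<And>n. z n \<in> ?S" "\<And>n. Z n \<in> ?S"
      "\<And>n. v n \<in> ?S" "\<And>n. V n \<in> ?S" "\<And>n. w n \<in> ?S" "\<And>n. W n \<in> ?S" for u U z Z v V w W
    unfolding A_form_def A_bilinear_def R_u_def R_U_def Let_def split
    by (simp add: G_conv Gs_conv coupling_conv grad_conv L2_inner_scaleR to_ops a_form_def[symmetric] p_eq[symmetric] a_eq[symmetric] S ops)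
  have R_conv: "norm_R_sq \<Omega>h h \<tau> N u U = R_u u u + R_U U U" if S: "\<And>n. u n \<in> ?S" "\<And>n. U n \<in> ?S" for u U
    unfolding norm_R_sq_def R_u_def R_U_def Let_def L2_norm_sq
    by (simp add: grad_conv L2_inner_scaleR to_ops a_form_def[symmetric] p_eq[symmetric] a_eq[symmetric] S ops)
  have stab_conv: "stab_sq \<Omega>h h \<tau> N (u, U, z, Z) = stability_sq u U z Z"
    if S: "\<And>n. u n \<in> ?S" "\<And>n. U n \<in> ?S" "\<And>n. z n \<in> ?S" "\<And>n. Z n \<in> ?S" for u U z Z
  proof -
    have "h\<^sup>2 * norm_F_sq \<Omega>h \<tau> N u = F_sq u"
      unfolding norm_F_sq_def F_sq_def L2_norm_sq
      by (simp add: to_ops a_form_def[symmetric] p_eq[symmetric] a_eq[symmetric] S ops)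
    moreover have "h\<^sup>2 * norm_F'_sq \<Omega>h \<tau> N U = F'_sq U"
      unfolding norm_F'_sq_def F'_sq_def Let_def L2_norm_sq
      by (simp add: grad_conv to_ops a_form_def[symmetric] p_eq[symmetric] a_eq[symmetric] S ops)
    moreover have "norm_D_sq \<Omega>h \<tau> N z = D_sq z" "norm_D'_sq \<Omega>h \<tau> N Z = D'_sq Z"
      unfolding norm_D_sq_def norm_D'_sq_def D_sq_def D'_sq_def L2_norm_sq
      by (simp_all add: to_ops a_form_def[symmetric] p_eq[symmetric] a_eq[symmetric] S ops)
    ultimately show ?thesis by (simp add: stab_sq_def stability_sq_def R_conv S)
  qed
  have C_conv: "norm_C_sq \<Omega>h h \<tau> N (v, V, w, W) = C_sq v V w W"
    if S: "\<And>n. v n \<in> ?S" "\<And>n. V n \<in> ?S" "\<And>n. w n \<in> ?S" "\<And>n. W n \<in> ?S" for v V w W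
    by (simp add: norm_C_sq_def C_sq_def R_conv L2_norm_sq p_eq S)
  obtain u U z Z where x_eq: "x = (u, U, z, Z)" by (metis prod.exhaust)
  have zero_S: "(\<lambda>x. 0) \<in> ?S" by (rule Vh_zero[OF op])
  have mem: "u \<in> seqs_on {0..N} ?S" "U \<in> seqs_on {0..N} ?S" "z \<in> seqs_on {2..N} ?S" "Z \<in> seqs_on {0..<N - 1} ?S"
    using x by (auto simp: x_eq Vh4N_def)
  have seq_S: "f n \<in> ?S" if "f \<in> seqs_on J ?S" for f J n
    using that zero_S by (cases "n \<in> J") (auto simp: seqs_on_def)
  note S = seq_S[OF mem(1)] seq_S[OF mem(2)] seq_S[OF mem(3)] seq_S[OF mem(4)]
  have z0: "z n = 0" if "n \<notin> {2..N}" for n using mem(3) that unfolding seqs_on_def zero_fun_def by blast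
  have Z0: "Z n = 0" if "n \<notin> {0..<N - 1}" for n using mem(4) that unfolding seqs_on_def zero_fun_def by blast
  have u0: "u n = 0" "U n = 0" if "n \<notin> {0..N}" for n using mem(1,2) that unfolding seqs_on_def zero_fun_def by blast+
  define b1 where "b1 = k / L"
  define b2 where "b2 = k ^ 3 / (16 * L ^ 3)"
  define b3 where "b3 = 1 / (8 * L)"
  define v where "v = (\<lambda>n. u n + b1 *\<^sub>R wsum \<tau> z n)"
  define V where "V = (\<lambda>n. U n + b2 *\<^sub>R wsum_bwd \<tau> N Z n)"
  define w where "w = (\<lambda>n. - z n + b3 *\<^sub>R u_multiplier u n)"
  define W where "W = (\<lambda>n. - Z n + b3 *\<^sub>R U_multiplier U n)"
  \<comment> \<open>Beyond \<open>N\<close> the sum \<open>wsum \<tau> z\<close> stays constant, whereas members of \<open>Vh4N\<close> vanish there.\<close>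
  define v' where "v' = (\<lambda>n. if n \<le> N then v n else 0)"
  have "z 0 = 0" "z 1 = 0" "Z N = 0" "Z (N - 1) = 0" using z0 Z0 by auto
  note main = discrete_inf_sup[OF this k L b1_def b2_def b3_def v_def V_def w_def W_def]
  have u_multiplier_S: "u_multiplier u n \<in> ?S" "U_multiplier U n \<in> ?S" for n
    unfolding u_multiplier_def U_multiplier_def using sub S ops[OF S(1)] ops[OF S(2)] by (auto intro!: subspace_scale subspace_0)
  have y_S: "v n \<in> ?S" "V n \<in> ?S" "w n \<in> ?S" "W n \<in> ?S" "v' n \<in> ?S" for n
    unfolding v'_def v_def V_def w_def W_def using sub S u_multiplier_S ops[OF S(3)] ops[OF S(4)]
    by (auto intro!: subspace_scale subspace_add subspace_diff subspace_neg subspace_0)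
  have seqI: "f \<in> seqs_on J ?S" if "\<And>n. f n \<in> ?S" "\<And>n. n \<notin> J \<Longrightarrow> f n = 0" for f J
    using that unfolding seqs_on_def zero_fun_def by blast
  have y_mem: "(v', V, w, W) \<in> Vh4N \<Omega>h Th N"
    unfolding Vh4N_def
  proof (intro SigmaI seqI y_S)
    show "v' n = 0" if "n \<notin> {0..N}" for n using that by (simp add: v'_def)
    show "V n = 0" if "n \<notin> {0..N}" for n using that u0[OF that] by (simp add: V_def wsum_bwd_def)
    show "w n = 0" if "n \<notin> {2..N}" for n using that z0[OF that] by (auto simp: w_def u_multiplier_def)
    show "W n = 0" if "n \<notin> {0..<N - 1}" for n using that Z0[OF that] by (auto simp: W_def U_multiplier_def)
  qed
  have v_eq: "v' n = v n" if "n \<le> N" for n using that by (simp add: v'_def)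
  have bd: "bdiff \<tau> v' n = bdiff \<tau> v n" "bdiff2 \<tau> v' n = bdiff2 \<tau> v n" if "n \<le> N" for n
    using that by (simp_all add: bdiff_def bdiff2_def v_eq)
  have "G v' z = G v z" unfolding G_def
    by (intro arg_cong[where f="\<lambda>s. \<tau> * s"] sum.cong refl) (simp add: bd v_eq)
  moreover have "R_u u v' = R_u u v" "R_u v' v' = R_u v v"
    using N by (simp_all add: R_u_def bd v_eq)
  ultimately have "A_bilinear u U z Z v' V w W = A_bilinear u U z Z v V w W" "C_sq v' V w W = C_sq v V w W"
    by (simp_all add: A_bilinear_def C_sq_def)
  with main show ?thesis
    unfolding x_eq
    by (intro bexI[OF _ y_mem]) (simp add: A_conv stab_conv C_conv S y_S)
qed

theorem proposition3p1:
  fixes \<Omega> \<omega> :: "(real ^ 'n) set"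
    and chi\<omega> :: "real ^ 'n \<Rightarrow> real"
    and T c1 c2 Cgeo Cchi \<sigma> \<kappa> :: real
    and H :: "real set"
    and \<Omega>h :: "real \<Rightarrow> (real ^ 'n) set"
    and Th :: "real \<Rightarrow> (real ^ 'n) set set"
    and chih :: "real \<Rightarrow> real ^ 'n \<Rightarrow> real"
  assumes dim: "CARD('n) \<in> {2, 3}"
    and "T > 0"
    and "open \<Omega>" "bounded \<Omega>" "connected \<Omega>" "\<Omega> \<noteq> {}" "smooth_boundary \<Omega>"
    and "open \<omega>" "\<omega> \<subseteq> \<Omega>"
    and "smooth_on UNIV chi\<omega>"
    and "\<forall>x\<in>closure \<Omega>. 0 \<le> chi\<omega> x" "\<forall>x\<in>\<Omega> - \<omega>. chi\<omega> x = 0"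
    and "c1 > 0" "c2 > 0"
    and "\<forall>h\<in>H. 0 < h \<and> mesh_size (Th h) = h"
    and "\<forall>h\<in>H. mesh_of (\<Omega>h h) (Th h)"
    and "\<forall>h\<in>H. quasi_uniform \<sigma> \<kappa> (Th h)"
    and "\<forall>h\<in>H. \<forall>x\<in>frontier (\<Omega>h h). infdist x (frontier \<Omega>) \<le> Cgeo * h\<^sup>2"
    and "\<forall>h\<in>H. continuous_on (\<Omega>h h) (chih h) \<and> (\<forall>x\<in>\<Omega>h h. 0 \<le> chih h x) \<and>
                (\<forall>K\<in>Th h. affine_fun_on K (chih h))"
    and "\<forall>h\<in>H. Linf_norm (\<Omega>h h) (\<lambda>x. chi\<omega> x - chih h x)
                + ereal h * W1inf_norm (\<Omega>h h) (\<lambda>x. chi\<omega> x - chih h x) \<le> ereal (Cchi * h\<^sup>2)"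
  shows "\<exists>h0>0. \<exists>C>0. \<forall>h\<in>H. h < h0 \<longrightarrow>
           (\<forall>N \<tau>. N > 0 \<and> \<tau> = T / real N \<and> c1 * h \<le> \<tau> \<and> \<tau> \<le> c2 * h \<longrightarrow>
             (\<forall>x \<in> Vh4N (\<Omega>h h) (Th h) N. \<exists>y \<in> Vh4N (\<Omega>h h) (Th h) N.
                A_form (\<Omega>h h) (chih h) h \<tau> N x y \<ge> C * stab_sq (\<Omega>h h) h \<tau> N x \<and>
                stab_sq (\<Omega>h h) h \<tau> N x \<ge> C * norm_C_sq (\<Omega>h h) h \<tau> N y))"
proof -
  obtain R where R: "0 \<le> R" "\<forall>\<Omega>h Th h. mesh_of \<Omega>h Th \<and> 0 < h \<and> h \<le> 1 \<and>
     (\<forall>x\<in>frontier \<Omega>h. infdist x (frontier \<Omega>) \<le> Cgeo * h\<^sup>2) \<longrightarrow> \<Omega>h \<subseteq> cball 0 R"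
    using mesh_domain_uniformly_bounded[OF \<open>bounded \<Omega>\<close> \<open>\<Omega> \<noteq> {}\<close>, of Cgeo] by blast
  have "continuous_on (cball 0 R) chi\<omega>"
    using smooth_on_continuous[OF \<open>smooth_on UNIV chi\<omega>\<close>] by (rule continuous_on_subset) simp
  then have "bounded (chi\<omega> ` cball 0 R)" by (intro compact_imp_bounded compact_continuous_image) auto
  then obtain B where B: "\<And>x. x \<in> cball 0 R \<Longrightarrow> \<bar>chi\<omega> x\<bar> \<le> B"
    unfolding bounded_iff ball_simps real_norm_def by blast
  have B0: "0 \<le> B" using order_trans[OF abs_ge_zero B[of 0]] R(1) by simp
  define Cinv where "Cinv = 2 ^ (DIM(real ^ 'n) + 2) * (2 * \<sigma> * \<kappa>)\<^sup>2"
  define K where "K = 1 + T + (B + \<bar>Cchi\<bar>) + 16 * R\<^sup>2 + Cinv + c2"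
  have Cinv0: "0 \<le> Cinv" by (simp add: Cinv_def)
  have R16: "0 \<le> 16 * R\<^sup>2" by simp
  have K: "1 \<le> K" "T \<le> K" "B + \<bar>Cchi\<bar> \<le> K" "16 * R\<^sup>2 \<le> K" "Cinv \<le> K" "c2 \<le> K"
    unfolding K_def using \<open>T > 0\<close> \<open>c2 > 0\<close> B0 Cinv0 R16 abs_ge_zero[of Cchi] by linarith+
  define k where "k = 1 / (2 * (1 + 2 * K)\<^sup>2)"
  define L where "L = 40 * K ^ 7"
  \<comment> \<open>The second bound makes \<open>\<tau> \<le> T/2\<close>, so there are at least two time steps.\<close>
  define h0 where "h0 = min 1 (T / (2 * c2))"
  show ?thesis
  proof (rule exI[of _ h0], intro conjI exI[of _ "k ^ 4 / (128 * L ^ 4)"] ballI impI allI)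
    show "0 < h0" using \<open>T > 0\<close> \<open>c2 > 0\<close> by (simp add: h0_def)
    have "0 < (1 + 2 * K)\<^sup>2" "0 < L" using K(1) by (auto simp: L_def)
    then show "0 < k ^ 4 / (128 * L ^ 4)" by (simp add: k_def)
  next
    fix h N \<tau> x
    assume hH: "h \<in> H" and hh0: "h < h0" and "N > 0 \<and> \<tau> = T / real N \<and> c1 * h \<le> \<tau> \<and> \<tau> \<le> c2 * h"
      and x: "x \<in> Vh4N (\<Omega>h h) (Th h) N"
    then have N0: "N > 0" and \<tau>: "\<tau> = T / real N" "\<tau> \<le> c2 * h" by auto
    have h: "0 < h" "h \<le> 1" and hT: "h < T / (2 * c2)" and ms: "mesh_size (Th h) = h" using hH hh0 assms by (auto simp: h0_def)
    have mesh: "mesh_of (\<Omega>h h) (Th h)" and qu: "quasi_uniform \<sigma> \<kappa> (Th h)"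
      and geo: "\<forall>x\<in>frontier (\<Omega>h h). infdist x (frontier \<Omega>) \<le> Cgeo * h\<^sup>2"
      and cont: "continuous_on (\<Omega>h h) (chih h)"
      and err: "Linf_norm (\<Omega>h h) (\<lambda>x. chi\<omega> x - chih h x) + ereal h * W1inf_norm (\<Omega>h h) (\<lambda>x. chi\<omega> x - chih h x) \<le> ereal (Cchi * h\<^sup>2)"
      using hH assms by blast+
    have op: "open (\<Omega>h h)" by (rule mesh_basic(2)[OF mesh])
    have sub: "\<Omega>h h \<subseteq> cball 0 R" using R(2) mesh h geo by blast
    have "2 \<le> N"
    proof (rule ccontr)
      assume "\<not> 2 \<le> N"
      then have "N = 1" using N0 by simp
      then have "\<tau> = T" using \<tau>(1) by simp
      moreover have "c2 * h < T / 2" using hT \<open>c2 > 0\<close> by (simp add: field_simps)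
      ultimately show False using \<tau>(2) \<open>T > 0\<close> by linarith
    qed
    have "c2 * h \<le> K * h" using K(6) h(1) by (intro mult_right_mono) auto
    then have \<tau>K: "\<tau> \<le> K * h" using \<tau>(2) by linarith
    have meas: "chih h \<in> borel_measurable (lebesgue_on (\<Omega>h h))"
      by (rule continuous_imp_measurable_on_sets_lebesgue[OF cont]) (use op in simp)
    have Cchi_le: "Cchi * h\<^sup>2 \<le> \<bar>Cchi\<bar> * 1" using h by (intro mult_mono) (auto simp: power_le_one)
    have "AE x in lebesgue_on (\<Omega>h h). \<bar>chih h x\<bar> \<le> B + Cchi * h\<^sup>2"
      by (rule chih_bound_AE[OF op _ h(1) err]) (use B sub in blast)
    then have bound: "AE x in lebesgue_on (\<Omega>h h). \<bar>chih h x\<bar> \<le> K"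
      by eventually_elim (use K(3) Cchi_le in linarith)
    have poin: "L2_inner (\<Omega>h h) v v \<le> K * a_form (\<Omega>h h) v v" if "v \<in> Vh (\<Omega>h h) (Th h)" for v
      using poincare_H1_0[OF op sub Vh_H1_0[OF that]] mult_right_mono[OF K(4) a_form_nonneg, of "\<Omega>h h" v] by linarith
    have inv: "h\<^sup>2 * a_form (\<Omega>h h) v v \<le> K * L2_inner (\<Omega>h h) v v" if "v \<in> Vh (\<Omega>h h) (Th h)" for v
      using inverse_inequality[OF mesh qu ms h(1) that, folded Cinv_def] mult_right_mono[OF K(5) L2_inner_nonneg, of "\<Omega>h h" v] by linarith
    show "\<exists>y\<in>Vh4N (\<Omega>h h) (Th h) N.
        A_form (\<Omega>h h) (chih h) h \<tau> N x y \<ge> k ^ 4 / (128 * L ^ 4) * stab_sq (\<Omega>h h) h \<tau> N x \<and>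
        stab_sq (\<Omega>h h) h \<tau> N x \<ge> k ^ 4 / (128 * L ^ 4) * norm_C_sq (\<Omega>h h) h \<tau> N y"
      by (rule fem_inf_sup[OF op meas bound poin inv K(1,2) \<open>T > 0\<close> h \<tau>(1) \<tau>K \<open>2 \<le> N\<close> x k_def L_def])
  qed
qed

end
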